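(* Let $-1<q<1$. Let $\mathfrak R_q$ and $\mathfrak G_q$ be the unital $C^*$-algebras on the $q$-deformed Fock space $\Gamma_q(\ell^2(\mathbb Z))$ generated respectively by the annihilators $\{a_i\mid i\in\mathbb Z\}$ and by their selfadjoint parts $\{s_i=a_i+a_i^\dagger\mid i\in\mathbb Z\}$. Then each of the sets $\mathcal S_{\mathbb P_{\mathbb Z}}(\mathfrak R_q)$ and $\mathcal S_{\mathbb P_{\mathbb Z}}(\mathfrak G_q)$ of states invariant under the action of $\mathbb P_{\mathbb Z}$ consists of exactly one element, namely the Fock vacuum expectation $\omega_q=\langle\,\cdot\,\Omega,\Omega\rangle$.
   Context: For a Hilbert space $\mathcal H$, $\Gamma_q(\mathcal H)$ is the completion of the linear span of the vacuum vector $\Omega$ and the vectors $f_1\otimes\cdots\otimes f_n$ ($f_j\in\mathcal H$, $n\geq1$) with respect to the inner product (linear in the first argument) $$\langle f_1\otimes\cdots\otimes f_n,g_1\otimes\cdots\otimes g_m\rangle_q=\delta_{n,m}\sum_{\pi\in\mathbb P_n}q^{i(\pi)}\langle f_1,g_{\pi(1)}\rangle\cdots\langle f_n,g_{\pi(n)}\rangle,$$ with $\mathbb P_n$ the symmetric group and $i(\pi)$ the number of inversions of $\pi$ (and $\Omega$ a unit vector orthogonal to all tensors with $n\ge 1$). The creator is $a_q^\dagger(f)\Omega=f$, $a_q^\dagger(f)f_1\otimes\cdots\otimes f_n=f\otimes f_1\otimes\cdots\otimes f_n$; the annihilator is its adjoint: $a_q(f)\Omega=0$, $a_q(f)(f_1\otimes\cdots\otimes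 f_n)=\sum_{k=1}^nq^{k-1}\langle f_k,f\rangle f_1\otimes\cdots\otimes f_{k-1}\otimes f_{k+1}\otimes\cdots\otimes f_n$. With $\mathcal H=\ell^2(\mathbb Z)$ and canonical basis $\{e_i\}_{i\in\mathbb Z}$, put $a_i:=a_q(e_i)$, $a_i^\dagger:=a_q^\dagger(e_i)$. $\mathbb P_{\mathbb Z}$ is the group of permutations of $\mathbb Z$ moving only finitely many elements; it acts on $\mathfrak R_q$ and $\mathfrak G_q$ by automorphisms determined by $\alpha_g(a_i)=a_{g(i)}$ (hence $\alpha_g(s_i)=s_{g(i)}$). *)

theory Defs
  imports "HOL-Analysis.Analysis" "HOL-Library.Nonpos_Ints" "HOL-Library.FuncSet"
begin

section \<open>Complex Hilbert spaces\<close>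

class complex_vector = real_vector +
  fixes scaleC :: "complex \<Rightarrow> 'a \<Rightarrow> 'a"  (infixr \<open>*\<^sub>C\<close> 75)
  assumes scaleC_add_right: "c *\<^sub>C (x + y) = c *\<^sub>C x + c *\<^sub>C y"
    and scaleC_add_left: "(c + d) *\<^sub>C x = c *\<^sub>C x + d *\<^sub>C x"
    and scaleC_scaleC: "c *\<^sub>C d *\<^sub>C x = (c * d) *\<^sub>C x"
    and scaleC_of_real: "complex_of_real r *\<^sub>C x = r *\<^sub>R x"

text \<open>The inner product is linear in its first argument. Its real part is the library's
  real inner product, from which norm, metric and topology are inherited.\<close>

class complex_inner = real_inner + complex_vector +
  fixes cinner :: "'a \<Rightarrow> 'a \<Rightarrow> complex"
  assumes cinner_commute: "cinner x y = cnj (cinner y x)"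
    and cinner_add_left: "cinner (x + y) z = cinner x z + cinner y z"
    and cinner_scaleC_left: "cinner (c *\<^sub>C x) y = c * cinner x y"
    and inner_eq_Re_cinner: "inner x y = Re (cinner x y)"

class chilbert_space = complex_inner + complete_space

global_interpretation complex_vector: vector_space "scaleC :: complex \<Rightarrow> 'a \<Rightarrow> 'a::complex_vector"
  defines cspan = complex_vector.span
proof
  show "1 *\<^sub>C x = x" for x :: 'a
    using scaleC_of_real[of 1 x] by simp
qed (auto simp: scaleC_add_right scaleC_add_left scaleC_scaleC)

lemma cinner_add_right: "cinner x (y + z) = cinner x y + cinner x z"
  by (metis cinner_commute cinner_add_left complex_cnj_add)

lemma cinner_scaleC_right: "cinner x (c *\<^sub>C y) = cnj c * cinner x y"
  by (metis cinner_commute cinner_scaleC_left complex_cnj_mult)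

lemma cinner_self: "cinner x x = complex_of_real ((norm x)\<^sup>2)"
proof -
  have "Im (cinner x x) = 0"
    by (metis cinner_commute complex_cnj_cancel_iff cnj.simps(2) neg_equal_zero)
  moreover have "Re (cinner x x) = (norm x)\<^sup>2"
    by (simp add: power2_norm_eq_inner inner_eq_Re_cinner)
  ultimately show ?thesis
    by (simp add: complex_eq_iff)
qed

lemma norm_scaleC: "norm (c *\<^sub>C x) = cmod c * norm (x :: 'a::complex_inner)"
proof -
  have "complex_of_real ((norm (c *\<^sub>C x))\<^sup>2) = complex_of_real ((cmod c * norm x)\<^sup>2)"
    by (simp only: cinner_self[symmetric] cinner_scaleC_left cinner_scaleC_right)
      (simp del: of_real_power add: cinner_self power_mult_distrib complex_norm_square)
  then have "(norm (c *\<^sub>C x))\<^sup>2 = (cmod c * norm x)\<^sup>2"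
    by (simp only: of_real_eq_iff)
  then show ?thesis
    by (simp add: power2_eq_iff_nonneg)
qed

section \<open>The Hilbert space of square-summable families\<close>

typedef 'a ell2 = "{f :: 'a \<Rightarrow> complex. (\<lambda>i. (cmod (f i))\<^sup>2) summable_on UNIV}"
  by (rule exI[of _ "\<lambda>_. 0"]) simp

setup_lifting type_definition_ell2

lemma abs_summable_mult_ell2:
  assumes "(\<lambda>i. (cmod (f i))\<^sup>2) summable_on A" "(\<lambda>i. (cmod (g i))\<^sup>2) summable_on A"
  shows "(\<lambda>i. cmod (f i * g i)) summable_on A"
proof (rule summable_on_comparison_test)
  show "(\<lambda>i. (cmod (f i))\<^sup>2 + (cmod (g i))\<^sup>2) summable_on A"
    using assms by (rule summable_on_add)
  fix i
  have "2 * (cmod (f i) * cmod (g i)) \<le> (cmod (f i))\<^sup>2 + (cmod (g i))\<^sup>2"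
    using sum_squares_bound[of "cmod (f i)" "cmod (g i)"] by (simp add: mult.assoc)
  moreover have "0 \<le> cmod (f i) * cmod (g i)" by simp
  ultimately show "cmod (f i * g i) \<le> (cmod (f i))\<^sup>2 + (cmod (g i))\<^sup>2"
    unfolding norm_mult by linarith
qed simp

lemma summable_mult_cnj_ell2:
  assumes "(\<lambda>i. (cmod (f i))\<^sup>2) summable_on A" "(\<lambda>i. (cmod (g i))\<^sup>2) summable_on A"
  shows "(\<lambda>i. f i * cnj (g i)) summable_on A"
  using abs_summable_mult_ell2[of f A "\<lambda>i. cnj (g i)"] assms
  by (simp add: abs_summable_summable)

lemma square_summable_add:
  assumes "(\<lambda>i. (cmod (f i))\<^sup>2) summable_on A" "(\<lambda>i. (cmod (g i))\<^sup>2) summable_on A"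
  shows "(\<lambda>i. (cmod (f i + g i))\<^sup>2) summable_on A"
proof -
  have "(\<lambda>i. 2 * (cmod (f i))\<^sup>2 + 2 * (cmod (g i))\<^sup>2) summable_on A"
    by (intro summable_on_add summable_on_cmult_right assms)
  then show ?thesis
  proof (rule summable_on_comparison_test)
    fix i
    have "(cmod (f i + g i))\<^sup>2 \<le> (cmod (f i) + cmod (g i))\<^sup>2"
      by (simp add: norm_triangle_ineq power_mono)
    also have "\<dots> \<le> 2 * (cmod (f i))\<^sup>2 + 2 * (cmod (g i))\<^sup>2"
      using sum_squares_bound[of "cmod (f i)" "cmod (g i)"] by (simp add: power2_sum)
    finally show "(cmod (f i + g i))\<^sup>2 \<le> 2 * (cmod (f i))\<^sup>2 + 2 * (cmod (g i))\<^sup>2" .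
  qed auto
qed

instantiation ell2 :: (type) complex_vector
begin

lift_definition zero_ell2 :: "'a ell2" is "\<lambda>_. 0" by simp
lift_definition uminus_ell2 :: "'a ell2 \<Rightarrow> 'a ell2" is "\<lambda>f i. - f i" by simp

lift_definition plus_ell2 :: "'a ell2 \<Rightarrow> 'a ell2 \<Rightarrow> 'a ell2" is "\<lambda>f g i. f i + g i"
  by (rule square_summable_add)

lift_definition minus_ell2 :: "'a ell2 \<Rightarrow> 'a ell2 \<Rightarrow> 'a ell2" is "\<lambda>f g i. f i - g i"
  using square_summable_add[of _ UNIV "\<lambda>i. - _ i"] by simp

lift_definition scaleC_ell2 :: "complex \<Rightarrow> 'a ell2 \<Rightarrow> 'a ell2" is "\<lambda>c f i. c * f i"
  by (simp add: norm_mult power_mult_distrib summable_on_cmult_right)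

lift_definition scaleR_ell2 :: "real \<Rightarrow> 'a ell2 \<Rightarrow> 'a ell2" is "\<lambda>r f i. complex_of_real r * f i"
  by (simp add: norm_mult power_mult_distrib summable_on_cmult_right)

instance
proof
  fix f g h :: "'a ell2" and c d :: complex and r s :: real
  show "f + g + h = f + (g + h)" by transfer (simp add: add.assoc)
  show "f + g = g + f" by transfer (simp add: add.commute)
  show "0 + f = f" by transfer simp
  show "- f + f = 0" by transfer simp
  show "f - g = f + - g" by transfer simp
  show "r *\<^sub>R (f + g) = r *\<^sub>R f + r *\<^sub>R g" by transfer (simp add: distrib_left)
  show "(r + s) *\<^sub>R f = r *\<^sub>R f + s *\<^sub>R f" by transfer (simp add: distrib_right)
  show "r *\<^sub>R s *\<^sub>R f = (r * s) *\<^sub>R f" by transfer (simp add: mult.assoc)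
  show "1 *\<^sub>R f = f" by transfer simp
  show "c *\<^sub>C (f + g) = c *\<^sub>C f + c *\<^sub>C g" by transfer (simp add: distrib_left)
  show "(c + d) *\<^sub>C f = c *\<^sub>C f + d *\<^sub>C f" by transfer (simp add: distrib_right)
  show "c *\<^sub>C d *\<^sub>C f = (c * d) *\<^sub>C f" by transfer (simp add: mult.assoc)
  show "complex_of_real r *\<^sub>C f = r *\<^sub>R f" by transfer simp
qed

end

instantiation ell2 :: (type) complex_inner
begin

lift_definition cinner_ell2 :: "'a ell2 \<Rightarrow> 'a ell2 \<Rightarrow> complex"
  is "\<lambda>f g. \<Sum>\<^sub>\<infinity>i. f i * cnj (g i)" .

definition inner_ell2 :: "'a ell2 \<Rightarrow> 'a ell2 \<Rightarrow> real" where
  "inner_ell2 f g = Re (cinner f g)"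

definition norm_ell2 :: "'a ell2 \<Rightarrow> real" where
  "norm_ell2 f = sqrt (inner f f)"

definition sgn_ell2 :: "'a ell2 \<Rightarrow> 'a ell2" where
  "sgn_ell2 f = f /\<^sub>R norm f"

definition dist_ell2 :: "'a ell2 \<Rightarrow> 'a ell2 \<Rightarrow> real" where
  "dist_ell2 f g = norm (f - g)"

definition uniformity_ell2 :: "('a ell2 \<times> 'a ell2) filter" where
  "uniformity_ell2 = (INF e\<in>{0<..}. principal {(x, y). dist x y < e})"

definition open_ell2 :: "'a ell2 set \<Rightarrow> bool" where
  "open_ell2 U \<longleftrightarrow> (\<forall>x\<in>U. eventually (\<lambda>(x', y). x' = x \<longrightarrow> y \<in> U) uniformity)"

lemma cinner_ell2_self: "cinner f f = complex_of_real (\<Sum>\<^sub>\<infinity>i. (cmod (Rep_ell2 f i))\<^sup>2)"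
proof -
  have "cinner f f = (\<Sum>\<^sub>\<infinity>i. complex_of_real ((cmod (Rep_ell2 f i))\<^sup>2))"
    by (simp del: of_real_power add: cinner_ell2.rep_eq complex_norm_square)
  also have "\<dots> = complex_of_real (\<Sum>\<^sub>\<infinity>i. (cmod (Rep_ell2 f i))\<^sup>2)"
    using Rep_ell2[of f] by (intro infsumI has_sum_of_real) simp
  finally show ?thesis .
qed

instance
proof
  fix f g h :: "'a ell2" and r :: real
  show comm: "cinner f g = cnj (cinner g f)" for f g :: "'a ell2"
    by transfer (simp add: mult.commute flip: infsum_cnj)
  show add: "cinner (f + g) h = cinner f h + cinner g h"
    by transfer (simp add: distrib_right infsum_add summable_mult_cnj_ell2)
  show scale: "cinner (c *\<^sub>C f) g = c * cinner f g" for c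
    by transfer (simp add: mult.assoc infsum_cmult_right')
  show "inner f g = Re (cinner f g)" by (rule inner_ell2_def)
  show "inner f g = inner g f"
    using comm[of f g] by (simp add: inner_ell2_def)
  show "inner (f + g) h = inner f h + inner g h"
    by (simp add: inner_ell2_def add)
  have "r *\<^sub>R f = complex_of_real r *\<^sub>C f" by transfer simp
  then show "inner (r *\<^sub>R f) g = r * inner f g"
    by (simp add: inner_ell2_def scale)
  show "0 \<le> inner f f"
    by (simp add: inner_ell2_def cinner_ell2_self infsum_nonneg)
  show "inner f f = 0 \<longleftrightarrow> f = 0"
  proof
    assume "inner f f = 0"
    then have "(\<Sum>\<^sub>\<infinity>i. (cmod (Rep_ell2 f i))\<^sup>2) = 0"
      by (simp add: inner_ell2_def cinner_ell2_self)
    then have "(cmod (Rep_ell2 f i))\<^sup>2 = 0" for i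
      using nonneg_infsum_le_0D[of "\<lambda>i. (cmod (Rep_ell2 f i))\<^sup>2" UNIV i] Rep_ell2[of f] by simp
    then show "f = 0" by transfer auto
  next
    assume "f = 0"
    then show "inner f f = 0" unfolding inner_ell2_def by transfer simp
  qed
qed (simp_all add: norm_ell2_def sgn_ell2_def dist_ell2_def uniformity_ell2_def open_ell2_def)

end

lemma norm_ell2_square: "(norm f)\<^sup>2 = (\<Sum>\<^sub>\<infinity>i. (cmod (Rep_ell2 f i))\<^sup>2)"
proof -
  have "complex_of_real ((norm f)\<^sup>2) = complex_of_real (\<Sum>\<^sub>\<infinity>i. (cmod (Rep_ell2 f i))\<^sup>2)"
    by (simp only: cinner_self[symmetric] cinner_ell2_self)
  then show ?thesis by (simp only: of_real_eq_iff)
qed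

lemma finite_sum_le_norm_ell2:
  assumes "finite S"
  shows "(\<Sum>i\<in>S. (cmod (Rep_ell2 f i))\<^sup>2) \<le> (norm f)\<^sup>2"
  unfolding norm_ell2_square using Rep_ell2[of f] assms by (intro finite_sum_le_infsum) auto

instance ell2 :: (type) chilbert_space
proof
  fix X :: "nat \<Rightarrow> 'a ell2"
  assume X: "Cauchy X"
  have Rep_diff: "Rep_ell2 (f - g) i = Rep_ell2 f i - Rep_ell2 g i" for f g :: "'a ell2" and i
    by (simp add: minus_ell2.rep_eq)
  have coord: "cmod (Rep_ell2 f i) \<le> norm f" for f :: "'a ell2" and i
    using finite_sum_le_norm_ell2[of "{i}" f] by (simp add: power2_le_iff_abs_le)
  have "\<exists>l. (\<lambda>n. Rep_ell2 (X n) i) \<longlonglongrightarrow> l" for i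
  proof -
    have "Cauchy (\<lambda>n. Rep_ell2 (X n) i)"
    proof (rule CauchyI)
      fix e :: real assume "0 < e"
      then obtain N where "\<forall>m\<ge>N. \<forall>n\<ge>N. norm (X m - X n) < e"
        using CauchyD[OF X] by blast
      then have "\<forall>m\<ge>N. \<forall>n\<ge>N. norm (Rep_ell2 (X m) i - Rep_ell2 (X n) i) < e"
        using coord[of "X _ - X _" i] by (metis Rep_diff order_le_less_trans)
      then show "\<exists>N. \<forall>m\<ge>N. \<forall>n\<ge>N. norm (Rep_ell2 (X m) i - Rep_ell2 (X n) i) < e" ..
    qed
    then show ?thesis by (simp add: Cauchy_convergent_iff convergent_def)
  qed
  then obtain L where L: "\<And>i. (\<lambda>n. Rep_ell2 (X n) i) \<longlonglongrightarrow> L i" by metis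
  have bound: "(\<Sum>i\<in>S. (cmod (Rep_ell2 (X n) i - L i))\<^sup>2) \<le> e\<^sup>2"
    if "finite S" and "n \<ge> N" and N: "\<forall>m\<ge>N. \<forall>n\<ge>N. norm (X m - X n) < e" for S n e N
  proof (rule LIMSEQ_le_const2)
    show "(\<lambda>m. \<Sum>i\<in>S. (cmod (Rep_ell2 (X n) i - Rep_ell2 (X m) i))\<^sup>2) \<longlonglongrightarrow>
        (\<Sum>i\<in>S. (cmod (Rep_ell2 (X n) i - L i))\<^sup>2)"
      by (intro tendsto_intros L)
    have "(\<Sum>i\<in>S. (cmod (Rep_ell2 (X n) i - Rep_ell2 (X m) i))\<^sup>2) \<le> e\<^sup>2" if "m \<ge> N" for m
    proof -
      have "(\<Sum>i\<in>S. (cmod (Rep_ell2 (X n) i - Rep_ell2 (X m) i))\<^sup>2) \<le> (norm (X n - X m))\<^sup>2"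
        using finite_sum_le_norm_ell2[OF \<open>finite S\<close>, of "X n - X m"] by (simp add: Rep_diff)
      also have "\<dots> \<le> e\<^sup>2"
        using N \<open>n \<ge> N\<close> that by (intro power_mono) (auto intro: less_imp_le)
      finally show ?thesis .
    qed
    then show "\<exists>N. \<forall>m\<ge>N. (\<Sum>i\<in>S. (cmod (Rep_ell2 (X n) i - Rep_ell2 (X m) i))\<^sup>2) \<le> e\<^sup>2" by blast
  qed
  have summ: "(\<lambda>i. (cmod (Rep_ell2 (X n) i - L i))\<^sup>2) summable_on UNIV \<and>
      (\<Sum>\<^sub>\<infinity>i. (cmod (Rep_ell2 (X n) i - L i))\<^sup>2) \<le> e\<^sup>2"
    if "n \<ge> N" "\<forall>m\<ge>N. \<forall>n\<ge>N. norm (X m - X n) < e" for n e N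
  proof
    show s: "(\<lambda>i. (cmod (Rep_ell2 (X n) i - L i))\<^sup>2) summable_on UNIV"
      by (rule nonneg_bounded_partial_sums_imp_summable_on[where C = "e\<^sup>2"])
        (auto intro!: bound[OF _ that] simp: eventually_finite_subsets_at_top)
    show "(\<Sum>\<^sub>\<infinity>i. (cmod (Rep_ell2 (X n) i - L i))\<^sup>2) \<le> e\<^sup>2"
      using s by (rule infsum_le_finite_sums) (rule bound[OF _ that])
  qed
  obtain N1 where N1: "\<forall>m\<ge>N1. \<forall>n\<ge>N1. norm (X m - X n) < 1"
    using CauchyD[OF X, of 1] by auto
  have "(\<lambda>i. (cmod (Rep_ell2 (X N1) i + - (Rep_ell2 (X N1) i - L i)))\<^sup>2) summable_on UNIV"
    using summ[OF order_refl N1] Rep_ell2[of "X N1"]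
    by (intro square_summable_add) (simp_all only: norm_minus_cancel mem_Collect_eq)
  then have "L \<in> {f. (\<lambda>i. (cmod (f i))\<^sup>2) summable_on UNIV}"
    by simp
  then have Rep_L: "Rep_ell2 (Abs_ell2 L) = L"
    by (rule Abs_ell2_inverse)
  have "X \<longlonglongrightarrow> Abs_ell2 L"
  proof (rule LIMSEQ_I)
    fix r :: real assume "0 < r"
    then obtain N where N: "\<forall>m\<ge>N. \<forall>n\<ge>N. norm (X m - X n) < r / 2"
      using CauchyD[OF X, of "r / 2"] by auto
    have "norm (X n - Abs_ell2 L) < r" if "n \<ge> N" for n
    proof -
      have "(norm (X n - Abs_ell2 L))\<^sup>2 \<le> (r / 2)\<^sup>2"
        using summ[OF that N] by (simp add: norm_ell2_square Rep_diff Rep_L)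
      then have "norm (X n - Abs_ell2 L) \<le> r / 2"
        using \<open>0 < r\<close> by (simp add: power2_le_iff_abs_le)
      then show ?thesis using \<open>0 < r\<close> by simp
    qed
    then show "\<exists>N. \<forall>n\<ge>N. norm (X n - Abs_ell2 L) < r" by blast
  qed
  then show "convergent X" by (rule convergentI)
qed

lift_definition ket :: "'a \<Rightarrow> 'a ell2" is "\<lambda>i j. if j = i then 1 else 0"
proof -
  fix i :: 'a
  have "(\<lambda>j. (cmod (if j = i then 1 else 0))\<^sup>2) summable_on UNIV \<longleftrightarrow>
      (\<lambda>_. 1 :: real) summable_on {i}"
    by (rule summable_on_cong_neutral) auto
  then show "(\<lambda>j. (cmod (if j = i then 1 else 0))\<^sup>2) summable_on UNIV"
    by simp
qed

section \<open>Bounded operators and unital $C^*$-algebras of operators\<close>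

text \<open>The library type of bounded linear maps consists of real-linear maps; the algebra of
  bounded operators of a complex Hilbert space is the following subset of it, with composition
  \<^term>\<open>(o\<^sub>L)\<close>, unit \<^term>\<open>id_blinfun\<close> and the operator norm of the type.\<close>

definition bounded_operators :: "('h::chilbert_space \<Rightarrow>\<^sub>L 'h) set" where
  "bounded_operators = {x. \<forall>c v. blinfun_apply x (c *\<^sub>C v) = c *\<^sub>C blinfun_apply x v}"

instantiation blinfun :: (real_normed_vector, complex_inner) complex_vector
begin

lift_definition scaleC_blinfun :: "complex \<Rightarrow> ('a \<Rightarrow>\<^sub>L 'b) \<Rightarrow> ('a \<Rightarrow>\<^sub>L 'b)" is "\<lambda>c x v. c *\<^sub>C x v"
proof -
  fix c :: complex and x :: "'a \<Rightarrow> 'b"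
  assume "bounded_linear x"
  moreover have "bounded_linear (\<lambda>w::'b. c *\<^sub>C w)"
    by (rule bounded_linear_intro[of _ "cmod c"])
      (simp_all add: scaleC_add_right norm_scaleC scaleC_scaleC mult.commute flip: scaleC_of_real)
  ultimately show "bounded_linear (\<lambda>v. c *\<^sub>C x v)"
    by (rule bounded_linear_compose[rotated])
qed

instance
proof
  fix c d :: complex and r :: real and x y :: "'a \<Rightarrow>\<^sub>L 'b"
  show "c *\<^sub>C (x + y) = c *\<^sub>C x + c *\<^sub>C y" by transfer (simp add: scaleC_add_right)
  show "(c + d) *\<^sub>C x = c *\<^sub>C x + d *\<^sub>C x" by transfer (simp add: scaleC_add_left)
  show "c *\<^sub>C d *\<^sub>C x = (c * d) *\<^sub>C x" by transfer (simp add: scaleC_scaleC)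
  show "complex_of_real r *\<^sub>C x = r *\<^sub>R x" by transfer (simp add: scaleC_of_real)
qed

end

definition adjoint_op :: "('h::chilbert_space \<Rightarrow>\<^sub>L 'h) \<Rightarrow> ('h \<Rightarrow>\<^sub>L 'h)" where
  "adjoint_op x =
    (THE y. \<forall>v w. cinner (blinfun_apply x v) w = cinner v (blinfun_apply y w))"

definition unital_cstar_algebra :: "('h::chilbert_space \<Rightarrow>\<^sub>L 'h) set \<Rightarrow> bool" where
  "unital_cstar_algebra A \<longleftrightarrow>
    A \<subseteq> bounded_operators \<and> closed A \<and> id_blinfun \<in> A \<and>
    (\<forall>x\<in>A. \<forall>y\<in>A. x + y \<in> A \<and> x o\<^sub>L y \<in> A) \<and>
    (\<forall>c. \<forall>x\<in>A. c *\<^sub>C x \<in> A) \<and> (\<forall>x\<in>A. adjoint_op x \<in> A)"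

definition star_automorphism ::
    "('h::chilbert_space \<Rightarrow>\<^sub>L 'h) set \<Rightarrow> (('h \<Rightarrow>\<^sub>L 'h) \<Rightarrow> ('h \<Rightarrow>\<^sub>L 'h)) \<Rightarrow> bool" where
  "star_automorphism A \<alpha> \<longleftrightarrow>
    bij_betw \<alpha> A A \<and>
    (\<forall>x\<in>A. \<forall>y\<in>A. \<alpha> (x + y) = \<alpha> x + \<alpha> y \<and> \<alpha> (x o\<^sub>L y) = \<alpha> x o\<^sub>L \<alpha> y) \<and>
    (\<forall>c. \<forall>x\<in>A. \<alpha> (c *\<^sub>C x) = c *\<^sub>C \<alpha> x) \<and> (\<forall>x\<in>A. \<alpha> (adjoint_op x) = adjoint_op (\<alpha> x))"

text \<open>A state of \<open>A\<close> is represented by the unique function on the whole operator type that agrees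
  with it on \<open>A\<close> and is \<^const>\<open>undefined\<close> elsewhere.\<close>

definition states :: "('h::chilbert_space \<Rightarrow>\<^sub>L 'h) set \<Rightarrow> (('h \<Rightarrow>\<^sub>L 'h) \<Rightarrow> complex) set" where
  "states A = {\<phi> \<in> extensional A.
    (\<forall>x\<in>A. \<forall>y\<in>A. \<phi> (x + y) = \<phi> x + \<phi> y) \<and> (\<forall>c. \<forall>x\<in>A. \<phi> (c *\<^sub>C x) = c * \<phi> x) \<and>
    (\<forall>x\<in>A. \<phi> (adjoint_op x o\<^sub>L x) \<in> \<real>\<^sub>\<ge>\<^sub>0) \<and> \<phi> id_blinfun = 1}"

section \<open>The \<open>q\<close>-deformed Fock space\<close>

definition inversions :: "nat \<Rightarrow> (nat \<Rightarrow> nat) \<Rightarrow> nat" where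
  "inversions n \<pi> = card {(i, j). i < j \<and> j < n \<and> \<pi> j < \<pi> i}"

text \<open>The inner product of \<open>f\<^sub>1 \<otimes> \<dots> \<otimes> f\<^sub>n\<close> and \<open>g\<^sub>1 \<otimes> \<dots> \<otimes> g\<^sub>m\<close>, the tensors being given by the lists
  of their factors; the empty list stands for the vacuum vector.\<close>

definition q_form :: "real \<Rightarrow> 'k::complex_inner list \<Rightarrow> 'k list \<Rightarrow> complex" where
  "q_form q fs gs =
    (if length fs = length gs
     then \<Sum>\<pi> | \<pi> permutes {..<length fs}.
       complex_of_real (q ^ inversions (length fs) \<pi>) *
       (\<Prod>k<length fs. cinner (fs ! k) (gs ! \<pi> k))
     else 0)"

text \<open>The completion of the span of the elementary tensors is determined up to a unique unitary
  operator that respects the elementary tensors; it is presented as a Hilbert space together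
  with the map that sends a list of vectors to the corresponding elementary tensor.
  Multilinearity of this map follows from the formula for the inner products. Existence for
  \<open>-1 < q < 1\<close>, i.e. positivity of the form, is \<open>q_fock_space_exists\<close> below.\<close>

definition q_fock_space :: "real \<Rightarrow> ('k::complex_inner list \<Rightarrow> 'h::chilbert_space) \<Rightarrow> bool" where
  "q_fock_space q \<Phi> \<longleftrightarrow>
    (\<forall>fs gs. cinner (\<Phi> fs) (\<Phi> gs) = q_form q fs gs) \<and> closure (cspan (range \<Phi>)) = UNIV"

text \<open>A bounded operator is determined by its values on the total set of elementary tensors;
  for \<open>-1 < q < 1\<close> the creators are bounded (Bozejko and Speicher).\<close>

definition creator :: "('k::complex_inner list \<Rightarrow> 'h::chilbert_space) \<Rightarrow> 'k \<Rightarrow> ('h \<Rightarrow>\<^sub>L 'h)" where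
  "creator \<Phi> f =
    (THE x. x \<in> bounded_operators \<and> (\<forall>fs. blinfun_apply x (\<Phi> fs) = \<Phi> (f # fs)))"

definition annihilator :: "('k::complex_inner list \<Rightarrow> 'h::chilbert_space) \<Rightarrow> 'k \<Rightarrow> ('h \<Rightarrow>\<^sub>L 'h)" where
  "annihilator \<Phi> f = adjoint_op (creator \<Phi> f)"

section \<open>The algebras, the action of the permutations and the invariant states\<close>

definition a_op :: "(int ell2 list \<Rightarrow> 'h::chilbert_space) \<Rightarrow> int \<Rightarrow> ('h \<Rightarrow>\<^sub>L 'h)" where
  "a_op \<Phi> i = annihilator \<Phi> (ket i)"

definition s_op :: "(int ell2 list \<Rightarrow> 'h::chilbert_space) \<Rightarrow> int \<Rightarrow> ('h \<Rightarrow>\<^sub>L 'h)" where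
  "s_op \<Phi> i = annihilator \<Phi> (ket i) + creator \<Phi> (ket i)"

definition R_algebra :: "(int ell2 list \<Rightarrow> 'h::chilbert_space) \<Rightarrow> ('h \<Rightarrow>\<^sub>L 'h) set" where
  "R_algebra \<Phi> = unital_cstar_algebra hull range (a_op \<Phi>)"

definition G_algebra :: "(int ell2 list \<Rightarrow> 'h::chilbert_space) \<Rightarrow> ('h \<Rightarrow>\<^sub>L 'h) set" where
  "G_algebra \<Phi> = unital_cstar_algebra hull range (s_op \<Phi>)"

definition finitary_permutations :: "(int \<Rightarrow> int) set" where
  "finitary_permutations = {g. bij g \<and> finite {i. g i \<noteq> i}}"

definition perm_action ::
    "(int ell2 list \<Rightarrow> 'h::chilbert_space) \<Rightarrow> (int \<Rightarrow> int) \<Rightarrow> ('h \<Rightarrow>\<^sub>L 'h) \<Rightarrow> ('h \<Rightarrow>\<^sub>L 'h)" where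
  "perm_action \<Phi> g =
    (THE \<alpha>. \<alpha> \<in> extensional (R_algebra \<Phi>) \<and> star_automorphism (R_algebra \<Phi>) \<alpha> \<and>
       (\<forall>i. \<alpha> (a_op \<Phi> i) = a_op \<Phi> (g i)))"

text \<open>The next definition is meant for \<open>A\<close> either of the two algebras. The action on
  \<^term>\<open>G_algebra \<Phi>\<close> is the restriction of the one on \<^term>\<open>R_algebra \<Phi>\<close>.\<close>

definition symmetric_states ::
    "(int ell2 list \<Rightarrow> 'h::chilbert_space) \<Rightarrow> ('h \<Rightarrow>\<^sub>L 'h) set \<Rightarrow> (('h \<Rightarrow>\<^sub>L 'h) \<Rightarrow> complex) set" where
  "symmetric_states \<Phi> A =
    {\<phi> \<in> states A. \<forall>g\<in>finitary_permutations. \<forall>x\<in>A. \<phi> (perm_action \<Phi> g x) = \<phi> x}"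

definition vacuum_state ::
    "(int ell2 list \<Rightarrow> 'h::chilbert_space) \<Rightarrow> ('h \<Rightarrow>\<^sub>L 'h) set \<Rightarrow> (('h \<Rightarrow>\<^sub>L 'h) \<Rightarrow> complex)" where
  "vacuum_state \<Phi> A = (\<lambda>x\<in>A. cinner (blinfun_apply x (\<Phi> [])) (\<Phi> []))"

section \<open>Existence of the \<open>q\<close>-deformed Fock space\<close>

lemma cinner_zero_left: "cinner 0 y = 0"
  using cinner_scaleC_left[of 0 0 y] by simp

lemma cinner_zero_right: "cinner x 0 = 0"
  using cinner_scaleC_right[of x 0 0] by simp

lemma cinner_minus_left: "cinner (- x) y = - cinner x y"
  using cinner_add_left[of x "- x" y] by (simp add: cinner_zero_left eq_neg_iff_add_eq_0 add.commute)

lemma cinner_minus_right: "cinner x (- y) = - cinner x y"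
  using cinner_add_right[of x y "- y"] by (simp add: cinner_zero_right eq_neg_iff_add_eq_0 add.commute)

lemma cinner_diff_left: "cinner (x - y) z = cinner x z - cinner y z"
  using cinner_add_left[of x "- y" z] by (simp add: cinner_minus_left)

lemma cinner_diff_right: "cinner x (y - z) = cinner x y - cinner x z"
  using cinner_add_right[of x y "- z"] by (simp add: cinner_minus_right)

lemma cinner_sum_left: "cinner (\<Sum>i\<in>A. f i) y = (\<Sum>i\<in>A. cinner (f i) y)"
  by (induction A rule: infinite_finite_induct) (simp_all add: cinner_zero_left cinner_add_left)

lemma cinner_sum_right: "cinner x (\<Sum>i\<in>A. f i) = (\<Sum>i\<in>A. cinner x (f i))"
  by (induction A rule: infinite_finite_induct) (simp_all add: cinner_zero_right cinner_add_right)

lemmas cinner_simps = cinner_add_left cinner_add_right cinner_diff_left cinner_diff_right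
  cinner_scaleC_left cinner_scaleC_right cinner_sum_left cinner_sum_right
  cinner_zero_left cinner_zero_right

lemma cinner_self_eq_0: "cinner x x = 0 \<longleftrightarrow> x = 0"
  by (simp add: cinner_self)

lemma complex_Cauchy_Schwarz: "cmod (cinner x y) \<le> norm x * norm y"
proof -
  obtain u where u: "cmod u = 1" "u * cinner x y = cmod (cinner x y)"
  proof (cases "cinner x y = 0")
    case False
    have "cnj (cinner x y) / cmod (cinner x y) * cinner x y = cmod (cinner x y)"
      using False complex_norm_square[of "cinner x y"]
      by (simp add: field_simps power2_eq_square)
    moreover have "cmod (cnj (cinner x y) / cmod (cinner x y)) = 1"
      using False by (simp add: norm_divide)
    ultimately show ?thesis by (rule that[rotated])
  qed (use that[of 1] in simp)
  have "cmod (cinner x y) = Re (cinner (u *\<^sub>C x) y)"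
    by (simp add: cinner_scaleC_left u)
  also have "\<dots> = inner (u *\<^sub>C x) y" by (simp add: inner_eq_Re_cinner)
  also have "\<dots> \<le> norm (u *\<^sub>C x) * norm y" by (rule norm_cauchy_schwarz)
  finally show ?thesis by (simp add: norm_scaleC u)
qed

lemma bounded_linear_cinner_left: "bounded_linear (\<lambda>x. cinner x y)"
  by (rule bounded_linear_intro[of _ "norm y"])
    (simp_all add: cinner_add_left complex_Cauchy_Schwarz cinner_scaleC_left scaleR_conv_of_real
      flip: scaleC_of_real)

lemma subspace_closure_cspan:
  fixes S :: "'a::complex_inner set"
  shows "complex_vector.subspace (closure (cspan S))"
proof (rule complex_vector.subspaceI)
  show "0 \<in> closure (cspan S)"
    using complex_vector.span_zero closure_subset by blast
  fix x y assume x: "x \<in> closure (cspan S)" and "y \<in> closure (cspan S)"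
  then obtain f g where "\<forall>n::nat. f n \<in> cspan S" "f \<longlonglongrightarrow> x" "\<forall>n::nat. g n \<in> cspan S" "g \<longlonglongrightarrow> y"
    by (auto simp: closure_sequential)
  then show "x + y \<in> closure (cspan S)"
    unfolding closure_sequential
    by (intro exI[of _ "\<lambda>n. f n + g n"]) (auto intro: tendsto_add complex_vector.span_add)
next
  fix c x assume "x \<in> closure (cspan S)"
  then obtain f where "\<forall>n::nat. f n \<in> cspan S" and f: "f \<longlonglongrightarrow> x"
    by (auto simp: closure_sequential)
  moreover have "bounded_linear (\<lambda>x::'a. c *\<^sub>C x)"
    by (rule bounded_linear_intro[of _ "cmod c"])
      (simp_all add: scaleC_add_right norm_scaleC scaleC_scaleC mult.commute flip: scaleC_of_real)
  ultimately show "c *\<^sub>C x \<in> closure (cspan S)"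
    unfolding closure_sequential
    by (intro exI[of _ "\<lambda>n. c *\<^sub>C f n"])
      (auto intro: bounded_linear.tendsto complex_vector.span_scale)
qed

lemma norm_diff_orthonormal_sum:
  assumes "finite S" and e: "\<And>i j. i \<in> S \<Longrightarrow> j \<in> S \<Longrightarrow> cinner (e i) (e j) = (if i = j then 1 else 0)"
  shows "(norm (v - (\<Sum>i\<in>S. cinner v (e i) *\<^sub>C e i)))\<^sup>2 = (norm v)\<^sup>2 - (\<Sum>i\<in>S. (cmod (cinner v (e i)))\<^sup>2)"
proof -
  define p where "p = (\<Sum>i\<in>S. cinner v (e i) *\<^sub>C e i)"
  define s where "s = (\<Sum>i\<in>S. cinner v (e i) * cnj (cinner v (e i)))"
  have "cinner p (e i) = cinner v (e i)" if "i \<in> S" for i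
    using that \<open>finite S\<close> by (simp add: p_def cinner_simps e if_distrib cong: if_cong)
  moreover have "cinner w p = (\<Sum>i\<in>S. cinner w (e i) * cnj (cinner v (e i)))" for w
    by (simp add: p_def cinner_simps mult.commute)
  ultimately have "cinner v p = s" "cinner p p = s"
    by (simp_all add: s_def)
  moreover from this have "cinner p v = cnj s"
    using cinner_commute[of p v] by simp
  moreover have "cnj s = s"
    by (simp add: s_def mult.commute)
  ultimately have "cinner (v - p) (v - p) = cinner v v - s"
    by (simp add: cinner_diff_left cinner_diff_right)
  moreover have "s = complex_of_real (\<Sum>i\<in>S. (cmod (cinner v (e i)))\<^sup>2)"
    by (simp del: of_real_power add: s_def complex_norm_square)
  ultimately have "complex_of_real ((norm (v - p))\<^sup>2) =
      complex_of_real ((norm v)\<^sup>2 - (\<Sum>i\<in>S. (cmod (cinner v (e i)))\<^sup>2))"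
    by (simp only: cinner_self of_real_diff)
  then show ?thesis
    by (simp only: of_real_eq_iff p_def)
qed

lemma Rep_ket: "Rep_ell2 (ket i) j = (if j = i then 1 else 0)"
  by (simp add: ket.rep_eq)

lemma cinner_ket_right: "cinner f (ket i) = Rep_ell2 f i"
proof -
  have "((\<lambda>j. Rep_ell2 f j * cnj (Rep_ell2 (ket i) j)) has_sum Rep_ell2 f i) UNIV"
    by (rule has_sum_finite_neutralI[of "{i}"]) (auto simp: Rep_ket)
  then show ?thesis by (simp add: cinner_ell2.rep_eq infsumI)
qed

lemma cinner_ket_left: "cinner (ket i) f = cnj (Rep_ell2 f i)"
  by (metis cinner_commute cinner_ket_right)

lemma Rep_ell2_inject_cinner: "(\<And>i. cinner f (ket i) = cinner g (ket i)) \<Longrightarrow> f = g"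
  by (metis Rep_ell2_inject ext cinner_ket_right)

lemma cinner_ket_ket: "cinner (ket i) (ket j) = (if i = j then 1 else 0)"
  by (simp add: cinner_ket_right Rep_ket)

lemma closure_cspan_ket: "closure (cspan (range (ket :: 'a \<Rightarrow> 'a ell2))) = UNIV"
proof -
  have "f \<in> closure (cspan (range ket))" for f :: "'a ell2"
    unfolding closure_approachable
  proof (intro allI impI)
    fix e :: real assume "0 < e"
    have "((\<lambda>i. (cmod (Rep_ell2 f i))\<^sup>2) has_sum (norm f)\<^sup>2) UNIV"
      using Rep_ell2[of f] by (simp add: norm_ell2_square)
    then have "\<forall>\<^sub>F S in finite_subsets_at_top UNIV.
        dist (\<Sum>i\<in>S. (cmod (Rep_ell2 f i))\<^sup>2) ((norm f)\<^sup>2) < e\<^sup>2"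
      unfolding has_sum_def using \<open>0 < e\<close> by (intro tendstoD) auto
    then obtain S where S: "finite S" "dist (\<Sum>i\<in>S. (cmod (Rep_ell2 f i))\<^sup>2) ((norm f)\<^sup>2) < e\<^sup>2"
      by (auto simp: eventually_finite_subsets_at_top)
    let ?g = "\<Sum>i\<in>S. Rep_ell2 f i *\<^sub>C ket i"
    have "(norm (f - ?g))\<^sup>2 = (norm f)\<^sup>2 - (\<Sum>i\<in>S. (cmod (Rep_ell2 f i))\<^sup>2)"
      using norm_diff_orthonormal_sum[OF \<open>finite S\<close> cinner_ket_ket, of f]
      by (simp add: cinner_ket_right)
    also have "\<dots> < e\<^sup>2" using S by (simp add: dist_real_def)
    finally have "norm (f - ?g) < e"
      using \<open>0 < e\<close> by (simp add: power_less_imp_less_base)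
    moreover have "?g \<in> cspan (range ket)"
      by (intro complex_vector.span_sum complex_vector.span_scale complex_vector.span_base) auto
    ultimately show "\<exists>y\<in>cspan (range ket). dist y f < e"
      by (auto simp: dist_norm norm_minus_commute)
  qed
  then show ?thesis by blast
qed

text \<open>Coordinates with respect to an orthonormal sequence turn a separable, infinite-dimensional
  closed subspace into the sequence space.\<close>

lemma exists_gram_schmidt:
  fixes x :: "nat \<Rightarrow> 'v::complex_inner"
  assumes inf: "\<And>B. finite B \<Longrightarrow> \<not> range x \<subseteq> cspan B"
  obtains b :: "nat \<Rightarrow> 'v" where
    "\<And>m n. cinner (b m) (b n) = (if m = n then 1 else 0)"
    "range b \<subseteq> cspan (range x)" "range x \<subseteq> cspan (range b)"
proof -
  define k where "k f n = (LEAST k. x k \<notin> cspan (f ` {..<n}))" for f :: "nat \<Rightarrow> 'v" and n :: nat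
  define P where "P f n r \<longleftrightarrow> cinner r r = 1 \<and> (\<forall>m<n. cinner r (f m) = 0) \<and> r \<in> cspan (range x) \<and>
    x (k f n) \<in> cspan (insert r (f ` {..<n}))" for f :: "nat \<Rightarrow> 'v" and n :: nat and r
  have "\<exists>b. \<forall>n. P b n (b n)"
  proof (rule dependent_wellorder_choice)
    fix r :: 'v and f g :: "nat \<Rightarrow> 'v" and n :: nat
    assume "\<And>m. m < n \<Longrightarrow> f m = g m"
    then have "f ` {..<n} = g ` {..<n}" "\<forall>m<n. f m = g m" by auto
    then show "P f n r = P g n r" by (simp add: P_def k_def)
  next
    fix n :: nat and f :: "nat \<Rightarrow> 'v"
    assume f: "\<And>m. m < n \<Longrightarrow> P f m (f m)"
    have orth: "cinner (f l) (f m) = (if l = m then 1 else 0)" if "l < n" "m < n" for l m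
      using that f[of l] f[of m] unfolding P_def
      by (metis cinner_commute complex_cnj_zero nat_neq_iff)
    have "\<exists>k. x k \<notin> cspan (f ` {..<n})"
      using inf[of "f ` {..<n}"] by auto
    then have k: "x (k f n) \<notin> cspan (f ` {..<n})"
      unfolding k_def by (rule LeastI_ex)
    define p where "p = (\<Sum>m<n. cinner (x (k f n)) (f m) *\<^sub>C f m)"
    define v where "v = x (k f n) - p"
    have p: "p \<in> cspan (f ` {..<n})"
      unfolding p_def
      by (intro complex_vector.span_sum complex_vector.span_scale complex_vector.span_base) auto
    have "f ` {..<n} \<subseteq> cspan (range x)"
      using f by (auto simp: P_def)
    then have p': "p \<in> cspan (range x)"
      using p complex_vector.span_minimal[OF _ complex_vector.subspace_span] by blast
    have "v \<noteq> 0" using k p by (auto simp: v_def)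
    define r where "r = complex_of_real (1 / norm v) *\<^sub>C v"
    have "cinner v (f m) = 0" if "m < n" for m
      using that by (simp add: v_def p_def cinner_simps orth if_distrib cong: if_cong)
    moreover have "cinner r r = 1"
      using \<open>v \<noteq> 0\<close> by (simp add: cinner_self r_def norm_scaleC norm_divide)
    moreover have "r \<in> cspan (range x)"
      unfolding r_def v_def
      by (intro complex_vector.span_scale complex_vector.span_diff p')
        (auto intro: complex_vector.span_base)
    moreover have "x (k f n) \<in> cspan (insert r (f ` {..<n}))"
    proof -
      have "x (k f n) = complex_of_real (norm v) *\<^sub>C r + p"
        using \<open>v \<noteq> 0\<close> by (simp add: r_def scaleC_scaleC v_def flip: of_real_mult)
      moreover have "p \<in> cspan (insert r (f ` {..<n}))"
        using p complex_vector.span_mono[of "f ` {..<n}" "insert r (f ` {..<n})"] by blast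
      ultimately show ?thesis
        by (simp only:) (intro complex_vector.span_add complex_vector.span_scale
            complex_vector.span_base[of r] insertI1)
    qed
    ultimately show "\<exists>r. P f n r"
      unfolding P_def by (intro exI[of _ r]) (auto simp: r_def cinner_scaleC_left)
  qed
  then obtain b where b: "\<And>n. P b n (b n)" by blast
  have "x m \<in> cspan (b ` {..<n})" if "m < n" for m n
    using that
  proof (induction n arbitrary: m)
    case (Suc n)
    have mono: "cspan (b ` {..<n}) \<subseteq> cspan (b ` {..<Suc n})"
      by (intro complex_vector.span_mono) auto
    show ?case
    proof (cases "x m \<in> cspan (b ` {..<n})")
      case False
      then have "m = n" using Suc by (metis less_SucE)
      have "k b n = n"
        unfolding k_def using False Suc.IH \<open>m = n\<close> by (intro Least_equality) (auto simp: not_less[symmetric])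
      then show ?thesis
        using b[of n] \<open>m = n\<close> by (simp add: P_def lessThan_Suc)
    qed (use mono in blast)
  qed simp
  then have "x m \<in> cspan (range b)" for m
    using complex_vector.span_mono[of "b ` {..<Suc m}" "range b"] by blast
  moreover have "cinner (b m) (b n) = (if m = n then 1 else 0)" for m n
    using b[of m] b[of n] unfolding P_def
    by (metis cinner_commute complex_cnj_zero nat_neq_iff)
  moreover have "range b \<subseteq> cspan (range x)"
    using b by (auto simp: P_def)
  ultimately show ?thesis by (intro that[of b]) auto
qed

lemma exists_sequence_model:
  fixes J :: "'i \<Rightarrow> 'v::complex_inner" and x :: "nat \<Rightarrow> 'v"
  assumes inf: "\<And>B. finite B \<Longrightarrow> \<not> range x \<subseteq> cspan B"
    and xJ: "range x \<subseteq> range J" and Jx: "range J \<subseteq> closure (cspan (range x))"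
  obtains F :: "'i \<Rightarrow> nat ell2" where
    "\<And>i j. cinner (F i) (F j) = cinner (J i) (J j)" "closure (cspan (range F)) = UNIV"
proof -
  obtain b :: "nat \<Rightarrow> 'v" where b: "\<And>m n. cinner (b m) (b n) = (if m = n then 1 else 0)"
    and bx: "range b \<subseteq> cspan (range x)" and xb: "range x \<subseteq> cspan (range b)"
    using exists_gram_schmidt[OF inf] by metis
  have bessel: "(\<Sum>n\<in>S. (cmod (cinner v (b n)))\<^sup>2) \<le> (norm v)\<^sup>2" if "finite S" for S v
  proof -
    have "0 \<le> (norm (v - (\<Sum>n\<in>S. cinner v (b n) *\<^sub>C b n)))\<^sup>2" by simp
    also have "\<dots> = (norm v)\<^sup>2 - (\<Sum>n\<in>S. (cmod (cinner v (b n)))\<^sup>2)"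
      using \<open>finite S\<close> by (rule norm_diff_orthonormal_sum) (rule b)
    finally show ?thesis by simp
  qed
  have summ: "(\<lambda>n. (cmod (cinner v (b n)))\<^sup>2) summable_on UNIV" for v
    by (rule nonneg_bounded_partial_sums_imp_summable_on[where C = "(norm v)\<^sup>2"])
      (auto intro!: bessel simp: eventually_finite_subsets_at_top)
  define U where "U v = Abs_ell2 (\<lambda>n. cinner v (b n))" for v
  have Rep_U: "Rep_ell2 (U v) n = cinner v (b n)" for v n
    unfolding U_def using summ[of v] by (simp add: Abs_ell2_inverse)
  have U_add: "U (v + w) = U v + U w" for v w
    by (rule Rep_ell2_inject_cinner) (simp add: cinner_simps cinner_ket_right Rep_U
        plus_ell2.rep_eq scaleC_ell2.rep_eq zero_ell2.rep_eq)
  have U_scale: "U (c *\<^sub>C v) = c *\<^sub>C U v" for c v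
    by (rule Rep_ell2_inject_cinner) (simp add: cinner_simps cinner_ket_right Rep_U
        plus_ell2.rep_eq scaleC_ell2.rep_eq zero_ell2.rep_eq)
  have U_0: "U 0 = 0"
    by (rule Rep_ell2_inject_cinner) (simp add: cinner_simps cinner_ket_right Rep_U
        plus_ell2.rep_eq scaleC_ell2.rep_eq zero_ell2.rep_eq)
  have norm_U: "norm (U v) \<le> norm v" for v
  proof -
    have "(norm (U v))\<^sup>2 \<le> (norm v)\<^sup>2"
      unfolding norm_ell2_square Rep_U using summ by (rule infsum_le_finite_sums) (rule bessel)
    then show ?thesis by simp
  qed
  have "bounded_linear U"
    by (rule bounded_linear_intro[of _ 1])
      (simp_all add: U_add U_scale norm_U flip: scaleC_of_real)
  have U_b: "U (b n) = ket n" for n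
    by (rule Rep_ell2_inject_cinner) (simp add: cinner_ket_right Rep_U Rep_ket b)
  let ?M = "\<lambda>w. {v. cinner (U v) (U w) = cinner v w}"
  have M: "closure (cspan (range b)) \<subseteq> ?M w" for w
  proof (rule closure_minimal)
    show "cspan (range b) \<subseteq> ?M w"
    proof (rule complex_vector.span_minimal)
      show "range b \<subseteq> ?M w"
        by (auto simp: U_b cinner_ket_left Rep_U cinner_commute[of "b _" w])
      show "complex_vector.subspace (?M w)"
        by (rule complex_vector.subspaceI) (simp_all add: U_add U_scale U_0 cinner_simps)
    qed
    have "continuous_on UNIV (\<lambda>v. cinner (U v) (U w))" "continuous_on UNIV (\<lambda>v. cinner v w)"
      using bounded_linear_compose[OF bounded_linear_cinner_left \<open>bounded_linear U\<close>]
        bounded_linear_cinner_left by (auto intro: linear_continuous_on)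
    then show "closed (?M w)"
      by (rule closed_Collect_eq)
  qed
  have "closure (cspan (range x)) \<subseteq> closure (cspan (range b))"
    by (intro closure_mono complex_vector.span_minimal complex_vector.subspace_span xb)
  then have JM: "J i \<in> ?M w" for i w
    using Jx M by blast
  let ?F = "\<lambda>i. U (J i)"
  have "range ket \<subseteq> cspan (range ?F)"
  proof -
    have "cspan (range J) \<subseteq> {v. U v \<in> cspan (range ?F)}"
    proof (rule complex_vector.span_minimal)
      show "complex_vector.subspace {v. U v \<in> cspan (range ?F)}"
        by (rule complex_vector.subspaceI)
          (auto simp: U_add U_scale U_0 intro: complex_vector.span_zero complex_vector.span_add
            complex_vector.span_scale)
    qed (auto intro: complex_vector.span_base)
    moreover have "range b \<subseteq> cspan (range J)"
      using bx complex_vector.span_mono[OF xJ] by blast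
    ultimately show ?thesis
      unfolding U_b[symmetric] by blast
  qed
  then have "cspan (range ket) \<subseteq> cspan (range ?F)"
    by (intro complex_vector.span_minimal complex_vector.subspace_span)
  then have "closure (cspan (range ?F)) = UNIV"
    using closure_mono closure_cspan_ket by blast
  with JM show ?thesis by (intro that[of ?F]) auto
qed

lemma has_sum_product_complex:
  fixes f :: "'a \<Rightarrow> complex" and g :: "'b \<Rightarrow> complex"
  assumes f: "(f has_sum s) UNIV" and g: "(g has_sum t) UNIV"
  shows "((\<lambda>(a, b). f a * g b) has_sum s * t) UNIV"
proof -
  have nf: "(\<lambda>a. cmod (f a)) summable_on UNIV" and ng: "(\<lambda>b. cmod (g b)) summable_on UNIV"
    using f g has_sum_imp_summable summable_on_iff_abs_summable_on_complex by blast+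
  have "(\<lambda>ab. norm (case ab of (a, b) \<Rightarrow> f a * g b)) summable_on (UNIV \<times> UNIV)"
  proof (subst Infinite_Sum.abs_summable_on_Sigma_iff, intro conjI ballI)
    show "(\<lambda>b. norm (case (a, b) of (a, b) \<Rightarrow> f a * g b)) summable_on UNIV" for a
      using ng by (simp add: norm_mult summable_on_cmult_right)
    show "(\<lambda>a. norm (\<Sum>\<^sub>\<infinity>b. norm (case (a, b) of (a, b) \<Rightarrow> f a * g b))) summable_on UNIV"
      using nf by (simp add: norm_mult infsum_cmult_right' abs_mult summable_on_cmult_left)
  qed
  then have "(\<lambda>(a, b). f a * g b) summable_on (UNIV \<times> UNIV)"
    by (rule abs_summable_summable)
  then have "((\<lambda>(a, b). f a * g b) has_sum s * t) (UNIV \<times> UNIV)"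
    by (rule has_sum_SigmaI[rotated 2]) (use has_sum_cmult_right[OF g] has_sum_cmult_left[OF f] in auto)
  then show ?thesis by simp
qed

lemma exists_tensor:
  fixes h :: "'a \<times> 'b \<Rightarrow> 'c"
  assumes h: "inj h"
  obtains P :: "'a ell2 \<Rightarrow> 'b ell2 \<Rightarrow> 'c ell2" where
    "\<And>f g f' g'. cinner (P f g) (P f' g') = cinner f f' * cinner g g'"
    "\<And>f g c. c \<notin> range h \<Longrightarrow> cinner (P f g) (ket c) = 0"
proof -
  define p where "p f g c =
    (if c \<in> range h then Rep_ell2 f (fst (inv h c)) * Rep_ell2 g (snd (inv h c)) else 0)" for f g c
  have sum: "((\<lambda>c. p f g c * cnj (p f' g' c)) has_sum cinner f f' * cinner g g') UNIV"
    for f f' :: "'a ell2" and g g' :: "'b ell2"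
  proof -
    have "((\<lambda>a. Rep_ell2 f a * cnj (Rep_ell2 f' a)) has_sum cinner f f') UNIV"
      "((\<lambda>b. Rep_ell2 g b * cnj (Rep_ell2 g' b)) has_sum cinner g g') UNIV"
      using Rep_ell2 unfolding cinner_ell2.rep_eq
      by (auto intro!: has_sum_infsum summable_mult_cnj_ell2 simp del: has_sum_infsum)
    from has_sum_product_complex[OF this]
    have "((\<lambda>c. p f g c * cnj (p f' g' c)) \<circ> h has_sum cinner f f' * cinner g g') UNIV"
      by (rule has_sum_cong[THEN iffD1, rotated]) (simp add: p_def h split: prod.split)
    then have "((\<lambda>c. p f g c * cnj (p f' g' c)) has_sum cinner f f' * cinner g g') (range h)"
      using has_sum_reindex[OF h] by blast
    then show ?thesis
      by (rule has_sum_cong_neutral[THEN iffD1, rotated -1]) (auto simp: p_def)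
  qed
  define P where "P f g = Abs_ell2 (p f g)" for f g
  have "(\<lambda>c. (cmod (p f g c))\<^sup>2) summable_on UNIV" for f g
  proof -
    have "(\<lambda>c. cmod (p f g c * cnj (p f g c))) summable_on UNIV"
      by (rule summable_on_iff_abs_summable_on_complex[THEN iffD1, OF has_sum_imp_summable[OF sum]])
    then show ?thesis by (simp add: norm_mult power2_eq_square)
  qed
  then have Rep_P: "Rep_ell2 (P f g) = p f g" for f g
    unfolding P_def by (simp add: Abs_ell2_inverse)
  show ?thesis
  proof (rule that[of P])
    show "cinner (P f g) (P f' g') = cinner f f' * cinner g g'" for f g f' g'
      using sum[of f g f' g'] by (simp add: cinner_ell2.rep_eq[of "P _ _"] Rep_P infsumI)
    show "cinner (P f g) (ket c) = 0" if "c \<notin> range h" for f g c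
      using that by (simp add: cinner_ket_right Rep_P p_def)
  qed
qed

lemma exists_list_tensor:
  obtains T :: "'a ell2 list \<Rightarrow> 'a list ell2" where
    "\<And>fs gs. cinner (T fs) (T gs) =
      (if length fs = length gs then \<Prod>k<length fs. cinner (fs ! k) (gs ! k) else 0)"
proof -
  have "inj (\<lambda>(a, w). a # w :: 'a list)" by (auto simp: inj_def)
  then obtain P :: "'a ell2 \<Rightarrow> 'a list ell2 \<Rightarrow> 'a list ell2" where
    P: "\<And>f g f' g'. cinner (P f g) (P f' g') = cinner f f' * cinner g g'"
    and P0: "\<And>f g c. c \<notin> range (\<lambda>(a, w). a # w) \<Longrightarrow> cinner (P f g) (ket c) = 0"
    by (rule exists_tensor) blast
  have Pk: "cinner (P f g) (ket []) = 0" for f g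
    by (rule P0) auto
  then have kP: "cinner (ket []) (P f g) = 0" for f g
    by (metis cinner_commute complex_cnj_zero)
  define T where "T fs = foldr P fs (ket [])" for fs
  have "cinner (T fs) (T gs) =
      (if length fs = length gs then \<Prod>k<length fs. cinner (fs ! k) (gs ! k) else 0)" for fs gs
  proof (induction fs arbitrary: gs)
    case Nil
    then show ?case by (cases gs) (auto simp: T_def kP cinner_ket_ket)
  next
    case (Cons f fs)
    then show ?case by (cases gs) (auto simp: T_def Pk P prod.lessThan_Suc_shift simp del: prod.lessThan_Suc)
  qed
  then show ?thesis by (rule that)
qed

text \<open>Positivity of the kernel \<open>q\<close> to the number of inversions: the inversion set of
  \<open>\<tau> \<circ> \<sigma>\<^sup>-\<^sup>1\<close> is equinumerous to the symmetric difference of those of \<open>\<sigma>\<close> and \<open>\<tau>\<close>, and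
  \<open>q\<close> to the cardinality of a symmetric difference is a tensor power of a positive
  two by two matrix.\<close>

definition inversion_set :: "nat \<Rightarrow> (nat \<Rightarrow> nat) \<Rightarrow> (nat \<times> nat) set" where
  "inversion_set n \<pi> = {(i, j). i < j \<and> j < n \<and> \<pi> j < \<pi> i}"

lemma inversions_compose_inv:
  assumes s: "\<sigma> permutes {..<n}" and t: "\<tau> permutes {..<n}"
  shows "inversions n (\<tau> \<circ> inv \<sigma>) =
    card (sym_diff (inversion_set n \<sigma>) (inversion_set n \<tau>))"
proof -
  note inj_s = permutes_inj[OF s]
  note inj_t = permutes_inj[OF t]
  have lt: "\<sigma> i < n \<longleftrightarrow> i < n" "inv \<sigma> i < n \<longleftrightarrow> i < n" for i
    using permutes_in_image[OF s, of i] permutes_in_image[OF permutes_inv[OF s], of i] by auto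
  have inv: "inv \<sigma> (\<sigma> i) = i" "\<sigma> (inv \<sigma> i) = i" for i
    using permutes_inverses[OF s] by auto
  have eq: "\<sigma> i = \<sigma> j \<longleftrightarrow> i = j" "\<tau> i = \<tau> j \<longleftrightarrow> i = j" "inv \<sigma> i = inv \<sigma> j \<longleftrightarrow> i = j" for i j
    using inj_s inj_t permutes_inj[OF permutes_inv[OF s]] by (auto simp: inj_eq)
  define F where "F = (\<lambda>(i, j). if \<sigma> i < \<sigma> j then (\<sigma> i, \<sigma> j) else (\<sigma> j, \<sigma> i))"
  define G where "G = (\<lambda>(k, l). if inv \<sigma> k < inv \<sigma> l then (inv \<sigma> k, inv \<sigma> l) else (inv \<sigma> l, inv \<sigma> k))"
  define D where "D = {(i, j). i < j \<and> j < n \<and> (\<sigma> j < \<sigma> i) \<noteq> (\<tau> j < \<tau> i)}"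
  have D: "sym_diff (inversion_set n \<sigma>) (inversion_set n \<tau>) = D"
    by (auto simp: D_def inversion_set_def)
  have "bij_betw F D {(k, l). k < l \<and> l < n \<and> (\<tau> \<circ> inv \<sigma>) l < (\<tau> \<circ> inv \<sigma>) k}"
    (is "bij_betw F D ?E")
  proof (rule bij_betw_byWitness[of _ G])
    show "\<forall>p\<in>D. G (F p) = p"
      by (auto simp: F_def G_def D_def inv)
    show "\<forall>p\<in>?E. F (G p) = p"
      by (auto simp: F_def G_def inv)
    show "F ` D \<subseteq> ?E"
    proof (rule image_subsetI)
      fix p assume "p \<in> D"
      then obtain i j where p: "p = (i, j)" and ij: "i < j" "j < n" "(\<sigma> j < \<sigma> i) \<noteq> (\<tau> j < \<tau> i)" by (auto simp: D_def)
      from ij have "\<sigma> i \<noteq> \<sigma> j" "\<tau> i \<noteq> \<tau> j" by (auto simp: eq)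
      with ij have "\<sigma> i < \<sigma> j \<and> \<tau> j < \<tau> i \<or> \<sigma> j < \<sigma> i \<and> \<tau> i < \<tau> j" by linarith
      then show "F p \<in> ?E" using p ij lt[of i] lt[of j] by (auto simp: F_def inv)
    qed
    show "G ` ?E \<subseteq> D"
    proof (rule image_subsetI)
      fix p assume "p \<in> ?E"
      then obtain k l where p: "p = (k, l)"
        and kl: "k < l" "l < n" "(\<tau> \<circ> inv \<sigma>) l < (\<tau> \<circ> inv \<sigma>) k" by auto
      then have "inv \<sigma> k \<noteq> inv \<sigma> l" by (auto simp: eq)
      then show "G p \<in> D" using p kl lt[of k] lt[of l] by (auto simp: G_def D_def inv)
    qed
  qed
  from bij_betw_same_card[OF this] show ?thesis
    by (simp only: inversions_def D)
qed

lemma exists_inversion_kernel: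
  assumes q: "-1 < q" "q < 1"
  obtains u :: "(nat \<Rightarrow> nat) \<Rightarrow> (nat \<times> nat) set ell2" where
    "\<And>\<sigma> \<tau>. cinner (u \<sigma>) (u \<tau>) =
      complex_of_real (q ^ card (sym_diff (inversion_set n \<sigma>) (inversion_set n \<tau>)))"
proof -
  define X where "X = {(i, j). i < j \<and> j < n}"
  have "X \<subseteq> {..<n} \<times> {..<n}" by (auto simp: X_def)
  then have fin: "finite X" by (rule finite_subset) simp
  have sub: "inversion_set n \<sigma> \<subseteq> X" for \<sigma>
    by (auto simp: inversion_set_def X_def)
  define a where "a \<sigma> p = (if p \<in> inversion_set n \<sigma> then sqrt (1 - q\<^sup>2) else 0)" for \<sigma> p
  define b where "b \<sigma> p = (if p \<in> inversion_set n \<sigma> then q else 1)" for \<sigma> p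
  define c where "c \<sigma> S = (\<Prod>p\<in>S. a \<sigma> p) * (\<Prod>p\<in>X - S. b \<sigma> p)" for \<sigma> S
  define u where "u \<sigma> = (\<Sum>S\<in>Pow X. complex_of_real (c \<sigma> S) *\<^sub>C ket S)" for \<sigma>
  have "q\<^sup>2 \<le> 1" using q by (simp add: abs_square_le_1 abs_le_iff)
  then have sqrt: "\<bar>1 - q\<^sup>2\<bar> = 1 - q * q"
    by (simp add: power2_eq_square)
  have "cinner (u \<sigma>) (u \<tau>) =
      complex_of_real (q ^ card (sym_diff (inversion_set n \<sigma>) (inversion_set n \<tau>)))" for \<sigma> \<tau>
  proof -
    have "cinner (u \<sigma>) (u \<tau>) = complex_of_real (\<Sum>S\<in>Pow X. c \<sigma> S * c \<tau> S)"
      using fin by (simp add: u_def cinner_simps cinner_ket_ket if_distrib mult.commute cong: if_cong)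
    also have "(\<Sum>S\<in>Pow X. c \<sigma> S * c \<tau> S) =
        (\<Sum>S\<in>Pow X. (\<Prod>p\<in>S. a \<sigma> p * a \<tau> p) * (\<Prod>p\<in>X - S. b \<sigma> p * b \<tau> p))"
      by (simp add: c_def prod.distrib mult_ac)
    also have "\<dots> = (\<Prod>p\<in>X. a \<sigma> p * a \<tau> p + b \<sigma> p * b \<tau> p)"
      using fin by (simp add: prod_add)
    also have "\<dots> = (\<Prod>p\<in>X. if p \<in> sym_diff (inversion_set n \<sigma>) (inversion_set n \<tau>) then q else 1)"
      by (rule prod.cong) (auto simp: a_def b_def sqrt)
    also have "\<dots> = q ^ card (sym_diff (inversion_set n \<sigma>) (inversion_set n \<tau>))"
    proof -
      have "X \<inter> sym_diff (inversion_set n \<sigma>) (inversion_set n \<tau>) =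
          sym_diff (inversion_set n \<sigma>) (inversion_set n \<tau>)"
        using sub by blast
      then show ?thesis using fin by (simp add: prod.If_cases Int_def)
    qed
    finally show ?thesis .
  qed
  then show ?thesis by (rule that)
qed

lemma exists_q_form_gram:
  assumes q: "-1 < q" "q < 1"
  obtains J :: "'a ell2 list \<Rightarrow> ('a list \<times> (nat \<times> nat) set) ell2" where
    "\<And>fs gs. cinner (J fs) (J gs) = q_form q fs gs"
proof -
  obtain T :: "'a ell2 list \<Rightarrow> 'a list ell2" where T: "\<And>fs gs. cinner (T fs) (T gs) =
      (if length fs = length gs then \<Prod>k<length fs. cinner (fs ! k) (gs ! k) else 0)"
    using exists_list_tensor by metis
  have "\<forall>n. \<exists>u :: (nat \<Rightarrow> nat) \<Rightarrow> (nat \<times> nat) set ell2. \<forall>\<sigma> \<tau>. cinner (u \<sigma>) (u \<tau>) =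
      complex_of_real (q ^ card (sym_diff (inversion_set n \<sigma>) (inversion_set n \<tau>)))"
    using exists_inversion_kernel[OF q] by metis
  then obtain u :: "nat \<Rightarrow> (nat \<Rightarrow> nat) \<Rightarrow> (nat \<times> nat) set ell2" where u: "\<And>n \<sigma> \<tau>.
      cinner (u n \<sigma>) (u n \<tau>) =
        complex_of_real (q ^ card (sym_diff (inversion_set n \<sigma>) (inversion_set n \<tau>)))"
    by metis
  obtain P :: "'a list ell2 \<Rightarrow> (nat \<times> nat) set ell2 \<Rightarrow> ('a list \<times> (nat \<times> nat) set) ell2" where
    P: "\<And>f g f' g'. cinner (P f g) (P f' g') = cinner f f' * cinner g g'"
    using exists_tensor[OF inj_on_id] by metis
  define perm where "perm fs \<sigma> = map (\<lambda>k. fs ! \<sigma> k) [0..<length fs]"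
    for fs :: "'a ell2 list" and \<sigma> :: "nat \<Rightarrow> nat"
  define S where "S n = {\<sigma>. \<sigma> permutes {..<n::nat}}" for n
  define J where "J fs = complex_of_real (1 / sqrt (fact (length fs))) *\<^sub>C
      (\<Sum>\<sigma>\<in>S (length fs). P (T (perm fs \<sigma>)) (u (length fs) \<sigma>))" for fs
  have [simp]: "length (perm fs \<sigma>) = length fs" for fs \<sigma>
    by (simp add: perm_def)
  have "cinner (J fs) (J gs) = q_form q fs gs" for fs gs
  proof (cases "length fs = length gs")
    case False
    then show ?thesis
      by (simp add: J_def cinner_simps P T q_form_def)
  next
    case True
    define n where "n = length fs"
    have n: "length fs = n" "length gs = n" using True by (auto simp: n_def)
    have finS: "finite (S n)" by (simp add: S_def finite_permutations)
    have cardS: "card (S n) = fact n" by (simp add: S_def card_permutations)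
    define K where "K \<pi> = complex_of_real (q ^ inversions n \<pi>) *
        (\<Prod>k<n. cinner (fs ! k) (gs ! \<pi> k))" for \<pi>
    have trm: "cinner (P (T (perm fs \<sigma>)) (u n \<sigma>)) (P (T (perm gs \<tau>)) (u n \<tau>)) = K (\<tau> \<circ> inv \<sigma>)"
      if "\<sigma> \<in> S n" "\<tau> \<in> S n" for \<sigma> \<tau>
    proof -
      have s: "\<sigma> permutes {..<n}" and t: "\<tau> permutes {..<n}" using that by (auto simp: S_def)
      have "(\<Prod>k<n. cinner (fs ! k) (gs ! (\<tau> \<circ> inv \<sigma>) k)) =
          (\<Prod>k<n. cinner (fs ! \<sigma> k) (gs ! (\<tau> \<circ> inv \<sigma>) (\<sigma> k)))"
        using prod.permute[OF s, of "\<lambda>k. cinner (fs ! k) (gs ! (\<tau> \<circ> inv \<sigma>) k)"]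
        by (simp add: o_def)
      also have "\<dots> = (\<Prod>k<n. cinner (fs ! \<sigma> k) (gs ! \<tau> k))"
        by (simp add: permutes_inverses[OF s])
      finally show ?thesis
        by (simp add: P T u K_def inversions_compose_inv[OF s t] n perm_def mult.commute)
    qed
    have "cinner (J fs) (J gs) = complex_of_real (1 / sqrt (fact n) * (1 / sqrt (fact n))) *
        (\<Sum>\<sigma>\<in>S n. \<Sum>\<tau>\<in>S n. cinner (P (T (perm fs \<sigma>)) (u n \<sigma>)) (P (T (perm gs \<tau>)) (u n \<tau>)))"
      by (simp only: J_def cinner_simps n complex_cnj_complex_of_real of_real_mult mult.assoc sum_distrib_left)
        (rule sum.swap)
    also have "1 / sqrt (fact n) * (1 / sqrt (fact n)) = 1 / (fact n :: real)"
      by (simp add: real_sqrt_mult_self)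
    also have "(\<Sum>\<sigma>\<in>S n. \<Sum>\<tau>\<in>S n. cinner (P (T (perm fs \<sigma>)) (u n \<sigma>)) (P (T (perm gs \<tau>)) (u n \<tau>))) =
        (\<Sum>\<sigma>\<in>S n. \<Sum>\<tau>\<in>S n. K (\<tau> \<circ> inv \<sigma>))"
      by (intro sum.cong refl trm)
    also have "\<dots> = (\<Sum>\<sigma>\<in>S n. \<Sum>\<pi>\<in>S n. K \<pi>)"
    proof (rule sum.cong[OF refl])
      fix \<sigma> assume "\<sigma> \<in> S n"
      then have s: "\<sigma> permutes {..<n}" by (simp add: S_def)
      show "(\<Sum>\<tau>\<in>S n. K (\<tau> \<circ> inv \<sigma>)) = (\<Sum>\<pi>\<in>S n. K \<pi>)"
        by (rule sum.reindex_bij_witness[of _ "\<lambda>\<pi>. \<pi> \<circ> \<sigma>" "\<lambda>\<tau>. \<tau> \<circ> inv \<sigma>"])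
          (auto simp: S_def o_assoc[symmetric] permutes_inv_o[OF s] intro: permutes_compose s permutes_inv)
    qed
    also have "\<dots> = of_nat (fact n) * (\<Sum>\<pi>\<in>S n. K \<pi>)"
      by (simp add: cardS)
    finally show ?thesis
      by (simp add: q_form_def n K_def S_def)
  qed
  then show ?thesis by (rule that)
qed

text \<open>Multilinearity and continuity of the tensors are consequences of the inner products.\<close>

lemma gram_multilinear:
  fixes J :: "'k::complex_inner list \<Rightarrow> 'v::complex_inner"
  assumes J: "\<And>fs gs. cinner (J fs) (J gs) = q_form q fs gs"
  shows "J (as @ (f + g) # bs) = J (as @ f # bs) + J (as @ g # bs)"
    and "J (as @ (c *\<^sub>C f) # bs) = c *\<^sub>C J (as @ f # bs)"

proof -
  define m where "m = length as"
  define n where "n = length (as @ f # bs)"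
  have split: "(\<Prod>k<n. cinner ((as @ h # bs) ! k) (y k)) =
      cinner h (y m) * (\<Prod>k\<in>{..<n} - {m}. cinner ((as @ f # bs) ! k) (y k))" for h and y :: "nat \<Rightarrow> 'k"
  proof -
    have "m \<in> {..<n}" by (simp add: m_def n_def)
    then have "(\<Prod>k<n. cinner ((as @ h # bs) ! k) (y k)) =
        cinner ((as @ h # bs) ! m) (y m) * (\<Prod>k\<in>{..<n} - {m}. cinner ((as @ h # bs) ! k) (y k))"
      by (intro prod.remove) auto
    also have "(as @ h # bs) ! m = h" by (simp add: m_def)
    also have "(\<Prod>k\<in>{..<n} - {m}. cinner ((as @ h # bs) ! k) (y k)) =
        (\<Prod>k\<in>{..<n} - {m}. cinner ((as @ f # bs) ! k) (y k))"
      by (rule prod.cong) (auto simp: nth_append m_def nth_Cons')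
    finally show ?thesis .
  qed
  have len: "length (as @ h # bs) = n" for h by (simp add: n_def)
  have add: "q_form q (as @ (f + g) # bs) hs = q_form q (as @ f # bs) hs + q_form q (as @ g # bs) hs"
    for g hs
    unfolding q_form_def len split
    by (simp add: cinner_add_left distrib_right distrib_left sum.distrib)
  have scale: "q_form q (as @ (c *\<^sub>C f) # bs) hs = c * q_form q (as @ f # bs) hs" for c hs
    unfolding q_form_def len split
    by (simp add: cinner_scaleC_left sum_distrib_left mult_ac)
  show "J (as @ (f + g) # bs) = J (as @ f # bs) + J (as @ g # bs)"
  proof -
    define d where "d = J (as @ (f + g) # bs) - (J (as @ f # bs) + J (as @ g # bs))"
    have "cinner d (J hs) = 0" for hs
      by (simp add: d_def cinner_simps J add)
    then have "cinner d d = 0"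
      unfolding d_def[THEN arg_cong[of _ _ "cinner d"]] by (simp add: cinner_simps)
    then show ?thesis by (simp add: cinner_self_eq_0 d_def)
  qed
  show "J (as @ (c *\<^sub>C f) # bs) = c *\<^sub>C J (as @ f # bs)"
  proof -
    define d where "d = J (as @ (c *\<^sub>C f) # bs) - c *\<^sub>C J (as @ f # bs)"
    have "cinner d (J hs) = 0" for hs
      by (simp add: d_def cinner_simps J scale)
    then have "cinner d d = 0"
      unfolding d_def[THEN arg_cong[of _ _ "cinner d"]] by (simp add: cinner_simps)
    then show ?thesis by (simp add: cinner_self_eq_0 d_def)
  qed
qed

lemma norm_gram_le:
  fixes J :: "'k::complex_inner list \<Rightarrow> 'v::complex_inner"
  assumes J: "\<And>fs gs. cinner (J fs) (J gs) = q_form q fs gs"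
  shows "norm (J fs) \<le> sqrt (\<Sum>\<pi> | \<pi> permutes {..<length fs}. \<bar>q ^ inversions (length fs) \<pi>\<bar>) *
    prod_list (map norm fs)"
proof -
  define n where "n = length fs"
  define S where "S = {\<pi>. \<pi> permutes {..<n}}"
  define N where "N = (\<Prod>k<n. norm (fs ! k))"
  have N: "prod_list (map norm fs) = N"
    by (simp add: N_def n_def prod.list_conv_set_nth atLeast0LessThan)
  have "(norm (J fs))\<^sup>2 = cmod (cinner (J fs) (J fs))"
    by (simp add: cinner_self norm_power)
  also have "\<dots> = cmod (\<Sum>\<pi>\<in>S. complex_of_real (q ^ inversions n \<pi>) *
      (\<Prod>k<n. cinner (fs ! k) (fs ! \<pi> k)))"
    by (simp add: J q_form_def n_def S_def)
  also have "\<dots> \<le> (\<Sum>\<pi>\<in>S. \<bar>q ^ inversions n \<pi>\<bar> * N\<^sup>2)"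
  proof (rule sum_norm_le)
    fix \<pi> assume "\<pi> \<in> S"
    then have p: "\<pi> permutes {..<n}" by (simp add: S_def)
    have "cmod (\<Prod>k<n. cinner (fs ! k) (fs ! \<pi> k)) \<le> (\<Prod>k<n. norm (fs ! k) * norm (fs ! \<pi> k))"
      unfolding prod_norm[symmetric] by (rule prod_mono) (simp add: complex_Cauchy_Schwarz)
    also have "\<dots> = N * (\<Prod>k<n. norm (fs ! \<pi> k))"
      by (simp add: prod.distrib N_def)
    also have "(\<Prod>k<n. norm (fs ! \<pi> k)) = N"
      using prod.permute[OF p, of "\<lambda>k. norm (fs ! k)"] by (simp add: N_def o_def)
    finally have "cmod (\<Prod>k<n. cinner (fs ! k) (fs ! \<pi> k)) \<le> N\<^sup>2"
      by (simp add: power2_eq_square)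
    then show "cmod (complex_of_real (q ^ inversions n \<pi>) * (\<Prod>k<n. cinner (fs ! k) (fs ! \<pi> k)))
        \<le> \<bar>q ^ inversions n \<pi>\<bar> * N\<^sup>2"
      unfolding norm_mult norm_of_real by (rule mult_left_mono) simp
  qed
  also have "\<dots> = (\<Sum>\<pi>\<in>S. \<bar>q ^ inversions n \<pi>\<bar>) * N\<^sup>2"
    by (simp only: sum_distrib_right)
  also have "\<dots> = (sqrt (\<Sum>\<pi>\<in>S. \<bar>q ^ inversions n \<pi>\<bar>) * N)\<^sup>2"
    by (simp add: power_mult_distrib sum_nonneg)
  finally have "norm (J fs) \<le> sqrt (\<Sum>\<pi>\<in>S. \<bar>q ^ inversions n \<pi>\<bar>) * N"
    by (rule power2_le_imp_le) (simp add: sum_nonneg N_def prod_nonneg)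
  then show ?thesis by (simp only: N S_def n_def)
qed

lemma bounded_linear_gram:
  fixes J :: "'k::complex_inner list \<Rightarrow> 'v::complex_inner"
  assumes J: "\<And>fs gs. cinner (J fs) (J gs) = q_form q fs gs"
  shows "bounded_linear (\<lambda>f. J (as @ f # bs))"
proof -
  define n where "n = Suc (length as + length bs)"
  define C where "C = sqrt (\<Sum>\<pi> | \<pi> permutes {..<n}. \<bar>q ^ inversions n \<pi>\<bar>)"
  show ?thesis
  proof (rule bounded_linear_intro)
    show "norm (J (as @ f # bs)) \<le>
        norm f * (C * prod_list (map norm as) * prod_list (map norm bs))" for f
      using norm_gram_le[of J q "as @ f # bs", OF J] by (simp add: C_def n_def mult_ac)
    show "J (as @ (r *\<^sub>R f) # bs) = r *\<^sub>R J (as @ f # bs)" for r f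
      using gram_multilinear(2)[of J q as "complex_of_real r", OF J] by (simp add: scaleC_of_real)
  qed (rule gram_multilinear(1)[of J q, OF J])
qed

lemma q_fock_space_exists:
  assumes q: "-1 < q" "q < 1"
  shows "\<exists>\<Phi> :: int ell2 list \<Rightarrow> nat ell2. q_fock_space q \<Phi>"
proof -
  obtain J :: "int ell2 list \<Rightarrow> (int list \<times> (nat \<times> nat) set) ell2" where
    J: "\<And>fs gs. cinner (J fs) (J gs) = q_form q fs gs"
    using exists_q_form_gram[OF q] by metis
  define x where "x n = J (map ket (from_nat n))" for n
  have x: "J (map ket w) \<in> range x" for w
    by (rule range_eqI[of _ _ "to_nat w"]) (simp add: x_def)
  have "J (map ket w @ fs) \<in> closure (cspan (range x))" for w fs
  proof (induction fs arbitrary: w)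
    case Nil
    have "J (map ket w) \<in> cspan (range x)"
      using x by (rule complex_vector.span_base)
    then show ?case using closure_subset by force
  next
    case (Cons f fs)
    let ?V = "{g. J (map ket w @ g # fs) \<in> closure (cspan (range x))}"
    have J0: "J (map ket w @ 0 # fs) = 0"
      using linear_0[OF bounded_linear.linear[OF bounded_linear_gram[of J q, OF J]]] .
    have "cspan (range ket) \<subseteq> ?V"
    proof (rule complex_vector.span_minimal)
      show "range ket \<subseteq> ?V"
        using Cons[of "w @ [_]"] by auto
      show "complex_vector.subspace ?V"
        using subspace_closure_cspan[of "range x"]
        by (auto simp: complex_vector.subspace_def J0 gram_multilinear[of J q, OF J])
    qed
    moreover have "closed ?V"
      using linear_continuous_on[OF bounded_linear_gram[of J q "map ket w" fs, OF J], of UNIV]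
      by (auto intro: closed_vimage simp: vimage_def[symmetric])
    ultimately have "closure (cspan (range ket)) \<subseteq> ?V"
      by (rule closure_minimal)
    then show ?case by (simp add: closure_cspan_ket set_eq_subset subset_iff)
  qed
  from this[of "[]"] have Jx: "range J \<subseteq> closure (cspan (range x))"
    by auto
  have orth: "cinner (J [ket i]) (J [ket j]) = (if i = j then 1 else 0)" for i j
  proof -
    have "{\<pi>. \<pi> permutes {..<Suc 0}} = {id}"
      by (auto simp: lessThan_Suc)
    moreover have "{(i, j). i < j \<and> j < Suc 0 \<and> id j < id i} = {}"
      by auto
    then have "inversions (Suc 0) id = 0"
      unfolding inversions_def by (simp only: card.empty)
    ultimately show ?thesis
      by (simp add: J q_form_def cinner_ket_ket)
  qed
  have inf: "\<not> range x \<subseteq> cspan B" if B: "finite B" for B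
  proof
    assume "range x \<subseteq> cspan B"
    then have sub: "range (\<lambda>i. J [ket i]) \<subseteq> cspan B"
      using x[of "[_]"] by auto
    have "inj (\<lambda>i. J [ket i])"
    proof (rule injI)
      fix i j assume "J [ket i] = J [ket j]"
      then have "cinner (J [ket i]) (J [ket j]) = cinner (J [ket j]) (J [ket j])" by simp
      then show "i = j" by (simp add: orth split: if_splits)
    qed
    then have infinite: "infinite (range (\<lambda>i. J [ket i]))"
      by (simp add: finite_image_iff)
    have "complex_vector.independent (range (\<lambda>i. J [ket i]))"
      unfolding complex_vector.independent_explicit_module
    proof (intro allI impI)
      fix t u v
      assume t: "finite t" "t \<subseteq> range (\<lambda>i. J [ket i])" and sum: "(\<Sum>v\<in>t. u v *\<^sub>C v) = 0" and "v \<in> t"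
      have o: "cinner y v = (if y = v then 1 else 0)" if "y \<in> t" for y
      proof -
        obtain i j where "y = J [ket i]" "v = J [ket j]"
          using \<open>y \<in> t\<close> \<open>v \<in> t\<close> t(2) by blast
        then show ?thesis using orth[of i j] orth[of i i] by auto
      qed
      have "0 = cinner (\<Sum>v\<in>t. u v *\<^sub>C v) v" by (simp add: sum cinner_zero_left)
      also have "\<dots> = (\<Sum>y\<in>t. u y * (if y = v then 1 else 0))"
        by (simp only: cinner_sum_left cinner_scaleC_left o cong: sum.cong)
      also have "\<dots> = u v"
        using t(1) \<open>v \<in> t\<close> by (simp add: if_distrib cong: if_cong)
      finally show "u v = 0" by simp
    qed
    from complex_vector.independent_span_bound[OF B this sub] infinite show False by blast
  qed
  have "range x \<subseteq> range J" by (auto simp: x_def)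
  then obtain \<Phi> :: "int ell2 list \<Rightarrow> nat ell2" where
    "\<And>fs gs. cinner (\<Phi> fs) (\<Phi> gs) = cinner (J fs) (J gs)" "closure (cspan (range \<Phi>)) = UNIV"
    using exists_sequence_model[OF inf _ Jx] by metis
  then have "q_fock_space q \<Phi>"
    by (simp add: q_fock_space_def J)
  then show ?thesis by (rule exI[of _ \<Phi>])
qed

end

theory Submission
  imports Defs
begin

text \<open>
  The reason for the uniqueness is that averages over permutations converge in norm to the vacuum
  expectation: there are permutations \<open>g\<^sub>0, g\<^sub>1, \<dots>\<close> such that
  \<open>(1 / n) \<Sum>\<^sub>k\<^sub><\<^sub>n \<alpha>\<^bsub>g\<^sub>k\<^esub>(x) \<longlonglongrightarrow> \<omega>\<^sub>q(x) 1\<close> for all \<open>x\<close> in the algebra of the annihilators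
  (\<open>avg_tendsto_vacuum\<close>). A symmetric state \<open>\<phi>\<close> does not distinguish \<open>x\<close> from its averages and is
  continuous, so \<open>\<phi>(x) = \<omega>\<^sub>q(x)\<close>. The algebra of the selfadjoint parts is an invariant subalgebra, so
  that the argument applies to its states without any extension to the larger algebra.

  For the convergence, the relation \<open>a\<^sub>i a\<^sub>j\<^sup>\<dagger> = \<delta>\<^sub>i\<^sub>j + q a\<^sub>j\<^sup>\<dagger> a\<^sub>i\<close> shows that the algebra is the closed span of the
  Wick ordered words. The identity is fixed by the averages. Any other word is, up to passage to
  the adjoint, of the form \<open>y a\<^sub>j\<close>, and its vacuum expectation is \<open>0\<close>. If the indices \<open>g\<^sub>k(j)\<close> are distinct,
  then the Cauchy-Schwarz inequality bounds \<open>\<parallel>\<Sum>\<^sub>k \<alpha>\<^bsub>g\<^sub>k\<^esub>(y) a\<^bsub>g\<^sub>k(j)\<^esub>\<parallel>\<close> by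
  \<open>\<parallel>y\<parallel> \<surd>n \<parallel>\<Sum>\<^sub>k a\<^bsub>g\<^sub>k(j)\<^esub>\<^sup>\<dagger> a\<^bsub>g\<^sub>k(j)\<^esub>\<parallel>\<^sup>1\<^sup>/\<^sup>2\<close>. The last norm stays below \<open>1 / (1 - |q|)\<close>, whatever the number of
  summands (\<open>sum_norm_annihilator_le\<close>), and the average is of order \<open>1 / \<surd>n\<close>.

  The same estimate, proved by induction on the degree for formal linear combinations of elementary
  tensors, also yields the existence of the creators as bounded operators. It rests on the expansion
  of the \<open>q\<close>-inner product along the first tensor factor (\<open>q_form_Cons\<close>).

  The action of the permutations is defined by a description, so that the uniqueness of the
  automorphism has to be shown as well. Automorphisms and states are continuous because \<open>1 - h\<close> has a
  self-adjoint square root in the algebra for every self-adjoint \<open>h\<close> with \<open>\<parallel>h\<parallel> < 1\<close>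
  (\<open>exists_sqrt_one_minus\<close>). Existence comes from the unitary operators that permute the basis in every
  tensor factor (\<open>perm_action_eq_act\<close>).
\<close>

section \<open>Adjoints\<close>

lemma cinner_eqI:
  assumes "\<And>v. cinner v a = cinner v b"
  shows "a = b"
  using assms[of "a - b"] cinner_self_eq_0[of "a - b"] by (simp add: cinner_diff_right)

text \<open>The representing vector minimises \<open>\<parallel>v\<parallel>\<^sup>2 / 2 - f v\<close>: by the parallelogram law every minimising
  sequence is Cauchy, and the vanishing of the derivative at the minimiser is the claim.\<close>

lemma bounded_linear_eq_inner:
  fixes f :: "'a::{real_inner, complete_space} \<Rightarrow> real"
  assumes "bounded_linear f"
  obtains w where "\<And>v. f v = inner v w"
proof -
  interpret f: bounded_linear f by fact
  define g where "g v = (norm v)\<^sup>2 / 2 - f v" for v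
  obtain K where K: "\<And>v. norm (f v) \<le> norm v * K"
    using f.bounded by blast
  have "- (K\<^sup>2 / 2) \<le> g v" for v
  proof -
    have "0 \<le> (norm v - K)\<^sup>2" by simp
    moreover have "f v \<le> norm v * K" using K[of v] by simp
    ultimately show ?thesis by (simp add: g_def power2_diff)
  qed
  then have bdd: "bdd_below (range g)" by (intro bdd_belowI2)
  define m where "m = Inf (range g)"
  have m: "m \<le> g v" for v unfolding m_def by (rule cInf_lower[OF _ bdd]) simp
  have "\<exists>v. g v < m + inverse (Suc n)" for n
    using cInf_lessD[of "range g" "m + inverse (Suc n)"] unfolding m_def by auto
  then obtain x where x: "\<And>n. g (x n) < m + inverse (Suc n)" by metis
  have para: "(norm (u - v))\<^sup>2 = 4 * (g u + g v - 2 * g ((1/2) *\<^sub>R (u + v)))" for u v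
    unfolding g_def f.scaleR f.add norm_scaleR power_mult_distrib power2_norm_eq_inner
    by (simp add: inner_simps inner_commute field_simps power2_eq_square)
  have diff: "(norm (x k - x l))\<^sup>2 \<le> 8 * inverse (Suc n)" if "n \<le> k" "n \<le> l" for n k l
  proof -
    have "inverse (real (Suc k)) \<le> inverse (Suc n)" "inverse (real (Suc l)) \<le> inverse (Suc n)"
      using that by (auto intro!: le_imp_inverse_le)
    moreover define p where "p = g ((1/2) *\<^sub>R (x k + x l))"
    ultimately show ?thesis
      using para[of "x k" "x l", folded p_def] m[of "(1/2) *\<^sub>R (x k + x l)", folded p_def] x[of k] x[of l]
      by argo
  qed
  have "Cauchy x"
  proof (rule CauchyI)
    fix e :: real assume "0 < e"
    then obtain n where "inverse (real (Suc n)) < e\<^sup>2 / 8"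
      using reals_Archimedean[of "e\<^sup>2 / 8"] by auto
    then have "norm (x k - x l) < e" if "n \<le> k" "n \<le> l" for k l
      using diff[OF that] \<open>0 < e\<close> by (intro power_less_imp_less_base[of _ 2 e]) linarith+
    then show "\<exists>M. \<forall>k\<ge>M. \<forall>l\<ge>M. norm (x k - x l) < e" by blast
  qed
  then obtain w where w: "x \<longlonglongrightarrow> w" by (auto simp: Cauchy_convergent_iff convergent_def)
  have gm: "g w \<le> m"
  proof (rule LIMSEQ_le)
    show "(\<lambda>n. g (x n)) \<longlonglongrightarrow> g w" unfolding g_def by (intro tendsto_intros w f.tendsto) simp
    show "(\<lambda>n. m + inverse (real (Suc n))) \<longlonglongrightarrow> m"
      using tendsto_add[OF tendsto_const LIMSEQ_inverse_real_of_nat, of m] by simp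
  qed (use x less_imp_le in blast)
  have "f v = inner v w" for v
  proof -
    define a where "a = inner v w - f v"
    \<comment> \<open>The optimal step along \<open>v\<close> has length \<open>- a / \<parallel>v\<parallel>\<^sup>2\<close>; the additional \<open>1\<close> covers \<open>v = 0\<close>.\<close>
    define c where "c = (norm v)\<^sup>2 + 1"
    have c: "c > 0" "(norm v)\<^sup>2 \<le> c" by (simp_all add: c_def add_nonneg_pos)
    have eq: "g (w + t *\<^sub>R v) = g w + (t * a + t\<^sup>2 * (norm v)\<^sup>2 / 2)" for t
      unfolding g_def f.scaleR f.add a_def power2_norm_eq_inner
      by (simp add: inner_simps inner_commute field_simps power2_eq_square)
    have "g w \<le> g (w + (- a / c) *\<^sub>R v)" using gm m order_trans by blast
    then have "0 \<le> (- a / c) * a + (- a / c)\<^sup>2 * (norm v)\<^sup>2 / 2"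
      unfolding eq by linarith
    also have "\<dots> \<le> (- a / c) * a + (- a / c)\<^sup>2 * c / 2"
      using c by (intro add_left_mono divide_right_mono mult_left_mono) auto
    also have "\<dots> = - (a\<^sup>2 / (2 * c))"
      using c by (simp add: field_simps power2_eq_square)
    finally have "a\<^sup>2 \<le> 0" using c by (simp add: divide_le_0_iff)
    then show ?thesis by (simp add: a_def)
  qed
  then show ?thesis by (rule that)
qed

lemma bounded_operators_apply_scaleC:
  "x \<in> bounded_operators \<Longrightarrow> blinfun_apply x (c *\<^sub>C v) = c *\<^sub>C blinfun_apply x v"
  by (simp add: bounded_operators_def)

text \<open>The real part of \<open>v \<mapsto> \<langle>x v, w\<rangle>\<close> is represented by a vector; complex linearity, applied to
  \<open>\<i> v\<close>, shows that the same vector represents the imaginary part.\<close>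

lemma exists_adjoint:
  assumes x: "x \<in> bounded_operators"
  shows "\<exists>y. \<forall>v w. cinner (blinfun_apply x v) w = cinner v (blinfun_apply y w)"
proof -
  have "\<exists>z. \<forall>v. cinner (blinfun_apply x v) w = cinner v z" for w
  proof -
    have "bounded_linear (\<lambda>v. Re (cinner (blinfun_apply x v) w))"
      by (intro bounded_linear_compose[OF bounded_linear_Re]
          bounded_linear_compose[OF bounded_linear_cinner_left] blinfun.bounded_linear_right)
    then obtain z where z: "\<And>v. Re (cinner (blinfun_apply x v) w) = inner v z"
      by (rule bounded_linear_eq_inner) blast
    have "cinner (blinfun_apply x v) w = cinner v z" for v
      using z[of v] z[of "\<i> *\<^sub>C v"]
      by (simp add: inner_eq_Re_cinner bounded_operators_apply_scaleC[OF x] cinner_scaleC_left complex_eq_iff)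
    then show ?thesis by blast
  qed
  then obtain z where z: "\<And>v w. cinner (blinfun_apply x v) w = cinner v (z w)" by metis
  have "bounded_linear z"
  proof (rule bounded_linear_intro)
    show "z (u + v) = z u + z v" for u v
      by (rule cinner_eqI) (simp add: cinner_add_right flip: z)
    show "z (r *\<^sub>R u) = r *\<^sub>R z u" for r u
      by (rule cinner_eqI) (simp add: cinner_scaleC_right flip: z scaleC_of_real)
    show "norm (z w) \<le> norm w * norm x" for w
    proof (cases "z w = 0")
      case False
      have "(norm (z w))\<^sup>2 = cmod (cinner (z w) (z w))"
        by (simp add: cinner_self norm_power)
      also have "\<dots> = cmod (cinner (blinfun_apply x (z w)) w)"
        by (simp add: z)
      also have "\<dots> \<le> norm (blinfun_apply x (z w)) * norm w"
        by (rule complex_Cauchy_Schwarz)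
      also have "\<dots> \<le> norm x * norm (z w) * norm w"
        by (intro mult_right_mono norm_blinfun) simp
      finally show ?thesis using False by (simp add: power2_eq_square mult_ac)
    qed simp
  qed
  then show ?thesis
    by (intro exI[of _ "Blinfun z"]) (simp add: bounded_linear_Blinfun_apply z)
qed

lemma adjoint_op_eqI:
  assumes "\<And>v w. cinner (blinfun_apply x v) w = cinner v (blinfun_apply y w)"
  shows "adjoint_op x = y"
  unfolding adjoint_op_def
proof (rule the_equality)
  fix z assume "\<forall>v w. cinner (blinfun_apply x v) w = cinner v (blinfun_apply z w)"
  then show "z = y" by (intro blinfun_eqI cinner_eqI) (simp add: assms[symmetric])
qed (use assms in simp)

lemma cinner_adjoint_right:
  assumes "x \<in> bounded_operators"
  shows "cinner v (blinfun_apply (adjoint_op x) w) = cinner (blinfun_apply x v) w"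
  using exists_adjoint[OF assms] adjoint_op_eqI by metis

lemma cinner_adjoint_left:
  assumes "x \<in> bounded_operators"
  shows "cinner (blinfun_apply (adjoint_op x) w) v = cinner w (blinfun_apply x v)"
  using cinner_adjoint_right[OF assms] cinner_commute by metis

lemma bounded_operators_adjoint: "x \<in> bounded_operators \<Longrightarrow> adjoint_op x \<in> bounded_operators"
  unfolding bounded_operators_def[THEN eqset_imp_iff, of "adjoint_op x"] mem_Collect_eq
  by (intro allI cinner_eqI) (simp add: cinner_adjoint_right cinner_scaleC_right)

lemma bounded_operators_id: "id_blinfun \<in> bounded_operators"
  by (simp add: bounded_operators_def)

lemma bounded_operators_add:
  "x \<in> bounded_operators \<Longrightarrow> y \<in> bounded_operators \<Longrightarrow> x + y \<in> bounded_operators"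
  by (simp add: bounded_operators_def blinfun.add_left scaleC_add_right)

lemma bounded_operators_compose:
  "x \<in> bounded_operators \<Longrightarrow> y \<in> bounded_operators \<Longrightarrow> x o\<^sub>L y \<in> bounded_operators"
  by (simp add: bounded_operators_def)

lemma blinfun_apply_scaleC: "blinfun_apply (c *\<^sub>C x) v = c *\<^sub>C blinfun_apply x v"
  by transfer simp

lemma bounded_operators_scale: "x \<in> bounded_operators \<Longrightarrow> c *\<^sub>C x \<in> bounded_operators"
  by (simp add: bounded_operators_def blinfun_apply_scaleC scaleC_scaleC mult.commute)

lemma bounded_linear_scaleC: "bounded_linear (\<lambda>v::'a::complex_inner. c *\<^sub>C v)"
  by (rule bounded_linear_intro[of _ "cmod c"])
    (simp_all add: scaleC_add_right norm_scaleC scaleC_scaleC mult.commute flip: scaleC_of_real)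

lemma tendsto_blinfun_apply_left: "(f \<longlongrightarrow> x) F \<Longrightarrow> ((\<lambda>n. blinfun_apply (f n) v) \<longlongrightarrow> blinfun_apply x v) F"
  by (rule bounded_linear.tendsto[OF blinfun.bounded_linear_left])

lemma closed_bounded_operators: "closed bounded_operators"
  unfolding closed_sequential_limits
proof (intro allI impI, elim conjE)
  fix f :: "nat \<Rightarrow> ('a \<Rightarrow>\<^sub>L 'a)" and x
  assume f: "\<forall>n. f n \<in> bounded_operators" and x: "f \<longlonglongrightarrow> x"
  have "blinfun_apply x (c *\<^sub>C v) = c *\<^sub>C blinfun_apply x v" for c v
  proof (rule LIMSEQ_unique)
    show "(\<lambda>n. blinfun_apply (f n) (c *\<^sub>C v)) \<longlonglongrightarrow> blinfun_apply x (c *\<^sub>C v)"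
      by (rule tendsto_blinfun_apply_left[OF x])
    show "(\<lambda>n. blinfun_apply (f n) (c *\<^sub>C v)) \<longlonglongrightarrow> c *\<^sub>C blinfun_apply x v"
      using f bounded_linear.tendsto[OF bounded_linear_scaleC tendsto_blinfun_apply_left[OF x]]
      by (simp add: bounded_operators_apply_scaleC)
  qed
  then show "x \<in> bounded_operators" by (simp add: bounded_operators_def)
qed

lemma adjoint_adjoint: "x \<in> bounded_operators \<Longrightarrow> adjoint_op (adjoint_op x) = x"
  by (rule adjoint_op_eqI) (simp add: cinner_adjoint_left)

lemma adjoint_id: "adjoint_op id_blinfun = id_blinfun"
  by (rule adjoint_op_eqI) simp

lemma adjoint_add:
  "x \<in> bounded_operators \<Longrightarrow> y \<in> bounded_operators \<Longrightarrow> adjoint_op (x + y) = adjoint_op x + adjoint_op y"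
  by (rule adjoint_op_eqI) (simp add: blinfun.add_left cinner_simps cinner_adjoint_right)

lemma adjoint_compose:
  "x \<in> bounded_operators \<Longrightarrow> y \<in> bounded_operators \<Longrightarrow> adjoint_op (x o\<^sub>L y) = adjoint_op y o\<^sub>L adjoint_op x"
  by (rule adjoint_op_eqI) (simp add: cinner_adjoint_right)

lemma adjoint_scale: "x \<in> bounded_operators \<Longrightarrow> adjoint_op (c *\<^sub>C x) = cnj c *\<^sub>C adjoint_op x"
  by (rule adjoint_op_eqI) (simp add: blinfun_apply_scaleC cinner_simps cinner_adjoint_right)

lemma norm_adjoint_le:
  assumes "x \<in> bounded_operators"
  shows "norm (adjoint_op x) \<le> norm x"
proof (rule norm_blinfun_bound)
  fix w
  let ?z = "blinfun_apply (adjoint_op x) w"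
  show "norm ?z \<le> norm x * norm w"
  proof (cases "?z = 0")
    case False
    have "(norm ?z)\<^sup>2 = cmod (cinner ?z ?z)"
      by (simp add: cinner_self norm_power)
    also have "\<dots> \<le> norm (blinfun_apply x ?z) * norm w"
      by (simp add: cinner_adjoint_right[OF assms] complex_Cauchy_Schwarz)
    also have "\<dots> \<le> norm x * norm ?z * norm w"
      by (intro mult_right_mono norm_blinfun) simp
    finally show ?thesis using False by (simp add: power2_eq_square mult_ac)
  qed simp
qed simp

lemma norm_adjoint: "x \<in> bounded_operators \<Longrightarrow> norm (adjoint_op x) = norm x"
  using norm_adjoint_le[of x] norm_adjoint_le[of "adjoint_op x"]
  by (simp add: adjoint_adjoint bounded_operators_adjoint)

lemma adjoint_diff:
  "x \<in> bounded_operators \<Longrightarrow> y \<in> bounded_operators \<Longrightarrow> adjoint_op (x - y) = adjoint_op x - adjoint_op y"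
  by (rule adjoint_op_eqI) (simp add: blinfun.diff_left cinner_simps cinner_adjoint_right)

lemma bounded_operators_diff:
  "x \<in> bounded_operators \<Longrightarrow> y \<in> bounded_operators \<Longrightarrow> x - y \<in> bounded_operators"
  by (simp add: bounded_operators_def blinfun.diff_left complex_vector.scale_right_diff_distrib)

lemma tendsto_adjoint:
  assumes f: "\<And>n. f n \<in> bounded_operators" and lim: "f \<longlonglongrightarrow> x"
  shows "(\<lambda>n. adjoint_op (f n)) \<longlonglongrightarrow> adjoint_op x"
proof -
  have x: "x \<in> bounded_operators"
    using closed_bounded_operators lim f by (auto simp: closed_sequential_limits)
  have "norm (adjoint_op (f n) - adjoint_op x) = norm (f n - x)" for n
    using norm_adjoint[OF bounded_operators_diff[OF f x], of n] by (simp only: adjoint_diff[OF f x])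
  then have "(\<lambda>n. norm (adjoint_op (f n) - adjoint_op x)) \<longlonglongrightarrow> 0"
    using tendsto_norm_zero[OF LIM_zero[OF lim]] by simp
  then show ?thesis by (rule LIM_zero_cancel[OF tendsto_norm_zero_cancel])
qed

lemma norm_scaleC_blinfun:
  fixes x :: "'a::real_normed_vector \<Rightarrow>\<^sub>L 'b::complex_inner"
  shows "norm (c *\<^sub>C x) \<le> cmod c * norm x"
proof (rule norm_blinfun_bound)
  show "norm (blinfun_apply (c *\<^sub>C x) v) \<le> cmod c * norm x * norm v" for v
    unfolding blinfun_apply_scaleC norm_scaleC mult.assoc by (rule mult_left_mono[OF norm_blinfun norm_ge_zero])
qed simp

lemma bounded_linear_scaleC_blinfun:
  "bounded_linear (\<lambda>x::'a::real_normed_vector \<Rightarrow>\<^sub>L 'b::complex_inner. c *\<^sub>C x)"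
proof (rule bounded_linear_intro)
  show "norm (c *\<^sub>C x) \<le> norm x * cmod c" for x :: "'a \<Rightarrow>\<^sub>L 'b"
    using norm_scaleC_blinfun[of c x] by (simp only: mult.commute)
qed (simp_all add: scaleC_add_right scaleC_scaleC mult.commute flip: scaleC_of_real)

text \<open>A generated algebra is the intersection of all algebras that contain the generators; this one shows
  that the intersection is not over the empty family and thus consists of complex-linear operators.\<close>

lemma unital_cstar_algebra_bounded_operators: "unital_cstar_algebra bounded_operators"
  unfolding unital_cstar_algebra_def
  by (simp add: closed_bounded_operators bounded_operators_id bounded_operators_add
      bounded_operators_compose bounded_operators_scale bounded_operators_adjoint)

lemma unital_cstar_algebra_hull:
  assumes "S \<subseteq> bounded_operators"
  shows "unital_cstar_algebra (unital_cstar_algebra hull S)"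
proof -
  have mem: "x \<in> unital_cstar_algebra hull S \<longleftrightarrow> (\<forall>A. unital_cstar_algebra A \<and> S \<subseteq> A \<longrightarrow> x \<in> A)" for x
    by (auto simp: hull_def)
  have closed: "closed (unital_cstar_algebra hull S)"
    unfolding hull_def by (rule closed_Inter) (auto simp: unital_cstar_algebra_def)
  have sub: "unital_cstar_algebra hull S \<subseteq> bounded_operators"
    using unital_cstar_algebra_bounded_operators assms by (rule hull_minimal[rotated])
  have ops: "id_blinfun \<in> A" "x \<in> A \<Longrightarrow> y \<in> A \<Longrightarrow> x + y \<in> A" "x \<in> A \<Longrightarrow> y \<in> A \<Longrightarrow> x o\<^sub>L y \<in> A"
    "x \<in> A \<Longrightarrow> c *\<^sub>C x \<in> A" "x \<in> A \<Longrightarrow> adjoint_op x \<in> A" if "unital_cstar_algebra A" for A x y c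
    using that by (simp_all add: unital_cstar_algebra_def)
  show ?thesis
    unfolding unital_cstar_algebra_def[of "unital_cstar_algebra hull S"]
    by (intro conjI sub closed ballI allI; unfold mem) (blast intro: ops)+
qed

section \<open>Square roots, automorphisms and states\<close>

instance chilbert_space \<subseteq> banach ..

lemma cstar_algebra_closure:
  assumes "unital_cstar_algebra A"
  shows cstar_bounded: "x \<in> A \<Longrightarrow> x \<in> bounded_operators"
    and cstar_closed: "closed A"
    and cstar_id: "id_blinfun \<in> A"
    and cstar_add: "x \<in> A \<Longrightarrow> y \<in> A \<Longrightarrow> x + y \<in> A"
    and cstar_compose: "x \<in> A \<Longrightarrow> y \<in> A \<Longrightarrow> x o\<^sub>L y \<in> A"
    and cstar_scaleC: "x \<in> A \<Longrightarrow> c *\<^sub>C x \<in> A"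
    and cstar_adjoint: "x \<in> A \<Longrightarrow> adjoint_op x \<in> A"
  using assms by (auto simp: unital_cstar_algebra_def)

lemma cstar_scaleR: "unital_cstar_algebra A \<Longrightarrow> x \<in> A \<Longrightarrow> r *\<^sub>R x \<in> A"
  using cstar_scaleC[of A x "complex_of_real r"] by (simp add: scaleC_of_real)

lemma cstar_diff: "unital_cstar_algebra A \<Longrightarrow> x \<in> A \<Longrightarrow> y \<in> A \<Longrightarrow> x - y \<in> A"
  using cstar_add[of A x "(-1) *\<^sub>R y"] cstar_scaleR[of A y "-1"] by simp

lemma cstar_sum: "unital_cstar_algebra A \<Longrightarrow> (\<And>i. i \<in> I \<Longrightarrow> f i \<in> A) \<Longrightarrow> sum f I \<in> A"
  by (induction I rule: infinite_finite_induct)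
    (auto intro: cstar_add cstar_scaleR[of A id_blinfun 0, simplified] cstar_id)

lemma adjoint_scaleR: "x \<in> bounded_operators \<Longrightarrow> adjoint_op (r *\<^sub>R x) = r *\<^sub>R adjoint_op x"
  using adjoint_scale[of x "complex_of_real r"] by (simp add: scaleC_of_real)

lemma cinner_scaleR_left: "cinner (r *\<^sub>R x) y = complex_of_real r * cinner x y"
  by (metis scaleC_of_real cinner_scaleC_left)

lemma blinfun_compose_assoc: "(x o\<^sub>L y) o\<^sub>L z = x o\<^sub>L (y o\<^sub>L z)"
  by (rule blinfun_eqI) simp

lemma blinfun_compose_id: "x o\<^sub>L id_blinfun = x" "id_blinfun o\<^sub>L x = x"
  by (auto intro: blinfun_eqI)

lemmas blinfun_compose_add_left = bounded_bilinear.add_left[OF bounded_bilinear_blinfun_compose]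
  and blinfun_compose_add_right = bounded_bilinear.add_right[OF bounded_bilinear_blinfun_compose]
  and blinfun_compose_diff_left = bounded_bilinear.diff_left[OF bounded_bilinear_blinfun_compose]
  and blinfun_compose_diff_right = bounded_bilinear.diff_right[OF bounded_bilinear_blinfun_compose]

text \<open>The square root is \<open>1 - y\<close> for the fixed point \<open>y\<close> of the map \<open>y \<mapsto> (h + y\<^sup>2) / 2\<close>, which is a
  contraction of the self-adjoint part of the ball of radius \<open>\<parallel>h\<parallel>\<close>.\<close>

lemma exists_sqrt_one_minus:
  assumes A: "unital_cstar_algebra A" and h: "h \<in> A" "adjoint_op h = h" "norm h < 1"
  obtains y where "y \<in> A" "adjoint_op y = y" "y o\<^sub>L y = id_blinfun - h"
proof -
  define S where "S = {y \<in> A. adjoint_op y = y \<and> norm y \<le> norm h}"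
  define f where "f y = (1/2) *\<^sub>R (h + (y o\<^sub>L y))" for y
  note bdd = cstar_bounded[OF A]
  have "closed S"
    unfolding closed_sequential_limits
  proof (intro allI impI, elim conjE)
    fix u l assume u: "\<forall>n. u n \<in> S" and l: "u \<longlonglongrightarrow> l"
    have "l \<in> A" using u l cstar_closed[OF A] by (auto simp: S_def closed_sequential_limits)
    moreover have "adjoint_op l = l"
    proof (rule LIMSEQ_unique[OF _ l])
      show "u \<longlonglongrightarrow> adjoint_op l"
        using tendsto_adjoint[OF _ l] u bdd by (simp add: S_def)
    qed
    moreover have "norm l \<le> norm h"
      using u by (intro LIMSEQ_le_const2[OF tendsto_norm[OF l]]) (auto simp: S_def)
    ultimately show "l \<in> S" by (simp add: S_def)
  qed
  have "\<exists>!y\<in>S. f y = y"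
  proof (rule Banach_fix[where c = "norm h"])
    show "complete S" using \<open>closed S\<close> by (simp add: complete_eq_closed)
    show "S \<noteq> {}" using h by (auto simp: S_def)
    show "f ` S \<subseteq> S"
    proof (rule image_subsetI)
      fix y assume "y \<in> S"
      then have y: "y \<in> A" "adjoint_op y = y" "norm y \<le> norm h" by (auto simp: S_def)
      have "f y \<in> A" unfolding f_def using A h y by (intro cstar_scaleR cstar_add cstar_compose)
      moreover have "adjoint_op (f y) = f y"
        unfolding f_def using h y bdd
        by (simp add: adjoint_scaleR adjoint_add adjoint_compose bounded_operators_add bounded_operators_compose)
      moreover have "norm (f y) \<le> norm h"
      proof -
        have "norm (y o\<^sub>L y) \<le> norm y * norm y" by (rule norm_blinfun_compose)
        also have "\<dots> \<le> norm h * 1" using y h by (intro mult_mono) auto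
        finally have "norm (h + (y o\<^sub>L y)) \<le> 2 * norm h"
          using norm_triangle_ineq[of h "y o\<^sub>L y"] by linarith
        then show ?thesis by (simp add: f_def)
      qed
      ultimately show "f y \<in> S" by (simp add: S_def)
    qed
    fix y z assume "y \<in> S" "z \<in> S"
    then have n: "norm y \<le> norm h" "norm z \<le> norm h" by (auto simp: S_def)
    have "f y - f z = (1/2) *\<^sub>R ((y o\<^sub>L (y - z)) + ((y - z) o\<^sub>L z))"
      by (simp add: f_def blinfun_compose_diff_left blinfun_compose_diff_right algebra_simps)
    then have "norm (f y - f z) \<le> 1/2 * (norm (y o\<^sub>L (y - z)) + norm ((y - z) o\<^sub>L z))"
      by (simp add: norm_triangle_ineq)
    also have "\<dots> \<le> 1/2 * (norm y * norm (y - z) + norm (y - z) * norm z)"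
      by (intro mult_left_mono add_mono norm_blinfun_compose) auto
    also have "\<dots> \<le> 1/2 * (norm h * norm (y - z) + norm (y - z) * norm h)"
      using n by (intro mult_left_mono add_mono mult_right_mono) auto
    finally show "dist (f y) (f z) \<le> norm h * dist y z"
      by (simp add: dist_norm)
  qed (use h in auto)
  then obtain y where y: "y \<in> S" and fix_pt: "f y = y" by blast
  have "2 *\<^sub>R f y = h + (y o\<^sub>L y)" by (simp add: f_def)
  then have "h = 2 *\<^sub>R y - (y o\<^sub>L y)" by (simp add: fix_pt)
  then have "(id_blinfun - y) o\<^sub>L (id_blinfun - y) = id_blinfun - h"
    by (simp add: blinfun_compose_diff_left blinfun_compose_diff_right blinfun_compose_id scaleR_2)
  moreover have "id_blinfun - y \<in> A" "adjoint_op (id_blinfun - y) = id_blinfun - y"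
    using A y by (auto simp: S_def adjoint_diff bdd adjoint_id bounded_operators_id cstar_diff cstar_id)
  ultimately show ?thesis by (intro that)
qed

text \<open>By surjectivity the unit is \<open>\<alpha>(e)\<close> for some \<open>e\<close>, and \<open>\<alpha>(e) = \<alpha>(1) \<alpha>(e)\<close>.\<close>

lemma star_automorphism_id:
  assumes A: "unital_cstar_algebra A" and \<alpha>: "star_automorphism A \<alpha>"
  shows "\<alpha> id_blinfun = id_blinfun"
proof -
  obtain e where e: "e \<in> A" "\<alpha> e = id_blinfun"
    using \<alpha> cstar_id[OF A] unfolding star_automorphism_def bij_betw_def by (metis imageE)
  have "\<alpha> (id_blinfun o\<^sub>L e) = \<alpha> id_blinfun o\<^sub>L \<alpha> e"
    using \<alpha> e cstar_id[OF A] unfolding star_automorphism_def by blast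
  then show ?thesis by (simp add: blinfun_compose_id e)
qed

text \<open>For \<open>r > \<parallel>x\<parallel>\<close> and \<open>h = x\<^sup>* x / r\<^sup>2\<close>, the square root writes \<open>1 - h\<close> as \<open>y\<^sup>* y\<close> with \<open>y\<close> in the algebra. An
  automorphism preserves this identity, and evaluation at a vector \<open>v\<close> gives
  \<open>\<parallel>\<alpha>(x) v\<parallel>\<^sup>2 \<le> r\<^sup>2 \<parallel>v\<parallel>\<^sup>2\<close>.\<close>

lemma norm_star_automorphism_le:
  assumes A: "unital_cstar_algebra A" and \<alpha>: "star_automorphism A \<alpha>" and x: "x \<in> A"
  shows "norm (\<alpha> x) \<le> norm x"
proof (rule field_le_epsilon)
  fix e :: real assume "0 < e"
  define r where "r = norm x + e"
  have r: "r > 0" "norm x < r" using \<open>0 < e\<close> by (auto simp: r_def add_nonneg_pos)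
  note bdd = cstar_bounded[OF A]
  have \<alpha>_add: "\<alpha> (u + v) = \<alpha> u + \<alpha> v" and \<alpha>_comp: "\<alpha> (u o\<^sub>L v) = \<alpha> u o\<^sub>L \<alpha> v"
    and \<alpha>_scale: "\<alpha> (c *\<^sub>C u) = c *\<^sub>C \<alpha> u" and \<alpha>_adj: "\<alpha> (adjoint_op u) = adjoint_op (\<alpha> u)"
    and \<alpha>_mem: "\<alpha> u \<in> A"
    if "u \<in> A" "v \<in> A" for u v c
    using \<alpha> that by (auto simp: star_automorphism_def bij_betw_def)
  define h where "h = (1 / r\<^sup>2) *\<^sub>R (adjoint_op x o\<^sub>L x)"
  have h: "h \<in> A" unfolding h_def using A x by (intro cstar_scaleR cstar_compose cstar_adjoint)
  moreover have "adjoint_op h = h"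
    using x bdd by (simp add: h_def adjoint_scaleR adjoint_compose adjoint_adjoint
        bounded_operators_compose bounded_operators_adjoint)
  moreover have "norm h < 1"
  proof -
    have "norm (adjoint_op x o\<^sub>L x) \<le> norm x * norm x"
      using norm_blinfun_compose[of "adjoint_op x" x] by (simp add: norm_adjoint bdd x)
    also have "\<dots> < r\<^sup>2" using r by (simp add: power2_eq_square mult_strict_mono')
    finally show ?thesis using r by (simp add: h_def)
  qed
  ultimately obtain y where y: "y \<in> A" "adjoint_op y = y" "y o\<^sub>L y = id_blinfun - h"
    by (rule exists_sqrt_one_minus[OF A])
  have y1: "h + (y o\<^sub>L y) = id_blinfun" using y by simp
  have yy: "y o\<^sub>L y \<in> A" using A y(1) y(1) by (rule cstar_compose)
  have "\<alpha> h = (1 / r\<^sup>2) *\<^sub>R (adjoint_op (\<alpha> x) o\<^sub>L \<alpha> x)"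
    using \<alpha>_scale[of "adjoint_op x o\<^sub>L x" h "complex_of_real (1 / r\<^sup>2)"] A x h
    by (simp add: h_def \<alpha>_comp \<alpha>_adj cstar_compose cstar_adjoint scaleC_of_real del: of_real_divide of_real_power)
  moreover have "\<alpha> h + (adjoint_op (\<alpha> y) o\<^sub>L \<alpha> y) = id_blinfun"
    using star_automorphism_id[OF A \<alpha>] \<alpha>_add[OF h yy] \<alpha>_comp[OF y(1) y(1)] \<alpha>_adj[OF y(1) y(1)] y
    by (simp add: y1)
  ultimately have eq: "(1 / r\<^sup>2) *\<^sub>R (adjoint_op (\<alpha> x) o\<^sub>L \<alpha> x) + (adjoint_op (\<alpha> y) o\<^sub>L \<alpha> y) = id_blinfun"
    by simp
  show "norm (\<alpha> x) \<le> norm x + e"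
    unfolding r_def[symmetric]
  proof (rule norm_blinfun_bound)
    fix v
    have "cinner (blinfun_apply ((1 / r\<^sup>2) *\<^sub>R (adjoint_op (\<alpha> x) o\<^sub>L \<alpha> x) + (adjoint_op (\<alpha> y) o\<^sub>L \<alpha> y)) v) v = cinner v v"
      unfolding eq by simp
    then have "complex_of_real (1 / r\<^sup>2 * (norm (blinfun_apply (\<alpha> x) v))\<^sup>2 + (norm (blinfun_apply (\<alpha> y) v))\<^sup>2)
        = complex_of_real ((norm v)\<^sup>2)"
      by (simp only: blinfun.add_left blinfun.scaleR_left cinner_add_left cinner_scaleR_left
          blinfun_apply_blinfun_compose cinner_adjoint_left[OF bdd[OF \<alpha>_mem[OF x x]]]
          cinner_adjoint_left[OF bdd[OF \<alpha>_mem[OF y(1) y(1)]]] cinner_self of_real_add of_real_mult)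
    then have "1 / r\<^sup>2 * (norm (blinfun_apply (\<alpha> x) v))\<^sup>2 \<le> (norm v)\<^sup>2"
      unfolding of_real_eq_iff using zero_le_power2[of "norm (blinfun_apply (\<alpha> y) v)"] by linarith
    then have "(norm (blinfun_apply (\<alpha> x) v))\<^sup>2 \<le> (r * norm v)\<^sup>2"
      using r by (simp add: pos_divide_le_eq power_mult_distrib mult.commute)
    then show "norm (blinfun_apply (\<alpha> x) v) \<le> r * norm v"
      by (rule power2_le_imp_le) (use r in simp)
  qed (use r in simp)
qed

text \<open>Automorphisms are continuous, so the set on which two of them agree is itself a \<open>C\<^sup>*\<close>-algebra. This
  makes the automorphism that permutes the annihilators unique.\<close>

lemma star_automorphism_eq_on_hull:
  assumes S: "S \<subseteq> bounded_operators" and A_def: "A = unital_cstar_algebra hull S"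
    and \<alpha>: "star_automorphism A \<alpha>" and \<beta>: "star_automorphism A \<beta>"
    and eq: "\<And>x. x \<in> S \<Longrightarrow> \<alpha> x = \<beta> x" and x: "x \<in> A"
  shows "\<alpha> x = \<beta> x"
proof -
  have A: "unital_cstar_algebra A"
    unfolding A_def by (rule unital_cstar_algebra_hull[OF S])
  have lim: "(\<lambda>n. \<gamma> (u n)) \<longlonglongrightarrow> \<gamma> l" if \<gamma>: "star_automorphism A \<gamma>" and u: "\<And>n. u n \<in> A" "u \<longlonglongrightarrow> l" "l \<in> A" for \<gamma> u l
  proof -
    have "\<gamma> (u n) - \<gamma> l = \<gamma> (u n - l)" for n
    proof -
      have "\<gamma> (u n) = \<gamma> ((u n - l) + l)" by simp
      also have "\<dots> = \<gamma> (u n - l) + \<gamma> l"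
        using \<gamma> cstar_diff[OF A u(1) u(3)] u(3) unfolding star_automorphism_def by blast
      finally show ?thesis by simp
    qed
    then have "norm (\<gamma> (u n) - \<gamma> l) \<le> norm (u n - l)" for n
      using norm_star_automorphism_le[OF A \<gamma> cstar_diff[OF A u(1) u(3)]] by simp
    then have "(\<lambda>n. norm (\<gamma> (u n) - \<gamma> l)) \<longlonglongrightarrow> 0"
      by (intro tendsto_sandwich[OF _ _ tendsto_const tendsto_norm_zero[OF LIM_zero[OF u(2)]]]) auto
    then show ?thesis by (rule LIM_zero_cancel[OF tendsto_norm_zero_cancel])
  qed
  let ?E = "{x \<in> A. \<alpha> x = \<beta> x}"
  have "unital_cstar_algebra ?E"
    unfolding unital_cstar_algebra_def
  proof (intro conjI)
    show "closed ?E"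
      unfolding closed_sequential_limits
    proof (intro allI impI, elim conjE)
      fix u l assume u: "\<forall>n. u n \<in> ?E" and l: "u \<longlonglongrightarrow> l"
      have "l \<in> A" using u l cstar_closed[OF A] by (auto simp: closed_sequential_limits)
      then show "l \<in> ?E"
        using lim[OF \<alpha> _ l] lim[OF \<beta> _ l] u by (auto intro: LIMSEQ_unique)
    qed
  qed (use A \<alpha> \<beta> in \<open>auto simp: star_automorphism_id cstar_bounded cstar_id star_automorphism_def
      intro: cstar_add cstar_compose cstar_scaleC cstar_adjoint\<close>)
  moreover have "S \<subseteq> ?E"
    using eq hull_subset[of S unital_cstar_algebra] by (auto simp: A_def)
  ultimately have "A \<subseteq> ?E"
    unfolding A_def by (metis (no_types, lifting) hull_minimal)
  then show ?thesis using x by blast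
qed

text \<open>If \<open>h\<close> is self-adjoint with \<open>\<parallel>h\<parallel> < 1\<close>, then \<open>1 - h\<close> and \<open>1 + h\<close> are squares of self-adjoint elements, whence
  \<open>-1 \<le> \<phi>(h) \<le> 1\<close>. The sharp constant would be \<open>1\<close>; the factor \<open>2\<close> results from adding the bounds for the
  real and the imaginary part, and any constant serves for continuity.\<close>

lemma state_bounded:
  assumes A: "unital_cstar_algebra A" and \<phi>: "\<phi> \<in> states A" and x: "x \<in> A"
  shows "cmod (\<phi> x) \<le> 2 * norm x"
proof -
  note bdd = cstar_bounded[OF A]
  have add: "\<phi> (u + v) = \<phi> u + \<phi> v" and scale: "\<phi> (c *\<^sub>C u) = c * \<phi> u"
    and pos: "\<phi> (adjoint_op u o\<^sub>L u) \<in> \<real>\<^sub>\<ge>\<^sub>0" if "u \<in> A" "v \<in> A" for u v c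
    using \<phi> that by (auto simp: states_def)
  have one: "\<phi> id_blinfun = 1" using \<phi> by (simp add: states_def)
  have upper: "\<phi> h \<in> \<real> \<and> Re (\<phi> h) \<le> 1" if h: "h \<in> A" "adjoint_op h = h" "norm h < 1" for h
  proof -
    obtain y where y: "y \<in> A" "adjoint_op y = y" "y o\<^sub>L y = id_blinfun - h"
      by (rule exists_sqrt_one_minus[OF A h])
    have "1 = \<phi> (h + (y o\<^sub>L y))" using y one by simp
    also have "\<dots> = \<phi> h + \<phi> (y o\<^sub>L y)" using A h y by (intro add cstar_compose)
    finally have "\<phi> (y o\<^sub>L y) = 1 - \<phi> h" by (simp add: algebra_simps)
    then have "1 - \<phi> h \<in> \<real>\<^sub>\<ge>\<^sub>0" using pos[of y] y by simp
    then show ?thesis by (auto simp: nonneg_Reals_def complex_is_Real_iff complex_eq_iff)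
  qed
  have sa: "cmod (\<phi> h) \<le> norm h" if h: "h \<in> A" "adjoint_op h = h" for h
  proof (rule field_le_epsilon)
    fix e :: real assume "0 < e"
    define r where "r = norm h + e"
    have r: "r > 0" "norm h < r" using \<open>0 < e\<close> by (auto simp: r_def add_nonneg_pos)
    have *: "\<phi> ((s / r) *\<^sub>R h) \<in> \<real> \<and> Re (\<phi> ((s / r) *\<^sub>R h)) \<le> 1" if "\<bar>s\<bar> = 1" for s
      using r h A bdd that by (intro upper) (auto simp: cstar_scaleR adjoint_scaleR abs_mult abs_divide)
    have eq: "\<phi> ((s / r) *\<^sub>R h) = complex_of_real (s / r) * \<phi> h" for s
      using scale[of h h "complex_of_real (s / r)"] h by (simp add: scaleC_of_real del: of_real_divide)
    have "complex_of_real (1 / r) * \<phi> h \<in> \<real>" "Re (complex_of_real (1 / r) * \<phi> h) \<le> 1"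
      "Re (complex_of_real (- 1 / r) * \<phi> h) \<le> 1"
      using *[of 1] *[of "-1"] unfolding eq by auto
    then have "Im (\<phi> h) = 0" "\<bar>Re (\<phi> h)\<bar> \<le> r"
      using r by (auto simp: complex_is_Real_iff divide_le_eq abs_le_iff field_simps)
    then show "cmod (\<phi> h) \<le> norm h + e" by (simp add: cmod_def r_def)
  qed
  define a where "a = (1/2) *\<^sub>R (x + adjoint_op x)"
  define b where "b = (1/2) *\<^sub>R (\<i> *\<^sub>C (adjoint_op x - x))"
  have adj: "adjoint_op x \<in> A" using A x by (simp add: cstar_adjoint)
  have mem: "a \<in> A" "b \<in> A" unfolding a_def b_def using A x adj
    by (auto intro!: cstar_scaleR cstar_scaleC cstar_add cstar_diff)
  have "adjoint_op a = a" "adjoint_op b = b"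
    using bdd x adj by (simp_all add: a_def b_def adjoint_scaleR adjoint_add adjoint_diff adjoint_scale
        bounded_operators_add bounded_operators_diff bounded_operators_scale adjoint_adjoint add.commute
        complex_vector.scale_right_diff_distrib)
  then have "cmod (\<phi> a) \<le> norm a" "cmod (\<phi> b) \<le> norm b" using sa mem by auto
  moreover have "norm a \<le> norm x"
    using norm_triangle_ineq[of x "adjoint_op x"] norm_adjoint[OF bdd[OF x]] by (simp add: a_def)
  moreover have "norm b \<le> norm x"
    using norm_triangle_ineq4[of "adjoint_op x" x] norm_adjoint[OF bdd[OF x]]
      norm_scaleC_blinfun[of \<i> "adjoint_op x - x"] by (simp add: b_def)
  moreover have "\<phi> x = \<phi> a + \<i> * \<phi> b"
  proof -
    have "x = a + \<i> *\<^sub>C b"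
      unfolding a_def b_def scaleC_of_real[symmetric]
      by (simp add: scaleC_scaleC complex_vector.scale_right_diff_distrib scaleC_add_right
          flip: scaleC_add_left)
    then show ?thesis using add[of a "\<i> *\<^sub>C b"] scale[of b b \<i>] mem cstar_scaleC[OF A] by simp
  qed
  ultimately show ?thesis
    using norm_triangle_ineq[of "\<phi> a" "\<i> * \<phi> b"] by (simp add: norm_mult)
qed

section \<open>Extension of operators from a total family\<close>

text \<open>A formal linear combination of members of a family is a list of coefficients and indices;
  it remembers the representation of a vector, which the vector itself does not determine.\<close>

definition lincomb :: "('i \<Rightarrow> 'v::complex_vector) \<Rightarrow> (complex \<times> 'i) list \<Rightarrow> 'v" where
  "lincomb x F = (\<Sum>(c, i)\<leftarrow>F. c *\<^sub>C x i)"

lemma lincomb_simps [simp]: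
  "lincomb x [] = 0"
  "lincomb x ((c, i) # F) = c *\<^sub>C x i + lincomb x F"
  "lincomb x (F @ G) = lincomb x F + lincomb x G"
  by (simp_all add: lincomb_def)

definition scale_coeffs :: "complex \<Rightarrow> (complex \<times> 'i) list \<Rightarrow> (complex \<times> 'i) list" where
  "scale_coeffs c F = map (\<lambda>(d, i). (c * d, i)) F"

lemma lincomb_scale_coeffs [simp]: "lincomb x (scale_coeffs c F) = c *\<^sub>C lincomb x F"
  by (induction F) (auto simp: scale_coeffs_def scaleC_add_right scaleC_scaleC)

lemma cspan_range_eq_lincomb: "cspan (range x) = range (lincomb x)"
proof
  show "cspan (range x) \<subseteq> range (lincomb x)"
  proof (rule complex_vector.span_minimal)
    show "range x \<subseteq> range (lincomb x)"
    proof clarify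
      fix i
      have "x i = lincomb x [(1, i)]" by simp
      then show "x i \<in> range (lincomb x)" by (rule range_eqI)
    qed
    show "complex_vector.subspace (range (lincomb x))"
    proof (rule complex_vector.subspaceI)
      show "0 \<in> range (lincomb x)" by (rule range_eqI[of _ _ "[]"]) simp
      fix u v c assume "u \<in> range (lincomb x)" "v \<in> range (lincomb x)"
      then obtain F G where u: "u = lincomb x F" and v: "v = lincomb x G" by blast
      show "u + v \<in> range (lincomb x)"
        by (rule range_eqI[of _ _ "F @ G"]) (simp add: u v)
      show "c *\<^sub>C u \<in> range (lincomb x)"
        by (rule range_eqI[of _ _ "scale_coeffs c F"]) (simp add: u)
    qed
  qed
  have "lincomb x F \<in> cspan (range x)" for F
    by (induction F)
      (auto simp: complex_vector.span_add complex_vector.span_scale complex_vector.span_zero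
        complex_vector.span_base)
  then show "range (lincomb x) \<subseteq> cspan (range x)" by blast
qed

lemma exists_lincomb_tendsto:
  assumes "closure (cspan (range x)) = UNIV"
  obtains F :: "nat \<Rightarrow> (complex \<times> 'i) list" where "(\<lambda>n. lincomb x (F n)) \<longlonglongrightarrow> (w::'h::complex_inner)"
proof -
  have "w \<in> closure (range (lincomb x))"
    using assms by (simp add: cspan_range_eq_lincomb)
  then obtain u where "\<forall>n. u n \<in> range (lincomb x)" "u \<longlonglongrightarrow> w"
    by (auto simp: closure_sequential)
  then have "\<forall>n. \<exists>F. u n = lincomb x F" by blast
  then obtain F where "\<And>n. u n = lincomb x (F n)" by metis
  then have "u = (\<lambda>n. lincomb x (F n))" by blast
  then show ?thesis using \<open>u \<longlonglongrightarrow> w\<close> by (intro that) simp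
qed

text \<open>The bound on formal combinations also shows that the operator is well defined: combinations
  that represent the same vector differ by one that represents \<open>0\<close>.\<close>

lemma exists_bounded_extension:
  fixes x y :: "'i \<Rightarrow> 'h::chilbert_space"
  assumes total: "closure (cspan (range x)) = UNIV"
    and bound: "\<And>F. norm (lincomb y F) \<le> B * norm (lincomb x F)"
  obtains T where "T \<in> bounded_operators" "\<And>i. blinfun_apply T (x i) = y i"
proof -
  have diff: "norm (lincomb y F - lincomb y G) \<le> B * norm (lincomb x F - lincomb x G)" for F G
    using bound[of "F @ scale_coeffs (-1) G"] by simp
  have "\<exists>l. \<forall>F. (\<lambda>n. lincomb x (F n)) \<longlonglongrightarrow> w \<longrightarrow> (\<lambda>n. lincomb y (F n)) \<longlonglongrightarrow> l" for w
  proof -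
    obtain F where F: "(\<lambda>n::nat. lincomb x (F n)) \<longlonglongrightarrow> w"
      by (rule exists_lincomb_tendsto[OF total])
    have B: "norm (lincomb y G - lincomb y H) \<le> \<bar>B\<bar> * norm (lincomb x G - lincomb x H)" for G H
      using diff[of G H] mult_right_mono[OF abs_ge_self[of B] norm_ge_zero[of "lincomb x G - lincomb x H"]]
      by linarith
    have "Cauchy (\<lambda>n. lincomb y (F n))"
    proof (rule CauchyI)
      fix e :: real assume "0 < e"
      then have "0 < e / (\<bar>B\<bar> + 1)" by simp
      then obtain M where M: "\<forall>m\<ge>M. \<forall>n\<ge>M. norm (lincomb x (F m) - lincomb x (F n)) < e / (\<bar>B\<bar> + 1)"
        using CauchyD[OF LIMSEQ_imp_Cauchy[OF F]] by blast
      have "norm (lincomb y (F m) - lincomb y (F n)) < e" if "m \<ge> M" "n \<ge> M" for m n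
      proof -
        have "norm (lincomb y (F m) - lincomb y (F n)) \<le> (\<bar>B\<bar> + 1) * norm (lincomb x (F m) - lincomb x (F n))"
          using B[of "F m" "F n"] norm_ge_zero[of "lincomb x (F m) - lincomb x (F n)"]
          unfolding distrib_right by linarith
        also have "\<dots> < e"
          using M that by (simp add: pos_less_divide_eq mult.commute)
        finally show ?thesis .
      qed
      then show "\<exists>M. \<forall>m\<ge>M. \<forall>n\<ge>M. norm (lincomb y (F m) - lincomb y (F n)) < e" by blast
    qed
    then obtain l where l: "(\<lambda>n. lincomb y (F n)) \<longlonglongrightarrow> l"
      by (auto simp: Cauchy_convergent_iff convergent_def)
    have "(\<lambda>n. lincomb y (G n)) \<longlonglongrightarrow> l" if G: "(\<lambda>n. lincomb x (G n)) \<longlonglongrightarrow> w" for G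
    proof -
      have "(\<lambda>n. B * norm (lincomb x (G n) - lincomb x (F n))) \<longlonglongrightarrow> B * norm (w - w)"
        by (intro tendsto_intros G F)
      then have null: "(\<lambda>n. B * norm (lincomb x (G n) - lincomb x (F n))) \<longlonglongrightarrow> 0" by simp
      have "(\<lambda>n. lincomb y (G n) - lincomb y (F n)) \<longlonglongrightarrow> 0"
        by (rule Lim_null_comparison[OF _ null]) (simp add: diff)
      from tendsto_add[OF this l] show ?thesis by simp
    qed
    then show ?thesis by blast
  qed
  then obtain t where t: "\<And>w F. (\<lambda>n. lincomb x (F n)) \<longlonglongrightarrow> w \<Longrightarrow> (\<lambda>n. lincomb y (F n)) \<longlonglongrightarrow> t w"
    by metis
  have add: "t (v + w) = t v + t w" for v w
  proof -
    obtain F where F: "(\<lambda>n::nat. lincomb x (F n)) \<longlonglongrightarrow> v"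
      by (rule exists_lincomb_tendsto[OF total])
    obtain G where G: "(\<lambda>n::nat. lincomb x (G n)) \<longlonglongrightarrow> w"
      by (rule exists_lincomb_tendsto[OF total])
    have "(\<lambda>n. lincomb y (F n @ G n)) \<longlonglongrightarrow> t (v + w)"
      using tendsto_add[OF F G] by (intro t) simp
    moreover have "(\<lambda>n. lincomb y (F n @ G n)) \<longlonglongrightarrow> t v + t w"
      using tendsto_add[OF t[OF F] t[OF G]] by simp
    ultimately show ?thesis by (rule LIMSEQ_unique)
  qed
  have scale: "t (c *\<^sub>C w) = c *\<^sub>C t w" for c w
  proof -
    obtain F where F: "(\<lambda>n::nat. lincomb x (F n)) \<longlonglongrightarrow> w"
      by (rule exists_lincomb_tendsto[OF total])
    have "(\<lambda>n. lincomb y (scale_coeffs c (F n))) \<longlonglongrightarrow> t (c *\<^sub>C w)"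
      using bounded_linear.tendsto[OF bounded_linear_scaleC F] by (intro t) simp
    moreover have "(\<lambda>n. lincomb y (scale_coeffs c (F n))) \<longlonglongrightarrow> c *\<^sub>C t w"
      using bounded_linear.tendsto[OF bounded_linear_scaleC t[OF F]] by simp
    ultimately show ?thesis by (rule LIMSEQ_unique)
  qed
  have le: "norm (t w) \<le> norm w * B" for w
  proof -
    obtain F where F: "(\<lambda>n::nat. lincomb x (F n)) \<longlonglongrightarrow> w"
      by (rule exists_lincomb_tendsto[OF total])
    show ?thesis
      using bound by (intro LIMSEQ_le[OF tendsto_norm[OF t[OF F]] tendsto_mult_right[OF tendsto_norm[OF F]]])
        (auto simp: mult.commute)
  qed
  have "bounded_linear t"
    by (rule bounded_linear_intro[of _ B]) (simp_all add: add scale le flip: scaleC_of_real)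
  moreover have "t (x i) = y i" for i
    using t[of "\<lambda>_. [(1, i)]" "x i"] by (simp add: LIMSEQ_const_iff)
  ultimately show ?thesis
    by (intro that[of "Blinfun t"]) (auto simp: bounded_linear_Blinfun_apply bounded_operators_def scale)
qed

lemma blinfun_eq_on_total:
  assumes "x \<in> bounded_operators" "y \<in> bounded_operators"
    and total: "closure (cspan (range \<Phi>)) = UNIV"
    and eq: "\<And>i. blinfun_apply x (\<Phi> i) = blinfun_apply y (\<Phi> i)"
  shows "x = y"
proof (rule blinfun_eqI)
  fix v
  let ?E = "{v. blinfun_apply x v = blinfun_apply y v}"
  have "cspan (range \<Phi>) \<subseteq> ?E"
    by (rule complex_vector.span_minimal)
      (use assms in \<open>auto simp: complex_vector.subspace_def blinfun.add_right bounded_operators_apply_scaleC\<close>)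
  moreover have "closed ?E"
    by (intro closed_Collect_eq continuous_intros)
  ultimately have "closure (cspan (range \<Phi>)) \<subseteq> ?E" by (rule closure_minimal)
  then show "blinfun_apply x v = blinfun_apply y v" using total by auto
qed

text \<open>The analogue for vectors: a vector that is orthogonal to a total family vanishes.\<close>

lemma cinner_eqI_total:
  assumes total: "closure (cspan (range \<Phi>)) = (UNIV :: 'h::complex_inner set)"
    and eq: "\<And>i. cinner v (\<Phi> i) = cinner w (\<Phi> i)"
  shows "v = w"
proof -
  let ?E = "{u. cinner u (v - w) = 0}"
  have "cspan (range \<Phi>) \<subseteq> ?E"
  proof (rule complex_vector.span_minimal)
    have "cinner (\<Phi> i) (v - w) = 0" for i
      using eq[of i] cinner_commute[of "\<Phi> i" "v - w"] by (simp add: cinner_diff_left)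
    then show "range \<Phi> \<subseteq> ?E" by auto
  qed (auto simp: complex_vector.subspace_def cinner_simps)
  moreover have "closed ?E"
    using bounded_linear_cinner_left[of "v - w"]
    by (intro closed_Collect_eq continuous_intros) (auto intro: linear_continuous_on)
  ultimately have "closure (cspan (range \<Phi>)) \<subseteq> ?E" by (rule closure_minimal)
  then show ?thesis using total cinner_self_eq_0[of "v - w"] by auto
qed

section \<open>Recursion for the \<open>q\<close>-inner product\<close>

text \<open>A permutation of \<open>{0, \<dots>, n}\<close> is determined by the image \<open>k\<close> of \<open>0\<close> and the permutation of
  \<open>{0, \<dots>, n-1}\<close> that results from deleting \<open>0\<close> and \<open>k\<close>. The deleted point accounts for \<open>k\<close>
  inversions.\<close>

definition skip :: "nat \<Rightarrow> nat \<Rightarrow> nat" where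
  "skip k m = (if m < k then m else Suc m)"

definition insert_perm :: "nat \<Rightarrow> nat \<Rightarrow> (nat \<Rightarrow> nat) \<Rightarrow> nat \<Rightarrow> nat" where
  "insert_perm n k \<sigma> i = (case i of 0 \<Rightarrow> k | Suc j \<Rightarrow> if j < n then skip k (\<sigma> j) else i)"

lemma skip_less_iff [simp]: "skip k a < skip k b \<longleftrightarrow> a < b"
  by (auto simp: skip_def)

lemma skip_eq_iff [simp]: "skip k a = skip k b \<longleftrightarrow> a = b"
  by (auto simp: skip_def)

lemma skip_neq [simp]: "skip k a \<noteq> k"
  by (auto simp: skip_def)

lemma skip_less_self_iff [simp]: "skip k a < k \<longleftrightarrow> a < k"
  by (auto simp: skip_def)

lemma insert_perm_permutes:
  assumes s: "\<sigma> permutes {..<n}" and k: "k < Suc n"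
  shows "insert_perm n k \<sigma> permutes {..<Suc n}"
proof (rule bij_imp_permutes)
  have lt: "\<sigma> j < n" if "j < n" for j using permutes_in_image[OF s, of j] that by simp
  have inj: "inj_on (insert_perm n k \<sigma>) {..<Suc n}"
  proof (rule inj_onI)
    fix i j assume "i \<in> {..<Suc n}" "j \<in> {..<Suc n}" "insert_perm n k \<sigma> i = insert_perm n k \<sigma> j"
    then show "i = j"
      using skip_neq[of k] skip_neq[of k, symmetric] permutes_inj[OF s]
      by (auto simp: insert_perm_def inj_eq split: nat.splits)
  qed
  have "insert_perm n k \<sigma> ` {..<Suc n} \<subseteq> {..<Suc n}"
    using k lt by (auto simp: insert_perm_def skip_def split: nat.splits)
  then show "bij_betw (insert_perm n k \<sigma>) {..<Suc n} {..<Suc n}"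
    using inj by (simp add: bij_betw_def endo_inj_surj)
  show "insert_perm n k \<sigma> i = i" if "i \<notin> {..<Suc n}" for i
    using that by (auto simp: insert_perm_def split: nat.splits)
qed

lemma inversions_insert_perm:
  assumes s: "\<sigma> permutes {..<n}" and k: "k < Suc n"
  shows "inversions (Suc n) (insert_perm n k \<sigma>) = k + inversions n \<sigma>"
proof -
  let ?I = "{(i, j). i < j \<and> j < n \<and> \<sigma> j < \<sigma> i}"
  let ?J = "{j. j < n \<and> \<sigma> j < k}"
  have "finite ?I" by (rule finite_subset[of _ "{..<n} \<times> {..<n}"]) auto
  have "bij_betw \<sigma> ?J {..<k}"
    unfolding bij_betw_def
  proof
    show "inj_on \<sigma> ?J" using permutes_inj[OF s] by (rule inj_on_subset) simp
    have "m \<in> \<sigma> ` ?J" if "m < k" for m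
      using permutes_inverses(1)[OF s, of m] permutes_in_image[OF permutes_inv[OF s], of m] that k
      by (intro image_eqI[of _ _ "inv \<sigma> m"]) auto
    then show "\<sigma> ` ?J = {..<k}" by auto
  qed
  then have card_J: "card ?J = k" using bij_betw_same_card[of \<sigma> ?J "{..<k}"] by simp
  have "{(i, j). i < j \<and> j < Suc n \<and> insert_perm n k \<sigma> j < insert_perm n k \<sigma> i} =
      (\<lambda>j. (0, Suc j)) ` ?J \<union> (\<lambda>(i, j). (Suc i, Suc j)) ` ?I" (is "?L = ?R")
  proof (rule set_eqI, clarify)
    fix i j
    \<comment> \<open>Inversions that involve the position \<open>0\<close> come from \<open>?J\<close>, all others are shifted inversions of \<open>\<sigma>\<close>.\<close>
    show "(i, j) \<in> ?L \<longleftrightarrow> (i, j) \<in> ?R"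
      by (cases i; cases j) (auto simp: insert_perm_def image_iff)
  qed
  moreover have "card ((\<lambda>j. (0::nat, Suc j)) ` ?J) = card ?J"
    by (rule card_image) (auto simp: inj_on_def)
  moreover have "card ((\<lambda>(i, j). (Suc i, Suc j)) ` ?I) = card ?I"
    by (rule card_image) (auto simp: inj_on_def)
  moreover have "card ((\<lambda>j. (0::nat, Suc j)) ` ?J \<union> (\<lambda>(i, j). (Suc i, Suc j)) ` ?I) =
      card ((\<lambda>j. (0::nat, Suc j)) ` ?J) + card ((\<lambda>(i, j). (Suc i, Suc j)) ` ?I)"
    using \<open>finite ?I\<close> by (intro card_Un_disjoint) auto
  ultimately show ?thesis by (simp add: inversions_def card_J)
qed

text \<open>Surjectivity follows from injectivity, since both sides have \<open>(n + 1)!\<close> elements.\<close>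

lemma bij_betw_insert_perm:
  "bij_betw (\<lambda>(k, \<sigma>). insert_perm n k \<sigma>) ({..<Suc n} \<times> {\<sigma>. \<sigma> permutes {..<n}}) {\<pi>. \<pi> permutes {..<Suc n}}"
proof -
  let ?f = "\<lambda>(k, \<sigma>). insert_perm n k \<sigma>" and ?D = "{..<Suc n} \<times> {\<sigma>. \<sigma> permutes {..<n}}"
  have inj: "inj_on ?f ?D"
  proof (rule inj_onI, clarsimp)
    fix k \<sigma> l \<tau>
    assume s: "\<sigma> permutes {..<n}" and t: "\<tau> permutes {..<n}" and eq: "insert_perm n k \<sigma> = insert_perm n l \<tau>"
    have "k = l" using fun_cong[OF eq, of 0] by (simp add: insert_perm_def)
    moreover have "\<sigma> j = \<tau> j" for j
      using fun_cong[OF eq, of "Suc j"] \<open>k = l\<close> permutes_not_in[OF s, of j] permutes_not_in[OF t, of j]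
      by (cases "j < n") (auto simp: insert_perm_def)
    ultimately show "k = l \<and> \<sigma> = \<tau>" by auto
  qed
  have "?f ` ?D \<subseteq> {\<pi>. \<pi> permutes {..<Suc n}}"
    using insert_perm_permutes by auto
  moreover have "card (?f ` ?D) = card {\<pi>. \<pi> permutes {..<Suc n}}"
    by (simp add: card_image[OF inj] card_cartesian_product card_permutations)
  ultimately have "?f ` ?D = {\<pi>. \<pi> permutes {..<Suc n}}"
    by (intro card_subset_eq) (auto simp: finite_permutations)
  with inj show ?thesis by (simp add: bij_betw_def)
qed

definition delete_nth :: "nat \<Rightarrow> 'a list \<Rightarrow> 'a list" where
  "delete_nth k xs = take k xs @ drop (Suc k) xs"

lemma length_delete_nth: "k < length xs \<Longrightarrow> length (delete_nth k xs) = length xs - 1"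
  by (simp add: delete_nth_def)

lemma nth_delete_nth: "k < length xs \<Longrightarrow> m < length xs - 1 \<Longrightarrow> delete_nth k xs ! m = xs ! skip k m"
  by (auto simp: delete_nth_def skip_def nth_append min_def)

text \<open>This is the adjointness of creator and annihilator on elementary tensors: the expansion of the
  permutation sum along the first factor.\<close>

lemma q_form_Cons:
  "q_form q (f # fs) gs =
    (\<Sum>k<length gs. complex_of_real (q ^ k) * cinner f (gs ! k) * q_form q fs (delete_nth k gs))"
proof (cases "length gs = Suc (length fs)")
  case False
  then have "q_form q fs (delete_nth k gs) = 0" if "k < length gs" for k
    using that by (auto simp: q_form_def length_delete_nth)
  then show ?thesis using False by (auto simp: q_form_def)
next
  case True
  define n where "n = length fs"
  have n: "length fs = n" "length gs = Suc n" using True by (auto simp: n_def)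
  let ?S = "\<lambda>n. {\<pi>. \<pi> permutes {..<n}}"
  define K where "K \<pi> = complex_of_real (q ^ inversions (Suc n) \<pi>) *
    (\<Prod>j<Suc n. cinner ((f # fs) ! j) (gs ! \<pi> j))" for \<pi>
  have "q_form q (f # fs) gs = (\<Sum>\<pi>\<in>?S (Suc n). K \<pi>)"
    by (simp add: q_form_def n K_def)
  also have "\<dots> = (\<Sum>(k, \<sigma>)\<in>{..<Suc n} \<times> ?S n. K (insert_perm n k \<sigma>))"
    using sum.reindex_bij_betw[OF bij_betw_insert_perm, of K n] by (simp add: case_prod_beta)
  also have "\<dots> = (\<Sum>k<Suc n. \<Sum>\<sigma>\<in>?S n. K (insert_perm n k \<sigma>))"
    by (rule sum.cartesian_product[symmetric])
  also have "\<dots> = (\<Sum>k<Suc n. complex_of_real (q ^ k) * cinner f (gs ! k) * q_form q fs (delete_nth k gs))"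
  proof (rule sum.cong[OF refl])
    fix k assume "k \<in> {..<Suc n}"
    then have k: "k < Suc n" by simp
    have len: "length (delete_nth k gs) = n" using k by (simp add: length_delete_nth n)
    have "K (insert_perm n k \<sigma>) = complex_of_real (q ^ k) * cinner f (gs ! k) *
        (complex_of_real (q ^ inversions n \<sigma>) * (\<Prod>j<n. cinner (fs ! j) (delete_nth k gs ! \<sigma> j)))"
      if "\<sigma> permutes {..<n}" for \<sigma>
    proof -
      have "\<sigma> j < n" if "j < n" for j
        using permutes_in_image[OF \<open>\<sigma> permutes _\<close>, of j] that by simp
      then have "(\<Prod>j<n. cinner (fs ! j) (gs ! insert_perm n k \<sigma> (Suc j))) =
          (\<Prod>j<n. cinner (fs ! j) (delete_nth k gs ! \<sigma> j))"
        using k by (intro prod.cong) (auto simp: insert_perm_def nth_delete_nth n)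
      then show ?thesis
        unfolding K_def inversions_insert_perm[OF that k] prod.lessThan_Suc_shift
        by (simp add: insert_perm_def power_add)
    qed
    then show "(\<Sum>\<sigma>\<in>?S n. K (insert_perm n k \<sigma>)) =
        complex_of_real (q ^ k) * cinner f (gs ! k) * q_form q fs (delete_nth k gs)"
      by (simp add: q_form_def n len sum_distrib_left)
  qed
  finally show ?thesis by (simp add: n)
qed

section \<open>Creators and annihilators\<close>

text \<open>Creator and annihilator are first defined on formal combinations, where nothing has to be checked;
  that they descend to vectors is a consequence of the norm estimates below.\<close>

definition create :: "'k \<Rightarrow> (complex \<times> 'k list) list \<Rightarrow> (complex \<times> 'k list) list" where
  "create f F = map (\<lambda>(c, fs). (c, f # fs)) F"

definition annihilate :: "real \<Rightarrow> 'k::complex_inner \<Rightarrow> (complex \<times> 'k list) list \<Rightarrow> (complex \<times> 'k list) list" where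
  "annihilate q f F = concat (map (\<lambda>(c, fs). map (\<lambda>k.
      (c * (complex_of_real (q ^ k) * cinner (fs ! k) f), delete_nth k fs)) [0..<length fs]) F)"

lemma lincomb_create: "lincomb x (create f F) = lincomb (\<lambda>fs. x (f # fs)) F"
  by (induction F) (auto simp: create_def)

lemma lincomb_annihilate:
  "lincomb x (annihilate q f F) =
    lincomb (\<lambda>fs. \<Sum>k<length fs. (complex_of_real (q ^ k) * cinner (fs ! k) f) *\<^sub>C x (delete_nth k fs)) F"
proof (induction F)
  case (Cons p F)
  obtain c fs where p: "p = (c, fs)" by (cases p)
  have "lincomb x (map (\<lambda>k. (c * (complex_of_real (q ^ k) * cinner (fs ! k) f), delete_nth k fs)) [0..<length fs]) =
      c *\<^sub>C (\<Sum>k<length fs. (complex_of_real (q ^ k) * cinner (fs ! k) f) *\<^sub>C x (delete_nth k fs))"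
    by (simp add: lincomb_def o_def interv_sum_list_conv_sum_set_nat complex_vector.scale_sum_right
        scaleC_scaleC atLeast0LessThan)
  then show ?case using Cons by (simp add: annihilate_def p)
qed (simp add: annihilate_def)

lemma delete_nth_Cons_Suc: "delete_nth (Suc k) (g # gs) = g # delete_nth k gs"
  by (simp add: delete_nth_def)

lemma delete_nth_Cons_0: "delete_nth 0 (g # gs) = gs"
  by (simp add: delete_nth_def)

lemma lincomb_add: "lincomb (\<lambda>i. x i + y i) F = lincomb x F + lincomb y F"
  by (induction F) (auto simp: scaleC_add_right)

lemma lincomb_scale: "lincomb (\<lambda>i. c *\<^sub>C x i) F = c *\<^sub>C lincomb x F"
  by (induction F) (auto simp: scaleC_add_right scaleC_scaleC mult.commute)

text \<open>The \<open>q\<close>-commutation relation \<open>a(f) a\<^sup>\<dagger>(g) = \<langle>g, f\<rangle> + q a\<^sup>\<dagger>(g) a(f)\<close>.\<close>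

lemma lincomb_annihilate_create:
  "lincomb x (annihilate q f (create g F)) =
    cinner g f *\<^sub>C lincomb x F + complex_of_real q *\<^sub>C lincomb x (create g (annihilate q f F))"
proof -
  have "(\<Sum>k<length (g # fs). (complex_of_real (q ^ k) * cinner ((g # fs) ! k) f) *\<^sub>C x (delete_nth k (g # fs))) =
      cinner g f *\<^sub>C x fs + complex_of_real q *\<^sub>C
        (\<Sum>k<length fs. (complex_of_real (q ^ k) * cinner (fs ! k) f) *\<^sub>C x (g # delete_nth k fs))" for fs
    unfolding list.size(4) add_Suc_right add_0_right sum.lessThan_Suc_shift
    by (simp add: delete_nth_Cons_0 delete_nth_Cons_Suc complex_vector.scale_sum_right scaleC_scaleC mult.assoc)
  then show ?thesis
    by (simp only: lincomb_annihilate lincomb_create lincomb_add lincomb_scale)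
qed

locale q_fock =
  fixes q :: real and \<Phi> :: "'k::complex_inner list \<Rightarrow> 'h::chilbert_space"
  assumes q: "-1 < q" "q < 1" and fock: "q_fock_space q \<Phi>"
begin

text \<open>\<open>C\<close> is the solution of \<open>1 + |q| C = C\<close>, the fixed point of the recursion that bounds the creators
  degree by degree.\<close>

definition C where "C = 1 / (1 - \<bar>q\<bar>)"

lemma C_pos: "C > 0" and C_eq: "1 + \<bar>q\<bar> * C = C"
  using q by (auto simp: C_def field_simps abs_if)

lemma cinner_\<Phi>: "cinner (\<Phi> fs) (\<Phi> gs) = q_form q fs gs"
  and total: "closure (cspan (range \<Phi>)) = UNIV"
  using fock by (auto simp: q_fock_space_def)

lemma cinner_\<Phi>_Cons:
  "cinner (\<Phi> (f # fs)) (\<Phi> gs) = cinner (\<Phi> fs)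
    (\<Sum>k<length gs. (complex_of_real (q ^ k) * cinner (gs ! k) f) *\<^sub>C \<Phi> (delete_nth k gs))"
  by (simp add: cinner_\<Phi> q_form_Cons cinner_simps cinner_commute[of f])

lemma cinner_create_left:
  "cinner (lincomb \<Phi> (create f F)) (lincomb \<Phi> G) = cinner (lincomb \<Phi> F) (lincomb \<Phi> (annihilate q f G))"
proof -
  define a where "a gs = (\<Sum>k<length gs. (complex_of_real (q ^ k) * cinner (gs ! k) f) *\<^sub>C \<Phi> (delete_nth k gs))" for gs
  have single: "cinner (\<Phi> (f # fs)) (lincomb \<Phi> G) = cinner (\<Phi> fs) (lincomb a G)" for fs
    by (induction G) (auto simp: cinner_simps cinner_\<Phi>_Cons a_def)
  show ?thesis
    unfolding lincomb_create lincomb_annihilate a_def[symmetric]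
    by (induction F) (auto simp: cinner_simps single)
qed

lemma cinner_create_right:
  "cinner (lincomb \<Phi> G) (lincomb \<Phi> (create f F)) = cinner (lincomb \<Phi> (annihilate q f G)) (lincomb \<Phi> F)"
  using cinner_create_left[of f F G] cinner_commute by metis

text \<open>The bound does not depend on the number of annihilators. With \<open>v\<close> the vector of \<open>F\<close>, put
  \<open>S = \<Sum>\<^sub>j \<parallel>a\<^sub>j v\<parallel>\<^sup>2\<close> and \<open>u = \<Sum>\<^sub>j a\<^sub>j\<^sup>\<dagger> a\<^sub>j v\<close>, so that \<open>S = \<langle>u, v\<rangle> \<le> \<parallel>u\<parallel> \<parallel>v\<parallel>\<close>. The commutation relation gives
  \<open>\<parallel>u\<parallel>\<^sup>2 = S + q \<Sum>\<^sub>i\<^sub>j \<langle>a\<^sub>i a\<^sub>j v, a\<^sub>j a\<^sub>i v\<rangle>\<close>. The double sum is at most \<open>\<Sum>\<^sub>j \<Sum>\<^sub>i \<parallel>a\<^sub>i a\<^sub>j v\<parallel>\<^sup>2\<close>, to which the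
  induction hypothesis applies because \<open>a\<^sub>j v\<close> has lower degree; hence \<open>\<parallel>u\<parallel>\<^sup>2 \<le> (1 + |q| C) S = C S\<close>
  and \<open>S\<^sup>2 \<le> C S \<parallel>v\<parallel>\<^sup>2\<close>.\<close>

lemma sum_norm_annihilate_le_degree:
  assumes J: "finite J" and e: "\<And>i j. i \<in> J \<Longrightarrow> j \<in> J \<Longrightarrow> cinner (e i) (e j) = (if i = j then 1 else 0)"
    and "\<forall>(c, fs)\<in>set F. length fs < n"
  shows "(\<Sum>j\<in>J. (norm (lincomb \<Phi> (annihilate q (e j) F)))\<^sup>2) \<le> C * (norm (lincomb \<Phi> F))\<^sup>2"
  using assms(3)
proof (induction n arbitrary: F)
  case 0
  then have "F = []" by (cases F) auto
  then show ?case by (simp add: annihilate_def)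
next
  case (Suc n)
  define G where "G j = annihilate q (e j) F" for j
  define S where "S = (\<Sum>j\<in>J. (norm (lincomb \<Phi> (G j)))\<^sup>2)"
  define u where "u = (\<Sum>j\<in>J. lincomb \<Phi> (create (e j) (G j)))"
  define B where "B i j = lincomb \<Phi> (annihilate q (e i) (G j))" for i j
  have S0: "0 \<le> S" by (simp add: S_def sum_nonneg)
  have "\<forall>(c, fs)\<in>set (G j). length fs < n" for j
    using Suc.prems by (fastforce simp: G_def annihilate_def length_delete_nth)
  then have IH: "(\<Sum>i\<in>J. (norm (B i j))\<^sup>2) \<le> C * (norm (lincomb \<Phi> (G j)))\<^sup>2" for j
    unfolding B_def by (rule Suc.IH)
  have "complex_of_real S = (\<Sum>j\<in>J. cinner (lincomb \<Phi> (G j)) (lincomb \<Phi> (G j)))"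
    by (simp add: S_def cinner_self)
  also have "\<dots> = cinner u (lincomb \<Phi> F)"
    unfolding u_def cinner_sum_left by (rule sum.cong) (simp_all only: cinner_create_left G_def)
  finally have "S = cmod (cinner u (lincomb \<Phi> F))"
    using S0 by (metis norm_of_real abs_of_nonneg)
  then have S_le: "S \<le> norm u * norm (lincomb \<Phi> F)"
    using complex_Cauchy_Schwarz by metis
  have "cinner u u = (\<Sum>j\<in>J. \<Sum>i\<in>J. cinner (lincomb \<Phi> (create (e j) (G j))) (lincomb \<Phi> (create (e i) (G i))))"
    unfolding u_def cinner_sum_left cinner_sum_right by (rule refl sum.swap)
  also have "\<dots> = (\<Sum>j\<in>J. \<Sum>i\<in>J. (if i = j then cinner (lincomb \<Phi> (G j)) (lincomb \<Phi> (G i)) else 0) +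
      complex_of_real q * cinner (B i j) (B j i))"
    by (intro sum.cong refl)
      (simp add: cinner_create_left lincomb_annihilate_create cinner_add_right cinner_scaleC_right e
        cinner_create_right[symmetric] B_def)
  also have "\<dots> = complex_of_real S + complex_of_real q * (\<Sum>j\<in>J. \<Sum>i\<in>J. cinner (B i j) (B j i))"
    using J by (simp add: sum.distrib sum_distrib_left S_def cinner_self)
  finally have "complex_of_real ((norm u)\<^sup>2) =
      complex_of_real S + complex_of_real q * (\<Sum>j\<in>J. \<Sum>i\<in>J. cinner (B i j) (B j i))"
    by (simp only: cinner_self)
  then have "(norm u)\<^sup>2 = cmod (complex_of_real S + complex_of_real q * (\<Sum>j\<in>J. \<Sum>i\<in>J. cinner (B i j) (B j i)))"
    by (metis norm_of_real abs_of_nonneg zero_le_power2)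
  also have "\<dots> \<le> cmod (complex_of_real S) + cmod (complex_of_real q * (\<Sum>j\<in>J. \<Sum>i\<in>J. cinner (B i j) (B j i)))"
    by (rule norm_triangle_ineq)
  also have "\<dots> = S + \<bar>q\<bar> * cmod (\<Sum>j\<in>J. \<Sum>i\<in>J. cinner (B i j) (B j i))"
    unfolding norm_mult norm_of_real using S0 by simp
  also have "cmod (\<Sum>j\<in>J. \<Sum>i\<in>J. cinner (B i j) (B j i)) \<le> C * S"
  proof -
    have "cmod (\<Sum>j\<in>J. \<Sum>i\<in>J. cinner (B i j) (B j i)) \<le>
        (\<Sum>j\<in>J. \<Sum>i\<in>J. ((norm (B i j))\<^sup>2 + (norm (B j i))\<^sup>2) / 2)"
    proof (intro sum_norm_le)
      fix i j
      have "cmod (cinner (B i j) (B j i)) \<le> norm (B i j) * norm (B j i)"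
        by (rule complex_Cauchy_Schwarz)
      also have "\<dots> \<le> ((norm (B i j))\<^sup>2 + (norm (B j i))\<^sup>2) / 2"
        using sum_squares_bound[of "norm (B i j)" "norm (B j i)"] by simp
      finally show "cmod (cinner (B i j) (B j i)) \<le> ((norm (B i j))\<^sup>2 + (norm (B j i))\<^sup>2) / 2" .
    qed
    also have "\<dots> = ((\<Sum>j\<in>J. \<Sum>i\<in>J. (norm (B i j))\<^sup>2) + (\<Sum>j\<in>J. \<Sum>i\<in>J. (norm (B j i))\<^sup>2)) / 2"
      by (simp add: sum.distrib sum_divide_distrib[symmetric])
    also have "(\<Sum>j\<in>J. \<Sum>i\<in>J. (norm (B j i))\<^sup>2) = (\<Sum>j\<in>J. \<Sum>i\<in>J. (norm (B i j))\<^sup>2)"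
      by (rule sum.swap)
    also have "((\<Sum>j\<in>J. \<Sum>i\<in>J. (norm (B i j))\<^sup>2) + (\<Sum>j\<in>J. \<Sum>i\<in>J. (norm (B i j))\<^sup>2)) / 2 =
        (\<Sum>j\<in>J. \<Sum>i\<in>J. (norm (B i j))\<^sup>2)" by simp
    also have "\<dots> \<le> (\<Sum>j\<in>J. C * (norm (lincomb \<Phi> (G j)))\<^sup>2)"
      by (intro sum_mono IH)
    finally show ?thesis by (simp add: S_def sum_distrib_left)
  qed
  finally have "(norm u)\<^sup>2 \<le> S + \<bar>q\<bar> * (C * S)" by (simp add: mult_left_mono)
  also have "\<dots> = (1 + \<bar>q\<bar> * C) * S" by (simp add: algebra_simps)
  finally have u_le: "(norm u)\<^sup>2 \<le> C * S" unfolding C_eq .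
  have "S \<le> C * (norm (lincomb \<Phi> F))\<^sup>2"
  proof (cases "S = 0")
    case False
    have "S\<^sup>2 \<le> (norm u * norm (lincomb \<Phi> F))\<^sup>2"
      using S_le S0 by (rule power_mono)
    also have "\<dots> \<le> C * S * (norm (lincomb \<Phi> F))\<^sup>2"
      unfolding power_mult_distrib using u_le by (rule mult_right_mono) simp
    finally have "S * S \<le> S * (C * (norm (lincomb \<Phi> F))\<^sup>2)"
      by (simp add: power2_eq_square mult_ac)
    then show ?thesis using False S0 by (simp add: mult_le_cancel_left)
  qed (use C_pos in simp)
  then show ?case by (simp add: S_def G_def)
qed

lemma sum_norm_annihilate_le:
  assumes J: "finite J" and e: "\<And>i j. i \<in> J \<Longrightarrow> j \<in> J \<Longrightarrow> cinner (e i) (e j) = (if i = j then 1 else 0)"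
  shows "(\<Sum>j\<in>J. (norm (lincomb \<Phi> (annihilate q (e j) F)))\<^sup>2) \<le> C * (norm (lincomb \<Phi> F))\<^sup>2"
proof (rule sum_norm_annihilate_le_degree[OF J e])
  have "length fs < Suc (Max (length ` snd ` set F))" if "(c, fs) \<in> set F" for c fs
    using that by (auto simp: less_Suc_eq_le intro!: Max_ge) (metis image_eqI snd_conv)
  then show "\<forall>(c, fs)\<in>set F. length fs < Suc (Max (length ` snd ` set F))" by blast
qed

text \<open>By the commutation relation \<open>\<parallel>a\<^sup>\<dagger> v\<parallel>\<^sup>2 = \<parallel>v\<parallel>\<^sup>2 + q \<parallel>a v\<parallel>\<^sup>2\<close> for a unit vector \<open>f\<close>.\<close>

lemma norm_create_le:
  assumes f: "cinner f f = 1"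
  shows "norm (lincomb (\<lambda>fs. \<Phi> (f # fs)) F) \<le> sqrt C * norm (lincomb \<Phi> F)"
proof -
  let ?v = "lincomb \<Phi> F" and ?a = "lincomb \<Phi> (annihilate q f F)" and ?c = "lincomb \<Phi> (create f F)"
  have a: "(norm ?a)\<^sup>2 \<le> C * (norm ?v)\<^sup>2"
    using sum_norm_annihilate_le[of "{()}" "\<lambda>_. f" F] f by simp
  have "cinner ?c ?c = cinner ?v ?v + complex_of_real q * cinner ?a ?a"
    by (simp add: cinner_create_left lincomb_annihilate_create cinner_simps f
        cinner_create_right[symmetric] del: cinner_self)
  then have "complex_of_real ((norm ?c)\<^sup>2) = complex_of_real ((norm ?v)\<^sup>2 + q * (norm ?a)\<^sup>2)"
    by (simp only: cinner_self of_real_add of_real_mult)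
  then have "(norm ?c)\<^sup>2 = (norm ?v)\<^sup>2 + q * (norm ?a)\<^sup>2"
    by (simp only: of_real_eq_iff)
  also have "\<dots> \<le> (norm ?v)\<^sup>2 + \<bar>q\<bar> * (C * (norm ?v)\<^sup>2)"
    using mult_mono[OF abs_ge_self a, of q] by simp
  also have "\<dots> = (1 + \<bar>q\<bar> * C) * (norm ?v)\<^sup>2" by (simp add: algebra_simps)
  also have "\<dots> = (sqrt C * norm ?v)\<^sup>2"
    using C_pos by (simp add: C_eq power_mult_distrib)
  finally have "norm ?c \<le> sqrt C * norm ?v"
    by (rule power2_le_imp_le) (use C_pos in simp)
  then show ?thesis by (simp add: lincomb_create)
qed

lemma creator_spec:
  assumes f: "cinner f f = 1"
  shows creator_bounded: "creator \<Phi> f \<in> bounded_operators"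
    and creator_apply: "blinfun_apply (creator \<Phi> f) (\<Phi> fs) = \<Phi> (f # fs)"
proof -
  let ?P = "\<lambda>x. x \<in> bounded_operators \<and> (\<forall>fs. blinfun_apply x (\<Phi> fs) = \<Phi> (f # fs))"
  obtain T where "?P T"
    using exists_bounded_extension[OF total norm_create_le[OF f]] by blast
  then have "?P (creator \<Phi> f)"
    unfolding creator_def by (rule theI) (use blinfun_eq_on_total[OF _ _ total] \<open>?P T\<close> in auto)
  then show "creator \<Phi> f \<in> bounded_operators" "blinfun_apply (creator \<Phi> f) (\<Phi> fs) = \<Phi> (f # fs)"
    by auto
qed

lemma bounded_operator_lincomb:
  "x \<in> bounded_operators \<Longrightarrow> blinfun_apply x (lincomb y F) = lincomb (\<lambda>i. blinfun_apply x (y i)) F"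
  by (induction F) (auto simp: blinfun.add_right bounded_operators_apply_scaleC blinfun.zero_right)

lemma annihilator_bounded: "cinner f f = 1 \<Longrightarrow> annihilator \<Phi> f \<in> bounded_operators"
  unfolding annihilator_def by (intro bounded_operators_adjoint creator_bounded)

lemma creator_lincomb:
  "cinner f f = 1 \<Longrightarrow> blinfun_apply (creator \<Phi> f) (lincomb \<Phi> F) = lincomb \<Phi> (create f F)"
  by (simp add: bounded_operator_lincomb creator_bounded creator_apply lincomb_create)

lemma annihilator_lincomb:
  assumes f: "cinner f f = 1"
  shows "blinfun_apply (annihilator \<Phi> f) (lincomb \<Phi> F) = lincomb \<Phi> (annihilate q f F)"
proof (rule cinner_eqI_total[OF total])
  fix gs
  have "cinner (blinfun_apply (annihilator \<Phi> f) (lincomb \<Phi> F)) (\<Phi> gs) = cinner (lincomb \<Phi> F) (\<Phi> (f # gs))"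
    unfolding annihilator_def by (simp add: cinner_adjoint_left creator_bounded creator_apply f)
  also have "\<dots> = cinner (lincomb \<Phi> (annihilate q f F)) (\<Phi> gs)"
    using cinner_create_right[of F f "[(1, gs)]"] by (simp add: create_def)
  finally show "cinner (blinfun_apply (annihilator \<Phi> f) (lincomb \<Phi> F)) (\<Phi> gs) =
      cinner (lincomb \<Phi> (annihilate q f F)) (\<Phi> gs)" .
qed

lemma annihilator_vacuum: "cinner f f = 1 \<Longrightarrow> blinfun_apply (annihilator \<Phi> f) (\<Phi> []) = 0"
  using annihilator_lincomb[of f "[(1, [])]"] by (simp add: annihilate_def)

lemma annihilator_creator:
  assumes f: "cinner f f = 1" and g: "cinner g g = 1"
  shows "annihilator \<Phi> f o\<^sub>L creator \<Phi> g =
    cinner g f *\<^sub>C id_blinfun + complex_of_real q *\<^sub>C (creator \<Phi> g o\<^sub>L annihilator \<Phi> f)"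
proof (rule blinfun_eq_on_total[OF _ _ total])
  fix fs
  show "blinfun_apply (annihilator \<Phi> f o\<^sub>L creator \<Phi> g) (\<Phi> fs) =
    blinfun_apply (cinner g f *\<^sub>C id_blinfun + complex_of_real q *\<^sub>C (creator \<Phi> g o\<^sub>L annihilator \<Phi> f)) (\<Phi> fs)"
    using lincomb_annihilate_create[of \<Phi> q f g "[(1, fs)]"]
    by (simp add: annihilator_lincomb[symmetric] creator_lincomb[symmetric] f g blinfun.add_left blinfun_apply_scaleC)
qed (auto intro!: bounded_operators_compose bounded_operators_add bounded_operators_scale bounded_operators_id
  annihilator_bounded creator_bounded f g)

text \<open>In operator terms: \<open>\<parallel>\<Sum>\<^sub>j a\<^sub>j\<^sup>\<dagger> a\<^sub>j\<parallel> \<le> C\<close> for every finite family of orthonormal vectors.\<close>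

lemma sum_norm_annihilator_le:
  assumes J: "finite J" and e: "\<And>i j. i \<in> J \<Longrightarrow> j \<in> J \<Longrightarrow> cinner (e i) (e j) = (if i = j then 1 else 0)"
  shows "(\<Sum>j\<in>J. (norm (blinfun_apply (annihilator \<Phi> (e j)) v))\<^sup>2) \<le> C * (norm v)\<^sup>2"
proof -
  obtain F where F: "(\<lambda>n. lincomb \<Phi> (F n)) \<longlonglongrightarrow> v"
    by (rule exists_lincomb_tendsto[OF total])
  show ?thesis
  proof (rule LIMSEQ_le)
    show "(\<lambda>n. \<Sum>j\<in>J. (norm (blinfun_apply (annihilator \<Phi> (e j)) (lincomb \<Phi> (F n))))\<^sup>2)
        \<longlonglongrightarrow> (\<Sum>j\<in>J. (norm (blinfun_apply (annihilator \<Phi> (e j)) v))\<^sup>2)"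
      by (intro tendsto_intros F)
    show "(\<lambda>n. C * (norm (lincomb \<Phi> (F n)))\<^sup>2) \<longlonglongrightarrow> C * (norm v)\<^sup>2"
      by (intro tendsto_intros F)
    have "(\<Sum>j\<in>J. (norm (blinfun_apply (annihilator \<Phi> (e j)) (lincomb \<Phi> (F n))))\<^sup>2) \<le> C * (norm (lincomb \<Phi> (F n)))\<^sup>2" for n
      using sum_norm_annihilate_le[OF J e, of "F n"] e by (simp add: annihilator_lincomb cong: sum.cong)
    then show "\<exists>N. \<forall>n\<ge>N. (\<Sum>j\<in>J. (norm (blinfun_apply (annihilator \<Phi> (e j)) (lincomb \<Phi> (F n))))\<^sup>2)
        \<le> C * (norm (lincomb \<Phi> (F n)))\<^sup>2" by blast
  qed
qed

end

section \<open>Second quantization of permutations\<close>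

definition permute_ell2 :: "('a \<Rightarrow> 'a) \<Rightarrow> 'a ell2 \<Rightarrow> 'a ell2" where
  "permute_ell2 g f = Abs_ell2 (\<lambda>i. Rep_ell2 f (inv g i))"

lemma Rep_permute_ell2:
  assumes g: "bij g"
  shows "Rep_ell2 (permute_ell2 g f) i = Rep_ell2 f (inv g i)"
proof -
  have "(\<lambda>i. (cmod (Rep_ell2 f (inv g i)))\<^sup>2) summable_on UNIV"
    using summable_on_reindex_bij_betw[OF bij_imp_bij_inv[OF g], of "\<lambda>i. (cmod (Rep_ell2 f i))\<^sup>2"] Rep_ell2[of f]
    by simp
  then show ?thesis by (simp add: permute_ell2_def Abs_ell2_inverse)
qed

lemma cinner_permute_ell2: "bij g \<Longrightarrow> cinner (permute_ell2 g f) (permute_ell2 g f') = cinner f f'"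
  using infsum_reindex_bij_betw[OF bij_imp_bij_inv, of g "\<lambda>i. Rep_ell2 f i * cnj (Rep_ell2 f' i)"]
  by (simp add: cinner_ell2.rep_eq Rep_permute_ell2)

lemma permute_ell2_ket:
  assumes "bij g"
  shows "permute_ell2 g (ket i) = ket (g i)"
proof -
  have "inv g j = i \<longleftrightarrow> j = g i" for j
    using assms by (metis bij_inv_eq_iff)
  then have "Rep_ell2 (permute_ell2 g (ket i)) = Rep_ell2 (ket (g i))"
    using assms by (intro ext) (simp add: Rep_permute_ell2 Rep_ket)
  then show ?thesis by (simp only: Rep_ell2_inject)
qed

lemma permute_ell2_inverse:
  assumes "bij g"
  shows "permute_ell2 g (permute_ell2 (inv g) f) = f" "permute_ell2 (inv g) (permute_ell2 g f) = f"
proof -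
  have "Rep_ell2 (permute_ell2 g (permute_ell2 (inv g) f)) = Rep_ell2 f"
    using assms by (intro ext) (simp add: Rep_permute_ell2 bij_imp_bij_inv inv_inv_eq bij_is_surj surj_f_inv_f)
  moreover have "Rep_ell2 (permute_ell2 (inv g) (permute_ell2 g f)) = Rep_ell2 f"
    using assms by (intro ext) (simp add: Rep_permute_ell2 bij_imp_bij_inv inv_inv_eq bij_is_inj inv_f_f)
  ultimately show "permute_ell2 g (permute_ell2 (inv g) f) = f" "permute_ell2 (inv g) (permute_ell2 g f) = f"
    by (simp_all only: Rep_ell2_inject)
qed

lemma cinner_lincomb_cong:
  assumes "\<And>i j. cinner (y i) (y j) = cinner (x i) (x j)"
  shows "cinner (lincomb y F) (lincomb y G) = cinner (lincomb x F) (lincomb x G)"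
proof -
  have "cinner (y i) (lincomb y G) = cinner (x i) (lincomb x G)" for i
    by (induction G) (auto simp: cinner_simps assms)
  then show ?thesis by (induction F) (auto simp: cinner_simps)
qed

locale int_fock = q_fock q \<Phi> for q and \<Phi> :: "int ell2 list \<Rightarrow> 'h::chilbert_space"
begin

text \<open>The unitary operator that applies a permutation of the basis to every tensor factor.\<close>

definition permute_fock :: "(int \<Rightarrow> int) \<Rightarrow> ('h \<Rightarrow>\<^sub>L 'h)" where
  "permute_fock g = (SOME T. T \<in> bounded_operators \<and> (\<forall>fs. blinfun_apply T (\<Phi> fs) = \<Phi> (map (permute_ell2 g) fs)))"

lemma cinner_\<Phi>_permute:
  "bij g \<Longrightarrow> cinner (\<Phi> (map (permute_ell2 g) fs)) (\<Phi> (map (permute_ell2 g) gs)) = cinner (\<Phi> fs) (\<Phi> gs)"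
  unfolding cinner_\<Phi> q_form_def
  by (auto intro!: sum.cong prod.cong simp: cinner_permute_ell2 permutes_in_image[of _ "{..<_}", simplified])

lemma permute_fock_spec:
  assumes g: "bij g"
  shows permute_fock_bounded: "permute_fock g \<in> bounded_operators"
    and permute_fock_apply: "blinfun_apply (permute_fock g) (\<Phi> fs) = \<Phi> (map (permute_ell2 g) fs)"
proof -
  let ?y = "\<lambda>fs. \<Phi> (map (permute_ell2 g) fs)"
  have le: "norm (lincomb ?y F) \<le> 1 * norm (lincomb \<Phi> F)" for F
  proof -
    have "complex_of_real ((norm (lincomb ?y F))\<^sup>2) = complex_of_real ((norm (lincomb \<Phi> F))\<^sup>2)"
      using cinner_lincomb_cong[of ?y \<Phi> F F] cinner_\<Phi>_permute[OF g] by (simp only: cinner_self)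
    then have "(norm (lincomb ?y F))\<^sup>2 = (norm (lincomb \<Phi> F))\<^sup>2"
      by (simp only: of_real_eq_iff)
    then show ?thesis by (simp add: power2_eq_iff_nonneg)
  qed
  have "\<exists>T. T \<in> bounded_operators \<and> (\<forall>fs. blinfun_apply T (\<Phi> fs) = ?y fs)"
  proof (rule exists_bounded_extension[OF total])
    show "norm (lincomb ?y F) \<le> 1 * norm (lincomb \<Phi> F)" for F
      by (rule le)
  qed blast
  then have "permute_fock g \<in> bounded_operators \<and> (\<forall>fs. blinfun_apply (permute_fock g) (\<Phi> fs) = ?y fs)"
    unfolding permute_fock_def by (rule someI_ex)
  then show "permute_fock g \<in> bounded_operators" "blinfun_apply (permute_fock g) (\<Phi> fs) = \<Phi> (map (permute_ell2 g) fs)"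
    by auto
qed

lemma permute_fock_inverse:
  assumes g: "bij g"
  shows "permute_fock g o\<^sub>L permute_fock (inv g) = id_blinfun" "permute_fock (inv g) o\<^sub>L permute_fock g = id_blinfun"
proof -
  note [simp] = g bij_imp_bij_inv[OF g] permute_fock_bounded permute_fock_apply
  show "permute_fock g o\<^sub>L permute_fock (inv g) = id_blinfun"
    by (rule blinfun_eq_on_total[OF _ _ total])
      (simp_all add: bounded_operators_compose bounded_operators_id o_def permute_ell2_inverse)
  show "permute_fock (inv g) o\<^sub>L permute_fock g = id_blinfun"
    by (rule blinfun_eq_on_total[OF _ _ total])
      (simp_all add: bounded_operators_compose bounded_operators_id o_def permute_ell2_inverse)
qed

lemma adjoint_permute_fock:
  assumes g: "bij g"
  shows "adjoint_op (permute_fock g) = permute_fock (inv g)"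
proof -
  have "adjoint_op (permute_fock g) o\<^sub>L permute_fock g = id_blinfun"
  proof (rule blinfun_eq_on_total[OF _ _ total])
    fix fs
    show "blinfun_apply (adjoint_op (permute_fock g) o\<^sub>L permute_fock g) (\<Phi> fs) = blinfun_apply id_blinfun (\<Phi> fs)"
      by (rule cinner_eqI_total[OF total])
        (simp add: cinner_adjoint_left permute_fock_bounded permute_fock_apply g cinner_\<Phi>_permute)
  qed (simp_all add: bounded_operators_compose bounded_operators_adjoint permute_fock_bounded g bounded_operators_id)
  then have "(adjoint_op (permute_fock g) o\<^sub>L permute_fock g) o\<^sub>L permute_fock (inv g) = permute_fock (inv g)"
    by (simp add: blinfun_compose_id)
  then show ?thesis
    by (simp add: blinfun_compose_assoc permute_fock_inverse[OF g] blinfun_compose_id)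
qed

lemma norm_permute_fock_apply:
  assumes g: "bij g"
  shows "norm (blinfun_apply (permute_fock g) v) = norm v"
proof -
  have "blinfun_apply (permute_fock (inv g) o\<^sub>L permute_fock g) v = v" by (simp only: permute_fock_inverse[OF g]) simp
  then have "cinner (blinfun_apply (permute_fock g) v) (blinfun_apply (permute_fock g) v) = cinner v v"
    using cinner_adjoint_right[OF permute_fock_bounded[OF g], of v "blinfun_apply (permute_fock g) v"]
    by (simp add: adjoint_permute_fock[OF g] del: cinner_self)
  then have "(norm (blinfun_apply (permute_fock g) v))\<^sup>2 = (norm v)\<^sup>2"
    by (simp only: cinner_self of_real_eq_iff)
  then show ?thesis by (simp add: power2_eq_iff_nonneg)
qed

text \<open>The action of a permutation is spatial: it is conjugation by the operator above.\<close>

definition act :: "(int \<Rightarrow> int) \<Rightarrow> ('h \<Rightarrow>\<^sub>L 'h) \<Rightarrow> ('h \<Rightarrow>\<^sub>L 'h)" where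
  "act g x = permute_fock g o\<^sub>L (x o\<^sub>L permute_fock (inv g))"

lemma act_bounded: "bij g \<Longrightarrow> x \<in> bounded_operators \<Longrightarrow> act g x \<in> bounded_operators"
  by (simp add: act_def bounded_operators_compose permute_fock_bounded bij_imp_bij_inv)

lemma act_add: "act g (x + y) = act g x + act g y"
  by (simp add: act_def blinfun_compose_add_left blinfun_compose_add_right)

lemma act_scaleC: "bij g \<Longrightarrow> act g (c *\<^sub>C x) = c *\<^sub>C act g x"
  by (rule blinfun_eqI) (simp add: act_def blinfun_apply_scaleC bounded_operators_apply_scaleC permute_fock_bounded)

lemma act_compose:
  assumes g: "bij g"
  shows "act g (x o\<^sub>L y) = act g x o\<^sub>L act g y"
proof (rule blinfun_eqI)
  fix v
  have "blinfun_apply (permute_fock (inv g) o\<^sub>L permute_fock g) w = w" for w by (simp only: permute_fock_inverse[OF g]) simp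
  then show "blinfun_apply (act g (x o\<^sub>L y)) v = blinfun_apply (act g x o\<^sub>L act g y) v"
    by (simp add: act_def)
qed

lemma act_id: "bij g \<Longrightarrow> act g id_blinfun = id_blinfun"
  by (simp add: act_def blinfun_compose_id permute_fock_inverse)

lemma act_adjoint: "bij g \<Longrightarrow> x \<in> bounded_operators \<Longrightarrow> act g (adjoint_op x) = adjoint_op (act g x)"
  by (simp add: act_def adjoint_compose bounded_operators_compose permute_fock_bounded bij_imp_bij_inv adjoint_permute_fock
      inv_inv_eq blinfun_compose_assoc)

lemma act_act_inv:
  assumes g: "bij g"
  shows "act g (act (inv g) x) = x" "act (inv g) (act g x) = x"
proof -
  have "blinfun_apply (permute_fock (inv g) o\<^sub>L permute_fock g) w = w" "blinfun_apply (permute_fock g o\<^sub>L permute_fock (inv g)) w = w" for w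
    by (simp_all only: permute_fock_inverse[OF g]) simp_all
  then show "act g (act (inv g) x) = x" "act (inv g) (act g x) = x"
    using g by (auto intro!: blinfun_eqI simp: act_def inv_inv_eq)
qed

lemma norm_act_le:
  assumes g: "bij g"
  shows "norm (act g x) \<le> norm x"
proof (rule norm_blinfun_bound)
  show "norm (blinfun_apply (act g x) v) \<le> norm x * norm v" for v
    using norm_blinfun[of x "blinfun_apply (permute_fock (inv g)) v"]
    by (simp add: act_def norm_permute_fock_apply g bij_imp_bij_inv)
qed simp

lemma tendsto_act: "(f \<longlongrightarrow> x) F \<Longrightarrow> ((\<lambda>n. act g (f n)) \<longlongrightarrow> act g x) F"
  unfolding act_def
  by (intro bounded_bilinear.tendsto[OF bounded_bilinear_blinfun_compose] tendsto_const)

lemma ket_unit: "cinner (ket i) (ket i) = 1"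
  by (simp add: cinner_ket_ket)

lemma a_op_bounded: "a_op \<Phi> i \<in> bounded_operators"
  by (simp add: a_op_def annihilator_bounded ket_unit)

lemma adjoint_a_op: "adjoint_op (a_op \<Phi> i) = creator \<Phi> (ket i)"
  by (simp add: a_op_def annihilator_def adjoint_adjoint creator_bounded ket_unit)

lemma s_op_eq: "s_op \<Phi> i = a_op \<Phi> i + adjoint_op (a_op \<Phi> i)"
  by (simp add: s_op_def adjoint_a_op) (simp add: a_op_def)

lemma act_creator:
  assumes g: "bij g"
  shows "act g (creator \<Phi> (ket i)) = creator \<Phi> (ket (g i))"
proof (rule blinfun_eq_on_total[OF _ _ total])
  fix fs
  show "blinfun_apply (act g (creator \<Phi> (ket i))) (\<Phi> fs) = blinfun_apply (creator \<Phi> (ket (g i))) (\<Phi> fs)"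
    using g by (simp add: act_def permute_fock_apply creator_apply ket_unit bij_imp_bij_inv permute_ell2_ket o_def
        permute_ell2_inverse)
qed (simp_all add: act_bounded creator_bounded ket_unit g)

lemma act_a_op: "bij g \<Longrightarrow> act g (a_op \<Phi> i) = a_op \<Phi> (g i)"
  by (simp add: a_op_def annihilator_def act_adjoint creator_bounded ket_unit act_creator)

lemma act_s_op: "bij g \<Longrightarrow> act g (s_op \<Phi> i) = s_op \<Phi> (g i)"
  by (simp add: s_op_eq act_add act_adjoint a_op_bounded act_a_op)

text \<open>The operators that are mapped into the generated algebra form a \<open>C\<^sup>*\<close>-algebra, since the action is a
  continuous *-homomorphism.\<close>

lemma act_hull:
  assumes S: "S \<subseteq> bounded_operators" and g: "bij g" and act: "\<And>x. x \<in> S \<Longrightarrow> act g x \<in> S"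
    and x: "x \<in> unital_cstar_algebra hull S"
  shows "act g x \<in> unital_cstar_algebra hull S"
proof -
  let ?A = "unital_cstar_algebra hull S"
  have A: "unital_cstar_algebra ?A" by (rule unital_cstar_algebra_hull[OF S])
  let ?E = "{x \<in> bounded_operators. act g x \<in> ?A}"
  have "unital_cstar_algebra ?E"
    unfolding unital_cstar_algebra_def[of ?E]
  proof (intro conjI)
    show "closed ?E"
      unfolding closed_sequential_limits
    proof (intro allI impI, elim conjE)
      fix u l assume u: "\<forall>n. u n \<in> ?E" and l: "u \<longlonglongrightarrow> l"
      have "l \<in> bounded_operators"
        using u l closed_bounded_operators by (auto simp: closed_sequential_limits)
      moreover have "act g l \<in> ?A"
        using u by (intro closed_sequentially[OF cstar_closed[OF A] _ tendsto_act[OF l]]) blast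
      ultimately show "l \<in> ?E" by simp
    qed
    show "\<forall>x\<in>?E. adjoint_op x \<in> ?E"
      using A g by (auto simp: act_adjoint cstar_adjoint bounded_operators_adjoint)
  qed (use A g in \<open>auto simp: bounded_operators_id bounded_operators_add bounded_operators_compose
      bounded_operators_scale act_id act_add act_compose act_scaleC cstar_id cstar_add cstar_compose
      cstar_scaleC\<close>)
  moreover have "S \<subseteq> ?E"
    using S act hull_subset[of S unital_cstar_algebra] by blast
  ultimately have "?A \<subseteq> ?E" by (rule hull_minimal[rotated])
  then show ?thesis using x by blast
qed

lemma R_algebra: "unital_cstar_algebra (R_algebra \<Phi>)"
  unfolding R_algebra_def by (rule unital_cstar_algebra_hull) (auto simp: a_op_bounded)

lemma a_op_R_algebra: "a_op \<Phi> i \<in> R_algebra \<Phi>"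
  unfolding R_algebra_def by (rule hull_inc) simp

lemma act_R_algebra: "bij g \<Longrightarrow> x \<in> R_algebra \<Phi> \<Longrightarrow> act g x \<in> R_algebra \<Phi>"
  unfolding R_algebra_def by (rule act_hull) (auto simp: a_op_bounded act_a_op)

lemma s_op_R_algebra: "s_op \<Phi> i \<in> R_algebra \<Phi>"
  unfolding s_op_eq by (intro cstar_add cstar_adjoint R_algebra a_op_R_algebra)

lemma G_algebra: "unital_cstar_algebra (G_algebra \<Phi>)"
  unfolding G_algebra_def
  by (rule unital_cstar_algebra_hull) (use cstar_bounded[OF R_algebra] s_op_R_algebra in auto)

lemma act_G_algebra: "bij g \<Longrightarrow> x \<in> G_algebra \<Phi> \<Longrightarrow> act g x \<in> G_algebra \<Phi>"
  unfolding G_algebra_def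
  by (rule act_hull) (use cstar_bounded[OF R_algebra] s_op_R_algebra in \<open>auto simp: act_s_op\<close>)

lemma G_algebra_subset: "G_algebra \<Phi> \<subseteq> R_algebra \<Phi>"
  unfolding G_algebra_def
  by (rule hull_minimal) (auto simp: R_algebra s_op_R_algebra)

lemma star_automorphism_cong:
  assumes A: "unital_cstar_algebra A" and "\<And>x. x \<in> A \<Longrightarrow> \<alpha> x = \<beta> x"
  shows "star_automorphism A \<alpha> \<longleftrightarrow> star_automorphism A \<beta>"
  unfolding star_automorphism_def
  using assms bij_betw_cong[of A \<alpha> \<beta> A] by (simp add: cstar_add cstar_compose cstar_scaleC cstar_adjoint)

lemma star_automorphism_act:
  assumes g: "bij g"
  shows "star_automorphism (R_algebra \<Phi>) (act g)"
  unfolding star_automorphism_def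
proof (intro conjI)
  show "bij_betw (act g) (R_algebra \<Phi>) (R_algebra \<Phi>)"
    by (rule bij_betw_byWitness[of _ "act (inv g)"])
      (auto simp: act_act_inv g act_R_algebra bij_imp_bij_inv)
qed (use g cstar_bounded[OF R_algebra] in \<open>auto simp: act_add act_compose act_scaleC act_adjoint\<close>)

lemma perm_action_eq_act:
  assumes g: "bij g" and x: "x \<in> R_algebra \<Phi>"
  shows "perm_action \<Phi> g x = act g x"
proof -
  let ?A = "R_algebra \<Phi>"
  have "perm_action \<Phi> g = restrict (act g) ?A"
    unfolding perm_action_def
  proof (rule the_equality)
    show "restrict (act g) ?A \<in> extensional ?A \<and> star_automorphism ?A (restrict (act g) ?A) \<and>
        (\<forall>i. restrict (act g) ?A (a_op \<Phi> i) = a_op \<Phi> (g i))"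
      using star_automorphism_act[OF g] star_automorphism_cong[OF R_algebra, of "restrict (act g) ?A" "act g"]
      by (simp add: a_op_R_algebra act_a_op g)
    fix \<alpha> assume \<alpha>: "\<alpha> \<in> extensional ?A \<and> star_automorphism ?A \<alpha> \<and> (\<forall>i. \<alpha> (a_op \<Phi> i) = a_op \<Phi> (g i))"
    have "\<alpha> x = act g x" if "x \<in> ?A" for x
      by (rule star_automorphism_eq_on_hull[OF _ R_algebra_def _ _ _ that])
        (use \<alpha> star_automorphism_act[OF g] in \<open>auto simp: a_op_bounded act_a_op g\<close>)
    then show "\<alpha> = restrict (act g) ?A"
      using \<alpha> by (intro extensionalityI[of _ ?A]) auto
  qed
  then show ?thesis using x by simp
qed

end

section \<open>Averages over permutations\<close>

text \<open>An exchange of the block \<open>{-k, \<dots>, k}\<close> with the next block of equal length. Only finitely many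
  integers are moved, and yet the images of any fixed \<open>j\<close> under these permutations are distinct for all
  \<open>k \<ge> |j|\<close>.\<close>

definition block_swap :: "nat \<Rightarrow> int \<Rightarrow> int" where
  "block_swap k i = (if - int k \<le> i \<and> i \<le> int k then i + (2 * int k + 1)
    else if int k < i \<and> i \<le> 3 * int k + 1 then i - (2 * int k + 1) else i)"

lemma block_swap_involution: "block_swap k (block_swap k i) = i"
  by (auto simp: block_swap_def)

lemma bij_block_swap: "bij (block_swap k)"
  by (rule o_bij[of "block_swap k"]) (auto simp: block_swap_involution)

lemma block_swap_finitary: "block_swap k \<in> finitary_permutations"
proof -
  have "{i. block_swap k i \<noteq> i} \<subseteq> {- int k..3 * int k + 1}"
    by (auto simp: block_swap_def split: if_splits)
  then show ?thesis
    by (auto simp: finitary_permutations_def bij_block_swap intro: finite_subset)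
qed

lemma inj_on_block_swap: "inj_on (\<lambda>k. block_swap k j) {nat \<bar>j\<bar>..}"
  by (rule inj_onI) (auto simp: block_swap_def abs_le_iff nat_le_iff split: if_splits)

context int_fock
begin

lemma norm_vacuum: "norm (\<Phi> []) = 1"
proof -
  have "{\<pi>. \<pi> permutes {..<0::nat}} = {id}" by auto
  moreover have "inversions 0 id = 0" by (simp add: inversions_def)
  ultimately have "cinner (\<Phi> []) (\<Phi> []) = 1" by (simp add: cinner_\<Phi> q_form_def)
  then have "complex_of_real ((norm (\<Phi> []))\<^sup>2) = complex_of_real 1"
    by (simp only: cinner_self of_real_1)
  then have "(norm (\<Phi> []))\<^sup>2 = 1" by (simp only: of_real_eq_iff)
  then show ?thesis using norm_ge_zero[of "\<Phi> []"] by (auto simp: power2_eq_1_iff)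
qed

text \<open>The vacuum expectation on all operators; on an algebra it agrees with \<^const>\<open>vacuum_state\<close>.\<close>

definition \<omega> :: "('h \<Rightarrow>\<^sub>L 'h) \<Rightarrow> complex" where
  "\<omega> x = cinner (blinfun_apply x (\<Phi> [])) (\<Phi> [])"

lemma \<omega>_add: "\<omega> (x + y) = \<omega> x + \<omega> y" and \<omega>_scaleC: "\<omega> (c *\<^sub>C x) = c * \<omega> x"
  by (simp_all add: \<omega>_def blinfun.add_left blinfun_apply_scaleC cinner_simps)

lemma \<omega>_id: "\<omega> id_blinfun = 1"
  by (simp add: \<omega>_def cinner_self norm_vacuum)

lemma \<omega>_adjoint: "x \<in> bounded_operators \<Longrightarrow> \<omega> (adjoint_op x) = cnj (\<omega> x)"
  by (simp add: \<omega>_def cinner_adjoint_left) (rule cinner_commute)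

lemma \<omega>_bounded: "cmod (\<omega> x) \<le> norm x"
  using complex_Cauchy_Schwarz[of "blinfun_apply x (\<Phi> [])" "\<Phi> []"] norm_blinfun[of x "\<Phi> []"]
  by (simp add: \<omega>_def norm_vacuum)

lemma \<omega>_act:
  assumes g: "bij g"
  shows "\<omega> (act g x) = \<omega> x"
proof -
  have v: "blinfun_apply (permute_fock g) (\<Phi> []) = \<Phi> []" if "bij g" for g
    using that by (simp add: permute_fock_apply)
  have "\<omega> (act g x) = cinner (blinfun_apply x (\<Phi> [])) (blinfun_apply (adjoint_op (permute_fock g)) (\<Phi> []))"
    by (simp add: \<omega>_def act_def v bij_imp_bij_inv cinner_adjoint_right permute_fock_bounded g)
  then show ?thesis by (simp add: adjoint_permute_fock v bij_imp_bij_inv g \<omega>_def)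
qed

definition avg :: "nat \<Rightarrow> ('h \<Rightarrow>\<^sub>L 'h) \<Rightarrow> ('h \<Rightarrow>\<^sub>L 'h)" where
  "avg n x = (1 / real n) *\<^sub>R (\<Sum>k<n. act (block_swap k) x)"

definition deviation :: "nat \<Rightarrow> ('h \<Rightarrow>\<^sub>L 'h) \<Rightarrow> ('h \<Rightarrow>\<^sub>L 'h)" where
  "deviation n x = avg n x - \<omega> x *\<^sub>C id_blinfun"

lemma avg_add: "avg n (x + y) = avg n x + avg n y"
  by (simp add: avg_def act_add sum.distrib scaleR_add_right)

lemma scaleR_scaleC_commute: "r *\<^sub>R c *\<^sub>C x = c *\<^sub>C r *\<^sub>R (x::'a::complex_vector)"
  by (simp add: scaleC_scaleC mult.commute flip: scaleC_of_real)

lemma avg_scaleC: "avg n (c *\<^sub>C x) = c *\<^sub>C avg n x"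
  by (simp add: avg_def act_scaleC bij_block_swap scaleR_scaleC_commute flip: complex_vector.scale_sum_right)

lemma norm_avg_le: "norm (avg n x) \<le> norm x"
proof (cases "n = 0")
  case False
  have "norm (\<Sum>k<n. act (block_swap k) x) \<le> (\<Sum>k<n. norm x)"
    by (intro sum_norm_le norm_act_le bij_block_swap)
  then show ?thesis using False by (simp add: avg_def divide_le_eq mult.commute)
qed (simp add: avg_def)

lemma avg_adjoint:
  assumes "x \<in> bounded_operators"
  shows "avg n (adjoint_op x) = adjoint_op (avg n x)"
proof -
  have "(\<Sum>k\<in>K. act (block_swap k) x) \<in> bounded_operators \<and>
    adjoint_op (\<Sum>k\<in>K. act (block_swap k) x) = (\<Sum>k\<in>K. act (block_swap k) (adjoint_op x))" if "finite K" for K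
    using that
  proof (induction K)
    case empty
    show ?case using bounded_operators_diff[OF assms assms] adjoint_diff[OF assms assms] by simp
  next
    case (insert k K)
    then show ?case
      by (simp add: adjoint_add bounded_operators_add act_bounded bij_block_swap assms act_adjoint)
  qed
  then show ?thesis by (simp add: avg_def adjoint_scaleR)
qed

lemma avg_bounded: "x \<in> bounded_operators \<Longrightarrow> avg n x \<in> bounded_operators"
  unfolding avg_def
  by (intro cstar_scaleR cstar_sum unital_cstar_algebra_bounded_operators act_bounded bij_block_swap)

lemma deviation_add: "deviation n (x + y) = deviation n x + deviation n y"
  by (simp add: deviation_def avg_add \<omega>_add scaleC_add_left)

lemma deviation_scaleC: "deviation n (c *\<^sub>C x) = c *\<^sub>C deviation n x"
  by (simp add: deviation_def avg_scaleC \<omega>_scaleC complex_vector.scale_right_diff_distrib scaleC_scaleC)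

lemma deviation_diff: "deviation n (x - y) = deviation n x - deviation n y"
  using deviation_add[of n "x - y" y] by simp

lemma norm_deviation_le: "norm (deviation n x) \<le> 2 * norm x"
proof -
  have "norm (\<omega> x *\<^sub>C (id_blinfun :: 'h \<Rightarrow>\<^sub>L 'h)) \<le> cmod (\<omega> x) * norm (id_blinfun :: 'h \<Rightarrow>\<^sub>L 'h)"
    by (rule norm_scaleC_blinfun)
  also have "\<dots> \<le> norm x * 1"
    by (intro mult_mono \<omega>_bounded norm_blinfun_id_le) auto
  finally show ?thesis
    unfolding deviation_def using norm_avg_le[of n x] norm_triangle_ineq4[of "avg n x" "\<omega> x *\<^sub>C id_blinfun"]
    by linarith
qed

lemma deviation_adjoint: "x \<in> bounded_operators \<Longrightarrow> deviation n (adjoint_op x) = adjoint_op (deviation n x)"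
  by (simp add: deviation_def avg_adjoint \<omega>_adjoint adjoint_diff avg_bounded adjoint_scale adjoint_id
      bounded_operators_scale bounded_operators_id)

text \<open>The operators whose averages converge in norm to their vacuum expectation.\<close>

definition mean_ergodic :: "('h \<Rightarrow>\<^sub>L 'h) set" where
  "mean_ergodic = {x. (\<lambda>n. deviation n x) \<longlonglongrightarrow> 0}"

lemma mean_ergodic_subspace: "complex_vector.subspace mean_ergodic"
proof (rule complex_vector.subspaceI)
  have "deviation n 0 = 0" for n using deviation_diff[of n 0 0] by simp
  then show "0 \<in> mean_ergodic" by (simp add: mean_ergodic_def)
  show "x + y \<in> mean_ergodic" if "x \<in> mean_ergodic" "y \<in> mean_ergodic" for x y
    using that tendsto_add[of "\<lambda>n. deviation n x" 0 _ "\<lambda>n. deviation n y" 0] by (simp add: mean_ergodic_def deviation_add)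
  show "c *\<^sub>C x \<in> mean_ergodic" if "x \<in> mean_ergodic" for c x
    using that bounded_linear.tendsto[OF bounded_linear_scaleC_blinfun, of "\<lambda>n. deviation n x" 0 _ c]
    by (simp add: mean_ergodic_def deviation_scaleC)
qed

text \<open>The deviations are bounded uniformly in \<open>n\<close>, so pointwise convergence to \<open>0\<close> passes to limits.\<close>

lemma mean_ergodic_closed: "closed mean_ergodic"
  unfolding closed_sequential_limits
proof (intro allI impI, elim conjE)
  fix u l assume u: "\<forall>m. u m \<in> mean_ergodic" and l: "u \<longlonglongrightarrow> l"
  have "(\<lambda>n. deviation n l) \<longlonglongrightarrow> 0"
  proof (rule LIMSEQ_I)
    fix e :: real assume "0 < e"
    then obtain m where m: "norm (u m - l) < e / 4"
      using LIMSEQ_D[OF l, of "e / 4"] by auto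
    have "(\<lambda>n. deviation n (u m)) \<longlonglongrightarrow> 0" using u by (simp add: mean_ergodic_def)
    then obtain N where N: "\<And>n. n \<ge> N \<Longrightarrow> norm (deviation n (u m)) < e / 2"
      using LIMSEQ_D[of _ 0 "e / 2"] \<open>0 < e\<close> by auto
    have "norm (deviation n l - 0) < e" if "n \<ge> N" for n
    proof -
      have "deviation n l = deviation n (u m) - deviation n (u m - l)" by (simp add: deviation_diff)
      then have "norm (deviation n l) \<le> norm (deviation n (u m)) + norm (deviation n (u m - l))"
        by (metis norm_triangle_ineq4)
      then show ?thesis using N[OF that] norm_deviation_le[of n "u m - l"] m by simp
    qed
    then show "\<exists>N. \<forall>n\<ge>N. norm (deviation n l - 0) < e" by blast
  qed
  then show "l \<in> mean_ergodic" by (simp add: mean_ergodic_def)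
qed

lemma mean_ergodic_id: "id_blinfun \<in> mean_ergodic"
proof -
  have "avg n id_blinfun = id_blinfun" if "n > 0" for n
    using that by (simp add: avg_def act_id bij_block_swap sum_constant_scaleR)
  then have "deviation n id_blinfun = 0" if "n > 0" for n
    using that by (simp add: deviation_def \<omega>_id)
  then show ?thesis
    unfolding mean_ergodic_def mem_Collect_eq
    by (intro tendsto_eventually eventually_mono[OF eventually_gt_at_top[of 0]])
qed

lemma mean_ergodic_adjoint:
  assumes "x \<in> mean_ergodic" "x \<in> bounded_operators"
  shows "adjoint_op x \<in> mean_ergodic"
proof -
  have "deviation n x \<in> bounded_operators" for n
    unfolding deviation_def using assms(2)
    by (intro bounded_operators_diff avg_bounded bounded_operators_scale bounded_operators_id)
  moreover have "(0 :: 'h \<Rightarrow>\<^sub>L 'h) \<in> bounded_operators" "adjoint_op (0 :: 'h \<Rightarrow>\<^sub>L 'h) = 0"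
    using bounded_operators_diff[OF assms(2,2)] adjoint_diff[OF assms(2,2)] by simp_all
  ultimately show ?thesis
    using tendsto_adjoint[of "\<lambda>n. deviation n x" 0] assms by (simp add: mean_ergodic_def deviation_adjoint)
qed

text \<open>From \<open>k = |j|\<close> on the permuted annihilators are distinct and are estimated together; each of the first
  \<open>|j|\<close> indices is estimated on its own. The bound is independent of \<open>n\<close>.\<close>

lemma sum_norm_a_op_block_swap_le:
  "(\<Sum>k<n. (norm (blinfun_apply (a_op \<Phi> (block_swap k j)) v))\<^sup>2) \<le> (real (nat \<bar>j\<bar>) + 1) * C * (norm v)\<^sup>2"
proof -
  define m where "m = nat \<bar>j\<bar>"
  define a where "a i = (norm (blinfun_apply (a_op \<Phi> i) v))\<^sup>2" for i
  have a: "(\<Sum>i\<in>J. a i) \<le> C * (norm v)\<^sup>2" if "finite J" for J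
    using sum_norm_annihilator_le[OF that, of ket v] by (simp add: a_def a_op_def cinner_ket_ket)
  have "(\<Sum>k<n. a (block_swap k j)) \<le> (\<Sum>k\<in>{..<m} \<union> {m..<n}. a (block_swap k j))"
    by (rule sum_mono2) (auto simp: a_def)
  also have "\<dots> = (\<Sum>k<m. a (block_swap k j)) + (\<Sum>k\<in>{m..<n}. a (block_swap k j))"
    by (rule sum.union_disjoint) auto
  also have "(\<Sum>k\<in>{m..<n}. a (block_swap k j)) = (\<Sum>i\<in>(\<lambda>k. block_swap k j) ` {m..<n}. a i)"
    by (subst sum.reindex) (auto simp: m_def intro: inj_on_subset[OF inj_on_block_swap[of j]])
  also have "\<dots> \<le> C * (norm v)\<^sup>2" by (intro a) simp
  also have "(\<Sum>k<m. a (block_swap k j)) \<le> (\<Sum>k<m. C * (norm v)\<^sup>2)"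
    using a[of "{_}"] by (intro sum_mono) simp
  finally show ?thesis by (simp add: a_def m_def algebra_simps)
qed

text \<open>The estimate that drives the proof: the Cauchy-Schwarz inequality bounds the sum of the \<open>n\<close> operators
  \<open>\<alpha>\<^sub>k(y) a\<^sub>k\<close>, with \<open>a\<^sub>k\<close> the permuted annihilator, by \<open>\<parallel>y\<parallel>\<close> times the square root of \<open>n\<close> and a constant.
  Division by \<open>n\<close> leaves a null sequence.\<close>

lemma mean_ergodic_compose_a_op:
  assumes y: "y \<in> bounded_operators"
  shows "y o\<^sub>L a_op \<Phi> j \<in> mean_ergodic"
proof -
  define B where "B = norm y * sqrt ((real (nat \<bar>j\<bar>) + 1) * C)"
  have B: "B \<ge> 0" using C_pos by (simp add: B_def)
  have "norm (\<Sum>k<n. act (block_swap k) (y o\<^sub>L a_op \<Phi> j)) \<le> B * sqrt n" for n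
  proof (rule norm_blinfun_bound)
    fix v
    define s where "s = (\<Sum>k<n. norm (blinfun_apply (a_op \<Phi> (block_swap k j)) v))"
    have "s\<^sup>2 \<le> (\<Sum>k<n. (norm (blinfun_apply (a_op \<Phi> (block_swap k j)) v))\<^sup>2) * real (card {..<n})"
      unfolding s_def by (rule sum_squared_le_sum_of_squares)
    also have "\<dots> \<le> (real (nat \<bar>j\<bar>) + 1) * C * (norm v)\<^sup>2 * real n"
      using sum_norm_a_op_block_swap_le[of j v n] by (simp add: mult_right_mono)
    also have "\<dots> = (sqrt ((real (nat \<bar>j\<bar>) + 1) * C) * sqrt n * norm v)\<^sup>2"
      using C_pos by (simp add: power_mult_distrib real_sqrt_pow2 mult_ac)
    finally have s: "s \<le> sqrt ((real (nat \<bar>j\<bar>) + 1) * C) * sqrt n * norm v"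
      by (rule power2_le_imp_le) (use C_pos in simp)
    have "norm (blinfun_apply (\<Sum>k<n. act (block_swap k) (y o\<^sub>L a_op \<Phi> j)) v) =
        norm (\<Sum>k<n. blinfun_apply (act (block_swap k) y) (blinfun_apply (a_op \<Phi> (block_swap k j)) v))"
      by (simp add: blinfun.sum_left act_compose act_a_op bij_block_swap)
    also have "\<dots> \<le> (\<Sum>k<n. norm y * norm (blinfun_apply (a_op \<Phi> (block_swap k j)) v))"
    proof (rule sum_norm_le)
      fix k
      show "norm (blinfun_apply (act (block_swap k) y) (blinfun_apply (a_op \<Phi> (block_swap k j)) v))
          \<le> norm y * norm (blinfun_apply (a_op \<Phi> (block_swap k j)) v)"
        by (rule order_trans[OF norm_blinfun]) (intro mult_right_mono norm_act_le bij_block_swap norm_ge_zero)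
    qed
    also have "\<dots> = norm y * s" by (simp add: s_def sum_distrib_left)
    also have "\<dots> \<le> B * sqrt n * norm v"
      using mult_left_mono[OF s, of "norm y"] by (simp add: B_def mult_ac)
    finally show "norm (blinfun_apply (\<Sum>k<n. act (block_swap k) (y o\<^sub>L a_op \<Phi> j)) v) \<le> B * sqrt n * norm v" .
  qed (use B in simp)
  then have "norm (avg n (y o\<^sub>L a_op \<Phi> j)) \<le> 1 / real n * (B * sqrt n)" for n
    by (simp add: avg_def divide_right_mono)
  moreover have "1 / real n * (B * sqrt n) = B * (1 / sqrt n)" for n
    by (cases "n = 0") (auto simp: field_simps)
  moreover have "\<omega> (y o\<^sub>L a_op \<Phi> j) = 0"
    by (simp add: \<omega>_def a_op_def annihilator_vacuum ket_unit cinner_zero_left blinfun.zero_right)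
  ultimately have le: "norm (deviation n (y o\<^sub>L a_op \<Phi> j)) \<le> B * (1 / sqrt n)" for n
    by (simp add: deviation_def)
  have "(\<lambda>n. 1 / sqrt (real n)) \<longlonglongrightarrow> 0"
    by (intro tendsto_divide_0[OF tendsto_const] filterlim_at_top_imp_at_infinity
        filterlim_compose[OF sqrt_at_top] filterlim_real_sequentially)
  from tendsto_mult_right[OF this, of B]
  have null: "(\<lambda>n. B * (1 / sqrt (real n))) \<longlonglongrightarrow> 0" by simp
  have "(\<lambda>n. deviation n (y o\<^sub>L a_op \<Phi> j)) \<longlonglongrightarrow> 0"
    by (rule Lim_null_comparison[OF _ null]) (intro always_eventually allI le)
  then show ?thesis by (simp add: mean_ergodic_def)
qed

text \<open>Wick ordered words: all creators stand to the left of all annihilators.\<close>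

definition wick :: "int list \<Rightarrow> int list \<Rightarrow> ('h \<Rightarrow>\<^sub>L 'h)" where
  "wick I J = foldr (\<lambda>i x. creator \<Phi> (ket i) o\<^sub>L x) I (foldr (\<lambda>j x. a_op \<Phi> j o\<^sub>L x) J id_blinfun)"

lemma wick_Cons: "wick (i # I) J = creator \<Phi> (ket i) o\<^sub>L wick I J"
  and wick_Nil_Cons: "wick [] (j # J) = a_op \<Phi> j o\<^sub>L wick [] J"
  and wick_Nil_Nil: "wick [] [] = id_blinfun"
  by (simp_all add: wick_def)

lemma wick_append_last: "wick I (J @ [j]) = wick I J o\<^sub>L a_op \<Phi> j"
proof (induction I)
  case Nil
  show ?case
    by (induction J) (simp_all add: wick_Nil_Cons wick_Nil_Nil blinfun_compose_assoc blinfun_compose_id)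
qed (simp add: wick_Cons blinfun_compose_assoc)

lemma wick_bounded: "wick I J \<in> bounded_operators"
proof (induction I)
  case Nil
  show ?case
    by (induction J)
      (simp_all add: wick_Nil_Cons wick_Nil_Nil bounded_operators_id bounded_operators_compose a_op_bounded)
qed (simp add: wick_Cons bounded_operators_compose creator_bounded ket_unit)

text \<open>A word other than the identity ends with an annihilator, or it consists of creators only, in which
  case its adjoint ends with an annihilator.\<close>

lemma mean_ergodic_wick: "wick I J \<in> mean_ergodic"
proof (cases J rule: rev_cases)
  case (snoc J' j)
  then show ?thesis by (simp add: wick_append_last mean_ergodic_compose_a_op wick_bounded)
next
  case J: Nil
  show ?thesis
  proof (cases I)
    case Nil
    then show ?thesis by (simp add: J wick_Nil_Nil mean_ergodic_id)
  next
    case (Cons i I')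
    let ?x = "adjoint_op (wick I' J) o\<^sub>L a_op \<Phi> i"
    have "adjoint_op ?x = wick I J"
      by (simp add: Cons wick_Cons adjoint_compose adjoint_adjoint adjoint_a_op wick_bounded
          bounded_operators_adjoint a_op_bounded)
    moreover have "adjoint_op ?x \<in> mean_ergodic"
      by (intro mean_ergodic_adjoint mean_ergodic_compose_a_op bounded_operators_compose
          bounded_operators_adjoint wick_bounded a_op_bounded)
    ultimately show ?thesis by simp
  qed
qed

text \<open>The closed complex subspace spanned by the Wick ordered words, as a hull: inclusions into a closed
  subspace then reduce to the words.\<close>

definition wick_span :: "('h \<Rightarrow>\<^sub>L 'h) set" where
  "wick_span = (\<lambda>X. closed X \<and> complex_vector.subspace X) hull range (\<lambda>(I, J). wick I J)"

lemma wick_span: "closed wick_span" "complex_vector.subspace wick_span" "wick I J \<in> wick_span"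
proof -
  show "closed wick_span"
    unfolding wick_span_def hull_def by (rule closed_Inter) auto
  show "complex_vector.subspace wick_span"
    unfolding wick_span_def hull_def by (rule complex_vector.subspace_Inter) auto
  show "wick I J \<in> wick_span"
    unfolding wick_span_def by (rule hull_inc) (auto intro: range_eqI[of _ _ "(I, J)"])
qed

lemma wick_span_minimal:
  assumes "closed X" "complex_vector.subspace X" "\<And>I J. wick I J \<in> X"
  shows "wick_span \<subseteq> X"
  unfolding wick_span_def by (rule hull_minimal) (use assms in auto)

lemma compose_wick_span:
  assumes x: "x \<in> bounded_operators" and wick: "\<And>I J. x o\<^sub>L wick I J \<in> wick_span" and y: "y \<in> wick_span"
  shows "x o\<^sub>L y \<in> wick_span"
proof -
  let ?E = "{y. x o\<^sub>L y \<in> wick_span}"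
  have scale: "x o\<^sub>L (c *\<^sub>C y) = c *\<^sub>C (x o\<^sub>L y)" for c y
    by (rule blinfun_eqI) (simp add: blinfun_apply_scaleC bounded_operators_apply_scaleC x)
  have "closed ?E"
    unfolding closed_sequential_limits
  proof (intro allI impI, elim conjE)
    fix u l assume u: "\<forall>n. u n \<in> ?E" and l: "u \<longlonglongrightarrow> l"
    have lim: "(\<lambda>n. x o\<^sub>L u n) \<longlonglongrightarrow> (x o\<^sub>L l)"
      by (intro bounded_bilinear.tendsto[OF bounded_bilinear_blinfun_compose] tendsto_const l)
    have "x o\<^sub>L l \<in> wick_span"
      by (rule closed_sequentially[OF wick_span(1) _ lim]) (use u in blast)
    then show "l \<in> ?E" by simp
  qed
  moreover have "complex_vector.subspace ?E"
    using wick_span(2) by (auto simp: complex_vector.subspace_def blinfun_compose_add_right scale)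
  ultimately have "wick_span \<subseteq> ?E"
    using wick by (intro wick_span_minimal) auto
  then show ?thesis using y by blast
qed

lemma creator_wick_span: "y \<in> wick_span \<Longrightarrow> creator \<Phi> (ket i) o\<^sub>L y \<in> wick_span"
  by (rule compose_wick_span) (simp_all add: creator_bounded ket_unit wick_Cons[symmetric] wick_span(3))

text \<open>The commutation relation moves an annihilator past the creators of the word one by one.\<close>

lemma a_op_wick_span: "y \<in> wick_span \<Longrightarrow> a_op \<Phi> i o\<^sub>L y \<in> wick_span"
proof (rule compose_wick_span)
  fix I J
  show "a_op \<Phi> i o\<^sub>L wick I J \<in> wick_span"
  proof (induction I)
    case Nil
    then show ?case by (simp add: wick_Nil_Cons[symmetric] wick_span(3))
  next
    case (Cons k I)
    have "a_op \<Phi> i o\<^sub>L wick (k # I) J = (a_op \<Phi> i o\<^sub>L creator \<Phi> (ket k)) o\<^sub>L wick I J"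
      by (simp add: wick_Cons blinfun_compose_assoc)
    also have "\<dots> = cinner (ket k) (ket i) *\<^sub>C wick I J +
        complex_of_real q *\<^sub>C (creator \<Phi> (ket k) o\<^sub>L (a_op \<Phi> i o\<^sub>L wick I J))"
      by (rule blinfun_eqI)
        (simp add: a_op_def annihilator_creator ket_unit blinfun.add_left blinfun_apply_scaleC del: blinfun_apply_blinfun_compose add: blinfun_compose.rep_eq)
    also have "\<dots> \<in> wick_span"
      using Cons by (intro complex_vector.subspace_add complex_vector.subspace_scale wick_span creator_wick_span)
    finally show ?case .
  qed
qed (simp_all add: a_op_bounded)

text \<open>The operators \<open>x\<close> such that multiplication by \<open>x\<close> and by \<open>x\<^sup>*\<close> from the left preserves the closed span
  of the words form a \<open>C\<^sup>*\<close>-algebra that contains the annihilators. Every such \<open>x\<close> lies in the span, as the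
  product of \<open>x\<close> and the empty word.\<close>

lemma R_algebra_subset_wick_span: "R_algebra \<Phi> \<subseteq> wick_span"
proof -
  let ?P = "{x \<in> bounded_operators. \<forall>y\<in>wick_span. x o\<^sub>L y \<in> wick_span \<and> adjoint_op x o\<^sub>L y \<in> wick_span}"
  note subspace = complex_vector.subspace_add[OF wick_span(2)] complex_vector.subspace_scale[OF wick_span(2)]
  have scale: "(c *\<^sub>C x) o\<^sub>L y = c *\<^sub>C (x o\<^sub>L y)" for c and x y :: "'h \<Rightarrow>\<^sub>L 'h"
    by (rule blinfun_eqI) (simp add: blinfun_apply_scaleC)
  have "unital_cstar_algebra ?P"
    unfolding unital_cstar_algebra_def
  proof (intro conjI)
    show "closed ?P"
      unfolding closed_sequential_limits
    proof (intro allI impI, elim conjE)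
      fix u l assume u: "\<forall>n. u n \<in> ?P" and l: "u \<longlonglongrightarrow> l"
      have "l \<in> bounded_operators"
        using u l by (intro closed_sequentially[OF closed_bounded_operators _ l]) blast
      moreover have "l o\<^sub>L y \<in> wick_span" "adjoint_op l o\<^sub>L y \<in> wick_span" if "y \<in> wick_span" for y
      proof -
        have lim: "(\<lambda>n. u n o\<^sub>L y) \<longlonglongrightarrow> (l o\<^sub>L y)" "(\<lambda>n. adjoint_op (u n) o\<^sub>L y) \<longlonglongrightarrow> (adjoint_op l o\<^sub>L y)"
          using u by (auto intro!: bounded_bilinear.tendsto[OF bounded_bilinear_blinfun_compose]
              tendsto_const l tendsto_adjoint)
        show "l o\<^sub>L y \<in> wick_span"
          by (rule closed_sequentially[OF wick_span(1) _ lim(1)]) (use u that in blast)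
        show "adjoint_op l o\<^sub>L y \<in> wick_span"
          by (rule closed_sequentially[OF wick_span(1) _ lim(2)]) (use u that in blast)
      qed
      ultimately show "l \<in> ?P" by blast
    qed
  qed (auto simp: bounded_operators_id blinfun_compose_id adjoint_id bounded_operators_add
      bounded_operators_compose bounded_operators_scale bounded_operators_adjoint adjoint_add
      adjoint_compose adjoint_scale adjoint_adjoint blinfun_compose_add_left blinfun_compose_assoc scale subspace)
  moreover have "range (a_op \<Phi>) \<subseteq> ?P"
    by (auto simp: a_op_bounded a_op_wick_span adjoint_a_op creator_wick_span)
  ultimately have sub: "R_algebra \<Phi> \<subseteq> ?P"
    unfolding R_algebra_def by (rule hull_minimal[rotated])
  show ?thesis
  proof
    fix x assume "x \<in> R_algebra \<Phi>"
    then have "x o\<^sub>L wick [] [] \<in> wick_span"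
      using sub wick_span(3) by blast
    then show "x \<in> wick_span" by (simp only: wick_Nil_Nil blinfun_compose_id)
  qed
qed

lemma avg_tendsto_vacuum:
  assumes "x \<in> R_algebra \<Phi>"
  shows "(\<lambda>n. avg n x) \<longlonglongrightarrow> \<omega> x *\<^sub>C id_blinfun"
proof -
  have "wick_span \<subseteq> mean_ergodic"
    by (intro wick_span_minimal mean_ergodic_wick mean_ergodic_closed mean_ergodic_subspace)
  then have "x \<in> mean_ergodic" using assms R_algebra_subset_wick_span by blast
  then show ?thesis by (simp add: mean_ergodic_def deviation_def LIM_zero_iff)
qed

text \<open>An invariant state has the same value on an operator and on each of its averages, and by continuity
  also on their limit. The same argument serves every invariant subalgebra.\<close>

lemma symmetric_states_eq_vacuum:
  assumes A: "unital_cstar_algebra A" and sub: "A \<subseteq> R_algebra \<Phi>"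
    and act: "\<And>g x. bij g \<Longrightarrow> x \<in> A \<Longrightarrow> act g x \<in> A"
  shows "symmetric_states \<Phi> A = {vacuum_state \<Phi> A}"
proof (rule set_eqI, simp only: singleton_iff)
  have vac: "vacuum_state \<Phi> A x = \<omega> x" if "x \<in> A" for x
    using that by (simp add: vacuum_state_def \<omega>_def)
  have perm: "perm_action \<Phi> g x = act g x" "bij g" if "g \<in> finitary_permutations" "x \<in> A" for g x
    using that sub perm_action_eq_act[of g x] by (auto simp: finitary_permutations_def)
  fix \<phi>
  show "\<phi> \<in> symmetric_states \<Phi> A \<longleftrightarrow> \<phi> = vacuum_state \<Phi> A"
  proof
    assume \<phi>: "\<phi> = vacuum_state \<Phi> A"
    have "\<omega> (adjoint_op x o\<^sub>L x) = complex_of_real ((norm (blinfun_apply x (\<Phi> [])))\<^sup>2)" if "x \<in> A" for x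
      using that cstar_bounded[OF A] by (simp add: \<omega>_def cinner_adjoint_left cinner_self)
    then have "\<omega> (adjoint_op x o\<^sub>L x) \<in> \<real>\<^sub>\<ge>\<^sub>0" if "x \<in> A" for x
      using that by (simp only: nonneg_Reals_of_real_iff zero_le_power2)
    then have "\<phi> \<in> states A"
      using cstar_algebra_closure[OF A] unfolding states_def \<phi>
      by (simp add: vac \<omega>_add \<omega>_scaleC \<omega>_id) (simp add: vacuum_state_def)
    then show "\<phi> \<in> symmetric_states \<Phi> A"
      unfolding symmetric_states_def \<phi> using perm act by (simp add: vac \<omega>_act)
  next
    assume \<phi>: "\<phi> \<in> symmetric_states \<Phi> A"
    then have state: "\<phi> \<in> states A" by (simp add: symmetric_states_def)
    then have add: "\<phi> (x + y) = \<phi> x + \<phi> y" and scale: "\<phi> (c *\<^sub>C x) = c * \<phi> x"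
      and one: "\<phi> id_blinfun = 1" if "x \<in> A" "y \<in> A" for x y c
      using that by (auto simp: states_def)
    have zero: "(0 :: 'h \<Rightarrow>\<^sub>L 'h) \<in> A" "\<phi> 0 = 0"
      using cstar_diff[OF A cstar_id[OF A] cstar_id[OF A]] add[of 0 0] by simp_all
    have sum: "\<phi> (\<Sum>k\<in>K. f k) = (\<Sum>k\<in>K. \<phi> (f k))" if "\<And>k. f k \<in> A" for f and K :: "nat set"
      by (induction K rule: infinite_finite_induct) (simp_all add: zero add that cstar_sum[OF A])
    have "\<phi> x = \<omega> x" if x: "x \<in> A" for x
    proof -
      have act_x: "act (block_swap k) x \<in> A" for k using x by (simp add: act bij_block_swap)
      have "\<phi> (act (block_swap k) x) = \<phi> x" for k
        using \<phi> x perm(1)[OF block_swap_finitary x, of k] block_swap_finitary[of k]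
        by (simp add: symmetric_states_def) metis
      then have sum_x: "\<phi> (\<Sum>k<n. act (block_swap k) x) = of_nat n * \<phi> x" for n
        using sum[of "\<lambda>k. act (block_swap k) x" "{..<n}", OF act_x] by simp
      have sum_mem: "(\<Sum>k<n. act (block_swap k) x) \<in> A" for n
        by (intro cstar_sum A act_x)
      have avg: "\<phi> (avg n x) = \<phi> x" "avg n x \<in> A" if "n > 0" for n
      proof -
        show "avg n x \<in> A" unfolding avg_def by (intro cstar_scaleR A sum_mem)
        have "\<phi> (avg n x) = complex_of_real (1 / real n) * (of_nat n * \<phi> x)"
          using scale[OF sum_mem zero(1), of "complex_of_real (1 / real n)"]
          unfolding avg_def scaleC_of_real sum_x .
        then show "\<phi> (avg n x) = \<phi> x" using that by simp
      qed
      have "(\<lambda>n. norm (avg n x - \<omega> x *\<^sub>C id_blinfun)) \<longlonglongrightarrow> 0"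
        using x sub by (intro tendsto_norm_zero LIM_zero avg_tendsto_vacuum) auto
      from tendsto_mult_right[OF this, of 2]
      have lim: "(\<lambda>n. 2 * norm (avg n x - \<omega> x *\<^sub>C id_blinfun)) \<longlonglongrightarrow> 0" by simp
      have le: "cmod (\<phi> x - \<omega> x) \<le> 2 * norm (avg n x - \<omega> x *\<^sub>C id_blinfun)" if "n > 0" for n
      proof -
        have mem: "avg n x - \<omega> x *\<^sub>C id_blinfun \<in> A" "\<omega> x *\<^sub>C id_blinfun \<in> A"
          using A avg(2)[OF that] by (auto intro!: cstar_diff cstar_scaleC cstar_id)
        have "\<phi> x = \<phi> (avg n x - \<omega> x *\<^sub>C id_blinfun) + \<omega> x"
          using add[OF mem] avg(1)[OF that] scale[OF cstar_id[OF A] cstar_id[OF A]] one[OF x x] by simp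
        then show ?thesis using state_bounded[OF A state mem(1)] by simp
      qed
      have "cmod (\<phi> x - \<omega> x) \<le> 0"
        by (rule LIMSEQ_le_const[OF lim], rule exI[of _ 1]) (simp add: le)
      then show ?thesis by simp
    qed
    moreover have "\<phi> \<in> extensional A" using state by (simp add: states_def)
    ultimately show "\<phi> = vacuum_state \<Phi> A"
      by (intro extensionalityI[of _ A]) (auto simp: vac, simp add: vacuum_state_def)
  qed
qed

end

theorem proposition6p2:
  fixes q :: real and \<Phi> :: "int ell2 list \<Rightarrow> 'h::chilbert_space"
  assumes "-1 < q" and "q < 1"
    and "q_fock_space q \<Phi>"
  shows "symmetric_states \<Phi> (R_algebra \<Phi>) = {vacuum_state \<Phi> (R_algebra \<Phi>)} \<and>
    symmetric_states \<Phi> (G_algebra \<Phi>) = {vacuum_state \<Phi> (G_algebra \<Phi>)}"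
proof -
  interpret int_fock q \<Phi>
    using assms by unfold_locales
  show ?thesis
    by (intro conjI symmetric_states_eq_vacuum[OF R_algebra order_refl act_R_algebra]
        symmetric_states_eq_vacuum[OF G_algebra G_algebra_subset act_G_algebra])
qed

end
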